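(* For any $\zeta>0$ there is $J\in\mathbb{N}$ such that for any $\epsilon>0$ there is $\eta>0$ such that the following holds. Let $p\in[\zeta,1-\zeta]$, $\rho\in[\zeta,\tfrac12-\zeta]$ and $\lambda\in[\zeta,1]$, and let $f\colon\{0,1\}^n\to[0,1]$ and $g\colon\{0,1\}^n\to\{0,1\}$ satisfy $\|\mathrm{T}^{p}_{\rho p} f-\lambda g\|_1\le\eta$. Then either $f,g$ are $\epsilon$-close to the zero function, or there is a set $T\subseteq[n]$ of size at most $J$ such that: (i) $g$ is $\epsilon$-close to $\mathsf{AND}_T$; (ii) the function $\tilde f\colon\{0,1\}^T\to[0,1]$ given by $\tilde f(x)=\mathbb{E}_{\mathbf{y}\sim\mu_{\rho p}^{[n]\setminus T}}[f(\mathbf{y},x)]$ is $\epsilon$-close to $\rho^{-|T|}\lambda\cdot\mathsf{AND}_T$.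
   Context: $\mu_p$ denotes the $p$-biased product measure on $\{0,1\}^n$ (each coordinate is $1$ independently with probability $p$). For $f$ on $(\{0,1\}^n,\mu_{\rho p})$, the downward noise operator is $\mathrm{T}^{p}_{\rho p}f(x)=\mathbb{E}_{\mathbf{z}\sim\mu_\rho}[f(x\wedge\mathbf{z})]$, viewed as a function on $(\{0,1\}^n,\mu_p)$; $x\wedge z$ is coordinatewise AND. $\|\cdot\|_1$ of a function of $x$ is the $L_1$ norm with respect to $\mu_p$. Two functions are $\epsilon$-close if their $L_1$ distance with respect to the measure of their input space is at most $\epsilon$ ($\mu_p$ for $g$, $\mu_{\rho p}$ for $f$ and $\tilde f$). $\mathsf{AND}_T(x)=\bigwedge_{i\in T}x_i$. $(\mathbf{y},x)$ denotes the point of $\{0,1\}^n$ whose coordinates outside $T$ are $\mathbf{y}$ and inside $T$ are $x$. *)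

theory Defs
  imports "HOL-Probability.Probability"
begin

text \<open>
  The set of points of \<open>{0,1}\<^sup>A\<close> for a finite set \<open>A\<close> of coordinates. A point is
  a function on all of \<open>nat\<close> that is \<open>False\<close> outside \<open>A\<close>, the convention of
  \<^const>\<open>Pi_pmf\<close> with default value \<open>False\<close>.
\<close>
definition cube :: "nat set \<Rightarrow> (nat \<Rightarrow> bool) set" where
  "cube A = PiE_dflt A False (\<lambda>_. UNIV)"

text \<open>
  The \<open>p\<close>-biased product measure on \<open>{0,1}\<^sup>A\<close>. It is meant for \<open>p \<in> [0,1]\<close>:
  \<^const>\<open>bernoulli_pmf\<close> truncates its parameter to this interval.
\<close>
definition mu :: "nat set \<Rightarrow> real \<Rightarrow> (nat \<Rightarrow> bool) pmf" where
  "mu A p = Pi_pmf A False (\<lambda>_. bernoulli_pmf p)"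

definition L1_norm :: "nat set \<Rightarrow> real \<Rightarrow> ((nat \<Rightarrow> bool) \<Rightarrow> real) \<Rightarrow> real" where
  "L1_norm A p h = measure_pmf.expectation (mu A p) (\<lambda>x. \<bar>h x\<bar>)"

definition eps_close ::
  "nat set \<Rightarrow> real \<Rightarrow> real \<Rightarrow> ((nat \<Rightarrow> bool) \<Rightarrow> real) \<Rightarrow> ((nat \<Rightarrow> bool) \<Rightarrow> real) \<Rightarrow> bool" where
  "eps_close A p \<epsilon> h k \<longleftrightarrow> L1_norm A p (\<lambda>x. h x - k x) \<le> \<epsilon>"

text \<open>
  The downward noise operator, from functions on \<open>{0,1}\<^sup>A\<close> with the
  \<open>\<rho> p\<close>-biased measure to functions on \<open>{0,1}\<^sup>A\<close> with the \<open>p\<close>-biased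
  measure; as a map of functions it depends only on \<open>\<rho>\<close>.
\<close>
definition noise_down ::
  "nat set \<Rightarrow> real \<Rightarrow> ((nat \<Rightarrow> bool) \<Rightarrow> real) \<Rightarrow> (nat \<Rightarrow> bool) \<Rightarrow> real" where
  "noise_down A \<rho> f x = measure_pmf.expectation (mu A \<rho>) (\<lambda>z. f (\<lambda>i. x i \<and> z i))"

definition AND_fun :: "nat set \<Rightarrow> (nat \<Rightarrow> bool) \<Rightarrow> real" where
  "AND_fun T x = of_bool (\<forall>i\<in>T. x i)"

definition combine :: "nat set \<Rightarrow> (nat \<Rightarrow> bool) \<Rightarrow> (nat \<Rightarrow> bool) \<Rightarrow> nat \<Rightarrow> bool" where
  "combine T y x = (\<lambda>i. if i \<in> T then x i else y i)"

text \<open>The average of \<open>f\<close> over the \<open>q\<close>-biased coordinates in \<open>A - T\<close>, as a function on \<open>{0,1}\<^sup>T\<close>.\<close>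
definition avg_outside ::
  "nat set \<Rightarrow> nat set \<Rightarrow> real \<Rightarrow> ((nat \<Rightarrow> bool) \<Rightarrow> real) \<Rightarrow> (nat \<Rightarrow> bool) \<Rightarrow> real" where
  "avg_outside A T q f x = measure_pmf.expectation (mu (A - T) q) (\<lambda>y. f (combine T y x))"

end

theory Submission
  imports Defs
begin

text \<open>
  Write \<open>h = T f\<close>, and for \<open>\<tau> = 1 - \<sigma>\<close> slightly below \<open>1\<close> let \<open>M(W)\<close> be the average of \<open>h\<close> over random
  subsets of \<open>W\<close> in which each point survives with probability \<open>\<tau>\<close>. By Bessel's inequality the
  coefficients of \<open>h\<close> below a point are square summable with sum at most \<open>1\<close> for \<^emph>\<open>every\<close> point, because
  \<open>\<rho> < 1/2\<close>. Hence these averages have variance at most \<open>\<sigma>\<close>, so \<open>M\<close> is close to \<open>0\<close> or to \<open>\<lambda>\<close> wherever \<open>h\<close>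
  is nearly two-valued. Call \<open>i \<in> W\<close> pivotal if \<open>M(W)\<close> is large and \<open>M(W - {i})\<close> is small; there are boundedly many
  pivotal points. A linear form with square summable coefficients of size \<open>O(\<sigma>)\<close> exceeds a
  constant with probability only \<open>O(\<sigma>\<^sup>2)\<close>, by its fourth moment. So when a random \<open>\<sigma>\<close>-fraction of the
  points is deleted, the set of pivotal points is constant, and \<open>M\<close> stays large exactly if no pivotal
  point is deleted, up to probability \<open>O(\<sigma>\<^sup>2)\<close>; the impossibility of an OR of two coordinates, again due to
  \<open>\<rho> < 1/2\<close>, excludes new pivotal points. The spectral gap of the resampling of a \<open>\<sigma>\<close>-fraction is
  only \<open>\<sigma>\<close>, so some set \<open>T\<close> of pivotal points is a certificate: almost all points above \<open>T\<close> have \<open>g = 1\<close>.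
  Certificates are closed under intersection, and a certificate of \<open>g\<close> restricted to \<open>x\<^sub>i = 0\<close> for
  \<open>i \<in> T\<close> does not contain \<open>i\<close>; so a minimal certificate \<open>T\<close> makes \<open>g\<close> close to \<open>AND\<^sub>T\<close>. Inverting the
  noise operator on \<open>{0,1}\<^sup>T\<close> gives the claim about \<open>f\<close>.
\<close>

text \<open>The error \<sigma>^2 is forced: the spectral gap turns a probability e of mismatching
  labels into a variance of order e / \<sigma>, so an error of order \<sigma>, which is all that
  second moments of the linear part give, would be worthless. The fourth moment of a linear form is
  at most 3 s^2 (\<Sum>b^2)^2 + s \<Sum>b^4 with s = \<tau> (1 - \<tau>), and the terms of degree at
  least 2 have variance at most s^2. New pivotal points need more, as the number of candidates i is
  unbounded: the error for i is bounded by squared coefficients of sets containing i, and summing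
  over i counts a set U only card U times. The tail bound is therefore kept linear in the squared
  coefficients. A random set and its thinning have different biases, hence separate averages and
  labels on the two levels. The parameters are chosen in the order \<zeta>, \<epsilon>, \<sigma>,
  \<eta>; the size of T is bounded by the number of pivotal points, which is controlled by \<zeta>
  alone.\<close>

subsection \<open>Biased averages over subsets\<close>

text \<open>The expectation of \<open>\<phi>\<close> under the \<open>p\<close>-biased measure, with points encoded as subsets of \<open>A\<close>. As the
  noise below \<open>X\<close> is a biased measure on the subsets of \<open>X\<close>, the downward noise operator is
  \<open>\<lambda>X. bexp \<rho> X f\<close>.\<close>
definition bexp :: "real \<Rightarrow> 'a set \<Rightarrow> ('a set \<Rightarrow> real) \<Rightarrow> real" where
  "bexp p A \<phi> = (\<Sum>S\<in>Pow A. p ^ card S * (1 - p) ^ card (A - S) * \<phi> S)"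

lemma bexp_empty [simp]: "bexp p {} \<phi> = \<phi> {}"
  by (simp add: bexp_def)

lemma bexp_cong: "(\<And>S. S \<subseteq> A \<Longrightarrow> \<phi> S = \<psi> S) \<Longrightarrow> bexp p A \<phi> = bexp p A \<psi>"
  unfolding bexp_def by (intro sum.cong) auto

lemma bexp_add: "bexp p A (\<lambda>S. \<phi> S + \<psi> S) = bexp p A \<phi> + bexp p A \<psi>"
  by (simp add: bexp_def distrib_left sum.distrib)

lemma bexp_diff: "bexp p A (\<lambda>S. \<phi> S - \<psi> S) = bexp p A \<phi> - bexp p A \<psi>"
  by (simp add: bexp_def right_diff_distrib sum_subtractf)

lemma bexp_cmult: "bexp p A (\<lambda>S. c * \<phi> S) = c * bexp p A \<phi>"
  by (simp add: bexp_def sum_distrib_left mult_ac)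

lemma bexp_sum: "bexp p A (\<lambda>S. \<Sum>i\<in>I. \<phi> i S) = (\<Sum>i\<in>I. bexp p A (\<phi> i))"
  unfolding bexp_def by (simp add: sum_distrib_left sum.swap[of _ I])

lemma bexp_insert:
  assumes "finite A" "i \<notin> A"
  shows "bexp p (insert i A) \<phi> = p * bexp p A (\<lambda>S. \<phi> (insert i S)) + (1 - p) * bexp p A \<phi>"
proof -
  have fin: "finite S" if "S \<subseteq> A" for S using that assms(1) finite_subset by blast
  have inj: "inj_on (insert i) (Pow A)"
    using assms(2) by (intro inj_onI) (metis PowD insert_ident subsetD)
  have d: "insert i A - insert i S = A - S" if "S \<subseteq> A" for S using assms(2) that by auto
  have 2: "insert i A - S = insert i (A - S)" if "S \<subseteq> A" for S using assms(2) that by auto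
  have "bexp p (insert i A) \<phi> =
     (\<Sum>S\<in>Pow A. p ^ card S * (1 - p) ^ card (insert i A - S) * \<phi> S) +
     (\<Sum>S\<in>insert i ` Pow A. p ^ card S * (1 - p) ^ card (insert i A - S) * \<phi> S)"
    unfolding bexp_def Pow_insert using assms by (intro sum.union_disjoint) auto
  also have "(\<Sum>S\<in>Pow A. p ^ card S * (1 - p) ^ card (insert i A - S) * \<phi> S) = (1 - p) * bexp p A \<phi>"
    unfolding bexp_def sum_distrib_left
    by (intro sum.cong) (use assms 2 in \<open>auto simp: card_insert_if\<close>)
  also have "(\<Sum>S\<in>insert i ` Pow A. p ^ card S * (1 - p) ^ card (insert i A - S) * \<phi> S) =
      p * bexp p A (\<lambda>S. \<phi> (insert i S))"
    unfolding bexp_def sum_distrib_left sum.reindex[OF inj] o_def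
  proof (intro sum.cong refl, goal_cases)
    case (1 S)
    then have "i \<notin> S" "finite S" using assms fin by auto
    then show ?case using 1 d by simp
  qed
  finally show ?thesis by simp
qed

lemma bexp_remove:
  assumes "finite A" "i \<in> A"
  shows "bexp p A \<phi> = p * bexp p (A - {i}) (\<lambda>S. \<phi> (insert i S)) + (1 - p) * bexp p (A - {i}) \<phi>"
  using bexp_insert[of "A - {i}" i p \<phi>] assms by (simp add: insert_absorb)

lemma bexp_const [simp]: "finite A \<Longrightarrow> bexp p A (\<lambda>_. c) = c"
  by (induction rule: finite_induct) (simp_all add: bexp_insert algebra_simps)

lemma bexp_mono:
  assumes "0 \<le> p" "p \<le> 1" "\<And>S. S \<subseteq> A \<Longrightarrow> \<phi> S \<le> \<psi> S"
  shows "bexp p A \<phi> \<le> bexp p A \<psi>"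
  unfolding bexp_def using assms by (intro sum_mono mult_left_mono) auto

lemma bexp_nonneg: "0 \<le> p \<Longrightarrow> p \<le> 1 \<Longrightarrow> (\<And>S. S \<subseteq> A \<Longrightarrow> 0 \<le> \<phi> S) \<Longrightarrow> 0 \<le> bexp p A \<phi>"
  unfolding bexp_def by (intro sum_nonneg) auto

lemma bexp_le_const:
  assumes "finite A" "0 \<le> p" "p \<le> 1" "\<And>S. S \<subseteq> A \<Longrightarrow> \<phi> S \<le> c"
  shows "bexp p A \<phi> \<le> c"
  using bexp_mono[of p A \<phi> "\<lambda>_. c"] assms by simp

lemma bexp_abs_le:
  assumes "0 \<le> p" "p \<le> 1"
  shows "\<bar>bexp p A \<phi>\<bar> \<le> bexp p A (\<lambda>S. \<bar>\<phi> S\<bar>)"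
proof -
  have "bexp p A \<phi> \<le> bexp p A (\<lambda>S. \<bar>\<phi> S\<bar>)" using assms by (intro bexp_mono) auto
  moreover have "bexp p A (\<lambda>S. - 1 * \<phi> S) \<le> bexp p A (\<lambda>S. \<bar>\<phi> S\<bar>)" using assms by (intro bexp_mono) auto
  ultimately show ?thesis unfolding bexp_cmult by linarith
qed

text \<open>Independent survival probabilities multiply. This makes an average seen from one level
  an average of averages seen from the next.\<close>

lemma bexp_comp:
  assumes "finite A"
  shows "bexp p A (\<lambda>W. bexp r W f) = bexp (p * r) A f"
  using assms
proof (induction A arbitrary: f rule: finite_induct)
  case (insert i A)
  have "bexp p A (\<lambda>W. bexp r (insert i W) f) =
      bexp p A (\<lambda>W. r * bexp r W (\<lambda>S. f (insert i S)) + (1 - r) * bexp r W f)"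
    using insert.hyps by (intro bexp_cong bexp_insert) (auto intro: finite_subset)
  also have "\<dots> = r * bexp (p * r) A (\<lambda>S. f (insert i S)) + (1 - r) * bexp (p * r) A f"
    by (simp add: bexp_add bexp_cmult insert.IH)
  finally have *: "bexp p A (\<lambda>W. bexp r (insert i W) f) =
      r * bexp (p * r) A (\<lambda>S. f (insert i S)) + (1 - r) * bexp (p * r) A f" .
  show ?case unfolding bexp_insert[OF insert.hyps] * insert.IH by (simp add: algebra_simps)
qed simp

lemma bexp_union:
  assumes "finite A" "finite B" "A \<inter> B = {}"
  shows "bexp p (A \<union> B) \<phi> = bexp p A (\<lambda>S. bexp p B (\<lambda>R. \<phi> (S \<union> R)))"
  using assms
proof (induction A arbitrary: \<phi> rule: finite_induct)
  case (insert i A)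
  have "bexp p (insert i (A \<union> B)) \<phi> =
      p * bexp p (A \<union> B) (\<lambda>S. \<phi> (insert i S)) + (1 - p) * bexp p (A \<union> B) \<phi>"
    using insert by (intro bexp_insert) auto
  then show ?case using insert by (simp add: bexp_insert)
qed simp

lemma bexp_split:
  assumes "finite A" "K \<subseteq> A"
  shows "bexp p A \<phi> = bexp p K (\<lambda>R. bexp p (A - K) (\<lambda>S. \<phi> (R \<union> S)))"
proof -
  have "A = K \<union> (A - K)" using assms by auto
  then show ?thesis using bexp_union[of K "A - K" p \<phi>] assms by (metis Diff_disjoint finite_Diff finite_subset)
qed

text \<open>One term of the outer sum in \<open>bexp_split\<close> is kept and the others, being
  nonnegative, are dropped. A small average thus stays small after the coordinates in K are fixed,
  at a price that is bounded when card K is.\<close>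

lemma bexp_ge_atom:
  assumes "finite A" "K \<subseteq> A" "R \<subseteq> K" "0 \<le> p" "p \<le> 1" "\<And>S. S \<subseteq> A \<Longrightarrow> 0 \<le> \<phi> S"
  shows "p ^ card R * (1 - p) ^ card (K - R) * bexp p (A - K) (\<lambda>S. \<phi> (R \<union> S)) \<le> bexp p A \<phi>"
proof -
  define \<psi> where "\<psi> = (\<lambda>R. bexp p (A - K) (\<lambda>S. \<phi> (R \<union> S)))"
  have fK: "finite (Pow K)" using assms finite_subset by auto
  have "p ^ card R * (1 - p) ^ card (K - R) * \<psi> R \<le> bexp p K \<psi>"
    unfolding bexp_def
  proof (rule member_le_sum[OF _ _ fK])
    show "R \<in> Pow K" using assms by auto
    fix S assume "S \<in> Pow K - {R}"
    then show "0 \<le> p ^ card S * (1 - p) ^ card (K - S) * \<psi> S"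
      unfolding \<psi>_def using assms(2,4,5) by (intro mult_nonneg_nonneg bexp_nonneg zero_le_power assms(6)) auto
  qed
  then show ?thesis unfolding \<psi>_def using bexp_split[OF assms(1,2)] by metis
qed

lemma bexp_delete_le:
  assumes "finite A" "i \<in> A" "0 \<le> p" "p \<le> 1" "\<And>S. S \<subseteq> A \<Longrightarrow> 0 \<le> \<phi> S"
  shows "(1 - p) * bexp p (A - {i}) \<phi> \<le> bexp p A \<phi>"
  using bexp_ge_atom[of A "{i}" "{}" p \<phi>] assms by simp

lemma bexp_not_depends:
  assumes "finite A" "i \<in> A"
  shows "bexp p A (\<lambda>W. \<phi> (W - {i})) = bexp p (A - {i}) \<phi>"
proof -
  have "bexp p (A - {i}) (\<lambda>S. \<phi> (insert i S - {i})) = bexp p (A - {i}) \<phi>"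
    by (intro bexp_cong arg_cong[where f = \<phi>]) auto
  moreover have "bexp p (A - {i}) (\<lambda>S. \<phi> (S - {i})) = bexp p (A - {i}) \<phi>"
    by (intro bexp_cong arg_cong[where f = \<phi>]) auto
  ultimately show ?thesis using bexp_remove[OF assms, of p "\<lambda>W. \<phi> (W - {i})"]
    by (simp add: algebra_simps)
qed

lemma bexp_square_le:
  assumes "finite A" "0 \<le> p" "p \<le> 1"
  shows "(bexp p A \<phi>)\<^sup>2 \<le> bexp p A (\<lambda>S. (\<phi> S)\<^sup>2)"
proof -
  define m where "m = bexp p A \<phi>"
  have "0 \<le> bexp p A (\<lambda>S. (\<phi> S - m)\<^sup>2)" using assms by (intro bexp_nonneg) auto
  also have "(\<lambda>S. (\<phi> S - m)\<^sup>2) = (\<lambda>S. (\<phi> S)\<^sup>2 - 2 * m * \<phi> S + m\<^sup>2)"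
    by (auto simp: power2_eq_square algebra_simps)
  also have "bexp p A \<dots> = bexp p A (\<lambda>S. (\<phi> S)\<^sup>2) - m\<^sup>2"
    using assms by (simp add: bexp_add bexp_diff bexp_cmult m_def power2_eq_square)
  finally show ?thesis by (simp add: m_def)
qed

lemma bexp_delete_delete_le:
  assumes "finite A" "i \<in> A" "j \<in> A" "i \<noteq> j" "0 \<le> p" "p \<le> 1" "\<And>S. S \<subseteq> A \<Longrightarrow> 0 \<le> \<phi> S"
  shows "(1 - p)\<^sup>2 * bexp p (A - {i} - {j}) \<phi> \<le> bexp p A \<phi>"
proof -
  have "(1 - p) * bexp p (A - {i} - {j}) \<phi> \<le> bexp p (A - {i}) \<phi>"
    by (rule bexp_delete_le) (use assms in auto)
  then have "(1 - p) * ((1 - p) * bexp p (A - {i} - {j}) \<phi>) \<le> (1 - p) * bexp p (A - {i}) \<phi>"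
    using assms by (intro mult_left_mono) auto
  also have "\<dots> \<le> bexp p A \<phi>" by (rule bexp_delete_le) (use assms in auto)
  finally show ?thesis by (simp add: power2_eq_square mult.assoc)
qed

subsection \<open>Chaos expansions\<close>

text \<open>The centred indicators are left unnormalised, so that \<open>chi\<close> has second
  moment (\<tau> (1 - \<tau>))^(card S). All powers of \<sigma> gained from high degrees come from
  this.\<close>

definition chi :: "real \<Rightarrow> 'a set \<Rightarrow> 'a set \<Rightarrow> real" where
  "chi \<tau> S W = (\<Prod>i\<in>S. of_bool (i \<in> W) - \<tau>)"

definition chaos :: "real \<Rightarrow> 'a set \<Rightarrow> ('a set \<Rightarrow> real) \<Rightarrow> 'a set \<Rightarrow> real" where
  "chaos \<tau> Y a W = (\<Sum>S\<in>Pow Y. a S * chi \<tau> S W)"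

lemma chi_insert_right: "i \<notin> S \<Longrightarrow> chi \<tau> S (insert i W) = chi \<tau> S W"
  unfolding chi_def by (intro prod.cong) auto

lemma sum_Pow_insert:
  assumes "finite A" "i \<notin> A"
  shows "(\<Sum>S\<in>Pow (insert i A). F S) = (\<Sum>S\<in>Pow A. F S) + (\<Sum>S\<in>Pow A. F (insert i S))"
proof -
  have inj: "inj_on (insert i) (Pow A)"
    using assms(2) by (intro inj_onI) (metis PowD insert_ident subsetD)
  show ?thesis unfolding Pow_insert using assms
    by (subst sum.union_disjoint) (auto simp: sum.reindex[OF inj])
qed

lemma chaos_insert:
  assumes "finite Y" "i \<notin> Y"
  shows "chaos \<tau> (insert i Y) a W =
    chaos \<tau> Y a W + (of_bool (i \<in> W) - \<tau>) * chaos \<tau> Y (\<lambda>S. a (insert i S)) W"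
proof -
  have "chi \<tau> (insert i S) W = (of_bool (i \<in> W) - \<tau>) * chi \<tau> S W" if "S \<subseteq> Y" for S
    using that assms unfolding chi_def by (subst prod.insert) (auto intro: finite_subset)
  then show ?thesis unfolding chaos_def sum_Pow_insert[OF assms] sum_distrib_left
    by (intro arg_cong2[where f = "(+)"] sum.cong) auto
qed

lemma chaos_insert_right: "i \<notin> Y \<Longrightarrow> chaos \<tau> Y a (insert i W) = chaos \<tau> Y a W"
  unfolding chaos_def by (intro sum.cong refl arg_cong2[where f = "(*)"] chi_insert_right) auto

lemma bexp_chaos_square:
  assumes "finite Y"
  shows "bexp \<tau> Y (\<lambda>W. (chaos \<tau> Y a W)\<^sup>2) = (\<Sum>S\<in>Pow Y. (a S)\<^sup>2 * (\<tau> * (1 - \<tau>)) ^ card S)"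
  using assms
proof (induction Y arbitrary: a rule: finite_induct)
  case empty
  then show ?case by (simp add: chaos_def chi_def)
next
  case (insert i Y)
  let ?Q0 = "chaos \<tau> Y a" and ?Q1 = "chaos \<tau> Y (\<lambda>S. a (insert i S))"
  have "bexp \<tau> (insert i Y) (\<lambda>W. (chaos \<tau> (insert i Y) a W)\<^sup>2) =
     \<tau> * bexp \<tau> Y (\<lambda>W. (?Q0 W + (1 - \<tau>) * ?Q1 W)\<^sup>2) + (1 - \<tau>) * bexp \<tau> Y (\<lambda>W. (?Q0 W - \<tau> * ?Q1 W)\<^sup>2)"
    using insert.hyps
    by (subst bexp_insert)
      (auto simp: chaos_insert chaos_insert_right intro!: arg_cong2[where f = "(+)"] bexp_cong)
  also have "\<dots> = bexp \<tau> Y (\<lambda>W. \<tau> * (?Q0 W + (1 - \<tau>) * ?Q1 W)\<^sup>2 + (1 - \<tau>) * (?Q0 W - \<tau> * ?Q1 W)\<^sup>2)"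
    by (simp add: bexp_add bexp_cmult)
  \<comment> \<open>The mixed terms cancel because the factor of i has mean 0; its second moment is
    \<tau> (1 - \<tau>).\<close>
  also have "\<dots> = bexp \<tau> Y (\<lambda>W. (?Q0 W)\<^sup>2 + \<tau> * (1 - \<tau>) * (?Q1 W)\<^sup>2)"
    by (intro bexp_cong) algebra
  also have "\<dots> = (\<Sum>S\<in>Pow Y. (a S)\<^sup>2 * (\<tau> * (1 - \<tau>)) ^ card S) +
      \<tau> * (1 - \<tau>) * (\<Sum>S\<in>Pow Y. (a (insert i S))\<^sup>2 * (\<tau> * (1 - \<tau>)) ^ card S)"
    by (simp add: bexp_add bexp_cmult insert.IH)
  also have "\<dots> = (\<Sum>S\<in>Pow (insert i Y). (a S)\<^sup>2 * (\<tau> * (1 - \<tau>)) ^ card S)"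
    unfolding sum_Pow_insert[OF insert.hyps] sum_distrib_left
    by (intro arg_cong2[where f = "(+)"] sum.cong refl)
      (use insert.hyps in \<open>auto simp: card_insert_if finite_subset subset_iff\<close>)
  finally show ?case .
qed

text \<open>The condition on \<open>r\<close> says that the noise contracts each coordinate in the
  unnormalised basis \<open>chi\<close>, and it is what makes the coefficients square summable for every \<open>Y\<close>.\<close>
lemma bessel_exists:
  assumes "finite Y" "0 \<le> r" "r \<le> \<tau> * (1 - \<tau> * r)" "\<tau> * r \<le> 1" "0 \<le> \<tau>"
  shows "\<exists>a. (\<forall>W\<subseteq>Y. bexp r W f = chaos \<tau> Y a W) \<and>
     (\<Sum>S\<in>Pow Y. (a S)\<^sup>2) \<le> bexp (\<tau> * r) Y (\<lambda>S. (f S)\<^sup>2)"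
  using assms(1)
proof (induction Y arbitrary: f rule: finite_induct)
  case empty
  then show ?case by (intro exI[of _ "\<lambda>_. f {}"]) (auto simp: chaos_def chi_def)
next
  case (insert i Y)
  \<comment> \<open>In coordinate i, \<open>g0\<close> is the mean over a bit of bias \<tau> r and
    \<open>g1\<close> is r times the discrete derivative. The noise at a set without i averages
    \<open>g0\<close> - \<tau> \<open>g1\<close>, and at a set with i it averages \<open>g0\<close>
    + (1 - \<tau>) \<open>g1\<close>, which is the shape of \<open>chaos_insert\<close>.\<close>
  define g0 where "g0 = (\<lambda>S. (1 - \<tau> * r) * f S + \<tau> * r * f (insert i S))"
  define g1 where "g1 = (\<lambda>S. r * (f (insert i S) - f S))"
  obtain a0 where a0: "\<And>W. W \<subseteq> Y \<Longrightarrow> bexp r W g0 = chaos \<tau> Y a0 W"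
    "(\<Sum>S\<in>Pow Y. (a0 S)\<^sup>2) \<le> bexp (\<tau> * r) Y (\<lambda>S. (g0 S)\<^sup>2)" using insert.IH[of g0] by blast
  obtain a1 where a1: "\<And>W. W \<subseteq> Y \<Longrightarrow> bexp r W g1 = chaos \<tau> Y a1 W"
    "(\<Sum>S\<in>Pow Y. (a1 S)\<^sup>2) \<le> bexp (\<tau> * r) Y (\<lambda>S. (g1 S)\<^sup>2)" using insert.IH[of g1] by blast
  define a where "a = (\<lambda>S. if i \<in> S then a1 (S - {i}) else a0 S)"
  have aY: "a S = a0 S" "a (insert i S) = a1 S" if "S \<subseteq> Y" for S
    using that insert.hyps by (auto simp: a_def intro!: arg_cong[where f = a1])
  have ch: "chaos \<tau> Y a W = chaos \<tau> Y a0 W" "chaos \<tau> Y (\<lambda>S. a (insert i S)) W = chaos \<tau> Y a1 W" for W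
    unfolding chaos_def by (auto intro!: sum.cong simp: aY)
  have eq: "bexp r W f = chaos \<tau> (insert i Y) a W" if W: "W \<subseteq> insert i Y" for W
  proof (cases "i \<in> W")
    case False
    then have "W \<subseteq> Y" using W by auto
    have "bexp r W f = bexp r W (\<lambda>S. g0 S - \<tau> * g1 S)"
      by (intro bexp_cong) (simp add: g0_def g1_def algebra_simps)
    also have "\<dots> = bexp r W g0 - \<tau> * bexp r W g1" by (simp add: bexp_diff bexp_cmult)
    finally show ?thesis using False insert.hyps \<open>W \<subseteq> Y\<close> by (simp add: chaos_insert ch a0(1) a1(1))
  next
    case True
    define V where "V = W - {i}"
    have V: "V \<subseteq> Y" "i \<notin> V" "W = insert i V" "finite V"
      using W True insert.hyps by (auto simp: V_def dest: finite_subset)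
    have "bexp r W f = bexp r V (\<lambda>S. r * f (insert i S) + (1 - r) * f S)"
      using V by (simp add: bexp_insert bexp_add bexp_cmult)
    also have "\<dots> = bexp r V (\<lambda>S. g0 S + (1 - \<tau>) * g1 S)"
      by (intro bexp_cong) (simp add: g0_def g1_def algebra_simps)
    also have "\<dots> = bexp r V g0 + (1 - \<tau>) * bexp r V g1" by (simp add: bexp_add bexp_cmult)
    finally show ?thesis using V insert.hyps
      by (simp add: chaos_insert ch a0(1) a1(1) chaos_insert_right)
  qed
  have "(\<Sum>S\<in>Pow (insert i Y). (a S)\<^sup>2) = (\<Sum>S\<in>Pow Y. (a0 S)\<^sup>2) + (\<Sum>S\<in>Pow Y. (a1 S)\<^sup>2)"
    unfolding sum_Pow_insert[OF insert.hyps] by (intro arg_cong2[where f = "(+)"] sum.cong) (auto simp: aY)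
  also have "\<dots> \<le> bexp (\<tau> * r) Y (\<lambda>S. (g0 S)\<^sup>2 + (g1 S)\<^sup>2)"
    using a0(2) a1(2) by (simp add: bexp_add)
  also have "\<dots> \<le> bexp (\<tau> * r) Y (\<lambda>S. \<tau> * r * (f (insert i S))\<^sup>2 + (1 - \<tau> * r) * (f S)\<^sup>2)"
  proof (rule bexp_mono)
    fix S
    \<comment> \<open>By the contraction condition, r^2 is at most the variance of a bit of bias
      \<tau> r, so \<open>g0\<close>^2 + \<open>g1\<close>^2 is at most the mean of the squares over
      this bit.\<close>
    have "r * r \<le> r * (\<tau> * (1 - \<tau> * r))" using assms by (intro mult_left_mono) auto
    then have "(g1 S)\<^sup>2 \<le> (\<tau> * r * (1 - \<tau> * r)) * (f (insert i S) - f S)\<^sup>2"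
      unfolding g1_def power_mult_distrib
      by (intro mult_right_mono) (auto simp: power2_eq_square mult_ac)
    moreover have "\<tau> * r * (f (insert i S))\<^sup>2 + (1 - \<tau> * r) * (f S)\<^sup>2 =
       (g0 S)\<^sup>2 + (\<tau> * r * (1 - \<tau> * r)) * (f (insert i S) - f S)\<^sup>2"
      unfolding g0_def by algebra
    ultimately show "(g0 S)\<^sup>2 + (g1 S)\<^sup>2 \<le> \<tau> * r * (f (insert i S))\<^sup>2 + (1 - \<tau> * r) * (f S)\<^sup>2" by linarith
  qed (use assms in auto)
  also have "\<dots> = bexp (\<tau> * r) (insert i Y) (\<lambda>S. (f S)\<^sup>2)"
    using insert.hyps by (simp add: bexp_insert bexp_add bexp_cmult)
  finally show ?case using eq by (intro exI[of _ a]) auto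
qed

lemma bexp_linear_moments:
  fixes b :: "'a \<Rightarrow> real"
  assumes "finite Y" "0 \<le> \<tau>" "\<tau> \<le> 1"
  defines "L \<equiv> \<lambda>Y W. \<Sum>i\<in>Y. b i * (of_bool (i \<in> W) - \<tau>)"
  defines "s \<equiv> \<tau> * (1 - \<tau>)"
  shows "bexp \<tau> Y (L Y) = 0"
    and "bexp \<tau> Y (\<lambda>W. (L Y W)\<^sup>2) = s * (\<Sum>i\<in>Y. (b i)\<^sup>2)"
    and "bexp \<tau> Y (\<lambda>W. (L Y W) ^ 4) \<le> 3 * s\<^sup>2 * (\<Sum>i\<in>Y. (b i)\<^sup>2)\<^sup>2 + s * (\<Sum>i\<in>Y. (b i) ^ 4)"
proof -
  have "bexp \<tau> Y (L Y) = 0 \<and> bexp \<tau> Y (\<lambda>W. (L Y W)\<^sup>2) = s * (\<Sum>i\<in>Y. (b i)\<^sup>2)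
    \<and> bexp \<tau> Y (\<lambda>W. (L Y W) ^ 4) \<le> 3 * s\<^sup>2 * (\<Sum>i\<in>Y. (b i)\<^sup>2)\<^sup>2 + s * (\<Sum>i\<in>Y. (b i) ^ 4)"
    using assms(1)
  proof (induction Y rule: finite_induct)
    case empty
    then show ?case by (simp add: L_def)
  next
    case (insert i Y)
    define B where "B = (\<Sum>i\<in>Y. (b i)\<^sup>2)"
    have ins: "bexp \<tau> (insert i Y) (\<lambda>W. F (L (insert i Y) W)) =
        bexp \<tau> Y (\<lambda>W. \<tau> * F (L Y W + b i * (1 - \<tau>)) + (1 - \<tau>) * F (L Y W - b i * \<tau>))" for F :: "real \<Rightarrow> real"
    proof -
      have 1: "L (insert i Y) (insert i S) = L Y S + b i * (1 - \<tau>)" if "S \<subseteq> Y" for S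
        unfolding L_def using insert.hyps
        by (simp add: sum.insert) (auto intro!: sum.cong)
      have 2: "L (insert i Y) S = L Y S - b i * \<tau>" if "S \<subseteq> Y" for S
      proof -
        have "i \<notin> S" using that insert.hyps by auto
        then show ?thesis unfolding L_def using insert.hyps by simp
      qed
      have "bexp \<tau> (insert i Y) (\<lambda>W. F (L (insert i Y) W)) =
        \<tau> * bexp \<tau> Y (\<lambda>W. F (L Y W + b i * (1 - \<tau>))) + (1 - \<tau>) * bexp \<tau> Y (\<lambda>W. F (L Y W - b i * \<tau>))"
        using insert.hyps by (subst bexp_insert)
          (auto intro!: arg_cong2[where f = "(+)"] bexp_cong simp: 1 2)
      then show ?thesis by (simp add: bexp_add bexp_cmult)
    qed
    have m1: "bexp \<tau> (insert i Y) (L (insert i Y)) = 0"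
    proof -
      have "bexp \<tau> (insert i Y) (L (insert i Y)) = bexp \<tau> Y (\<lambda>W. L Y W)"
        using ins[of "\<lambda>x. x"] by (simp add: algebra_simps)
      then show ?thesis using insert.IH by simp
    qed
    have m2: "bexp \<tau> (insert i Y) (\<lambda>W. (L (insert i Y) W)\<^sup>2) = s * (\<Sum>i\<in>insert i Y. (b i)\<^sup>2)"
    proof -
      have "bexp \<tau> (insert i Y) (\<lambda>W. (L (insert i Y) W)\<^sup>2) = bexp \<tau> Y (\<lambda>W. (L Y W)\<^sup>2 + s * (b i)\<^sup>2)"
        unfolding ins[of "\<lambda>x. x\<^sup>2"] s_def by (intro bexp_cong) algebra
      then show ?thesis using insert by (simp add: bexp_add algebra_simps)
    qed
    \<comment> \<open>The fourth moment of one centred bit is s (\<tau>^3 + (1 - \<tau>)^3). The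
      third moments need no estimate, as they multiply the mean of L, which is 0.\<close>
    have mu4: "\<tau> ^ 3 + (1 - \<tau>) ^ 3 \<le> 1"
    proof -
      have "\<tau> ^ 3 \<le> \<tau>" "(1 - \<tau>) ^ 3 \<le> 1 - \<tau>"
        using power_decreasing[of 1 3 \<tau>] power_decreasing[of 1 3 "1 - \<tau>"] assms by auto
      then show ?thesis by linarith
    qed
    have s0: "0 \<le> s" using assms by (simp add: s_def)
    have "bexp \<tau> (insert i Y) (\<lambda>W. (L (insert i Y) W) ^ 4) =
        bexp \<tau> Y (\<lambda>W. (L Y W) ^ 4 + 6 * s * (b i)\<^sup>2 * (L Y W)\<^sup>2 + 4 * (b i) ^ 3 * (s * (1 - 2 * \<tau>)) * L Y W
           + (b i) ^ 4 * (s * (\<tau> ^ 3 + (1 - \<tau>) ^ 3)))"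
      unfolding ins[of "\<lambda>x. x ^ 4"] s_def by (intro bexp_cong) algebra
    also have "\<dots> = bexp \<tau> Y (\<lambda>W. (L Y W) ^ 4) + 6 * s * (b i)\<^sup>2 * (s * B)
           + (b i) ^ 4 * (s * (\<tau> ^ 3 + (1 - \<tau>) ^ 3))"
      using insert.IH insert.hyps by (simp add: bexp_add bexp_cmult B_def)
    also have "\<dots> \<le> 3 * s\<^sup>2 * B\<^sup>2 + s * (\<Sum>i\<in>Y. (b i) ^ 4) + 6 * s * (b i)\<^sup>2 * (s * B) + (b i) ^ 4 * (s * 1)"
      using insert.IH mu4 s0 unfolding B_def
      by (intro add_mono mult_left_mono) (auto simp: zero_le_even_power)
    also have "\<dots> \<le> 3 * s\<^sup>2 * ((b i)\<^sup>2 + B)\<^sup>2 + s * ((b i) ^ 4 + (\<Sum>i\<in>Y. (b i) ^ 4))"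
    proof -
      have "3 * s\<^sup>2 * ((b i)\<^sup>2 + B)\<^sup>2 + s * ((b i) ^ 4 + (\<Sum>i\<in>Y. (b i) ^ 4)) -
        (3 * s\<^sup>2 * B\<^sup>2 + s * (\<Sum>i\<in>Y. (b i) ^ 4) + 6 * s * (b i)\<^sup>2 * (s * B) + (b i) ^ 4 * (s * 1)) = 3 * s\<^sup>2 * (b i) ^ 4"
        by algebra
      moreover have "0 \<le> 3 * s\<^sup>2 * (b i) ^ 4" by (simp add: zero_le_even_power)
      ultimately show ?thesis by linarith
    qed
    also have "\<dots> = 3 * s\<^sup>2 * (\<Sum>i\<in>insert i Y. (b i)\<^sup>2)\<^sup>2 + s * (\<Sum>i\<in>insert i Y. (b i) ^ 4)"
      using insert.hyps by (simp add: B_def)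
    finally show ?case using m1 m2 by blast
  qed
  then show "bexp \<tau> Y (L Y) = 0"
    and "bexp \<tau> Y (\<lambda>W. (L Y W)\<^sup>2) = s * (\<Sum>i\<in>Y. (b i)\<^sup>2)"
    and "bexp \<tau> Y (\<lambda>W. (L Y W) ^ 4) \<le> 3 * s\<^sup>2 * (\<Sum>i\<in>Y. (b i)\<^sup>2)\<^sup>2 + s * (\<Sum>i\<in>Y. (b i) ^ 4)" by blast+
qed

section \<open>Coefficients as averages after deletions, and tails of expansions\<close>

lemma chaos_mean: "finite Y \<Longrightarrow> bexp \<tau> Y (chaos \<tau> Y a) = a {}"
proof (induction Y arbitrary: a rule: finite_induct)
  case empty
  then show ?case by (simp add: chaos_def chi_def)
next
  case (insert i Y)
  let ?Q0 = "chaos \<tau> Y a" and ?Q1 = "chaos \<tau> Y (\<lambda>S. a (insert i S))"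
  have "bexp \<tau> (insert i Y) (chaos \<tau> (insert i Y) a) =
     \<tau> * bexp \<tau> Y (\<lambda>W. ?Q0 W + (1 - \<tau>) * ?Q1 W) + (1 - \<tau>) * bexp \<tau> Y (\<lambda>W. ?Q0 W - \<tau> * ?Q1 W)"
    using insert.hyps
    by (subst bexp_insert)
      (auto simp: chaos_insert chaos_insert_right intro!: arg_cong2[where f = "(+)"] bexp_cong)
  then show ?case by (simp add: bexp_add bexp_diff bexp_cmult insert.IH algebra_simps)
qed

text \<open>Deleting i freezes its centred factor at -\<tau>, while every other factor averages to
  0. Coefficients of degree 1 and 2 can therefore be read off from averages after one or two
  deletions.\<close>

lemma bexp_chaos_delete:
  assumes "finite Y" "i \<in> Y"
  shows "bexp \<tau> (Y - {i}) (chaos \<tau> Y a) = a {} - \<tau> * a {i}"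
proof -
  define Z where "Z = Y - {i}"
  have Z: "finite Z" "i \<notin> Z" "Y = insert i Z" using assms by (auto simp: Z_def)
  have "bexp \<tau> Z (chaos \<tau> Y a) = bexp \<tau> Z (\<lambda>W. chaos \<tau> Z a W - \<tau> * chaos \<tau> Z (\<lambda>S. a (insert i S)) W)"
    unfolding Z(3) using Z by (intro bexp_cong) (auto simp: chaos_insert)
  then show ?thesis using Z(1) by (simp add: Z_def[symmetric] bexp_diff bexp_cmult chaos_mean)
qed

lemma bexp_chaos_delete2:
  assumes "finite Y" "i \<in> Y" "j \<in> Y" "i \<noteq> j"
  shows "bexp \<tau> (Y - {i} - {j}) (chaos \<tau> Y a) = a {} - \<tau> * a {i} - \<tau> * a {j} + \<tau>\<^sup>2 * a {i, j}"
proof -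
  define Z where "Z = Y - {i}"
  have Z: "finite Z" "i \<notin> Z" "Y = insert i Z" "j \<in> Z" using assms by (auto simp: Z_def)
  have "bexp \<tau> (Z - {j}) (chaos \<tau> Y a) =
      bexp \<tau> (Z - {j}) (\<lambda>W. chaos \<tau> Z a W - \<tau> * chaos \<tau> Z (\<lambda>S. a (insert i S)) W)"
    unfolding Z(3) using Z by (intro bexp_cong) (auto simp: chaos_insert)
  also have "\<dots> = a {} - \<tau> * a {j} - \<tau> * (a {i} - \<tau> * a {i, j})"
    unfolding bexp_diff bexp_cmult bexp_chaos_delete[OF Z(1,4)] by simp
  finally show ?thesis by (simp add: Z_def power2_eq_square algebra_simps)
qed

text \<open>The discrete derivative in i keeps exactly the sets containing i. Its constant term is a
  {i} and its linear coefficients are the a {i, j}; the tail bound is applied to it when i becomes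
  pivotal.\<close>

lemma chaos_difference:
  assumes "finite Y" "i \<in> Y"
  shows "chaos \<tau> Y a (insert i W) - chaos \<tau> Y a (W - {i}) = chaos \<tau> (Y - {i}) (\<lambda>S. a (insert i S)) (W - {i})"
proof -
  define Z where "Z = Y - {i}"
  have Z: "finite Z" "i \<notin> Z" "Y = insert i Z" using assms by (auto simp: Z_def)
  have *: "chaos \<tau> Z b (insert i W) = chaos \<tau> Z b (W - {i})" for b
    using chaos_insert_right[OF Z(2), of \<tau> b "W - {i}"] by simp
  show ?thesis unfolding Z_def[symmetric] unfolding Z(3) chaos_insert[OF Z(1,2)] *
    by (simp add: algebra_simps)
qed

lemma sum_Pow_singletons:
  assumes "finite Y"
  shows "(\<Sum>S\<in>Pow Y. if card S = 1 then F S else 0) = (\<Sum>i\<in>Y. F {i})"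
proof -
  have "(\<Sum>S\<in>Pow Y. if card S = 1 then F S else 0) = (\<Sum>S\<in>(\<lambda>i. {i}) ` Y. F S)"
    using assms by (intro sum.mono_neutral_cong_right) (auto simp: card_1_singleton_iff)
  also have "\<dots> = (\<Sum>i\<in>Y. F {i})" by (subst sum.reindex) auto
  finally show ?thesis .
qed

lemma chaos_split:
  assumes "finite Y"
  shows "chaos \<tau> Y b W = b {} + (\<Sum>i\<in>Y. b {i} * (of_bool (i \<in> W) - \<tau>))
     + chaos \<tau> Y (\<lambda>S. if 2 \<le> card S then b S else 0) W"
proof -
  let ?F = "\<lambda>S. b S * chi \<tau> S W"
  have "chaos \<tau> Y b W = (\<Sum>S\<in>Pow Y. (if S = {} then ?F S else 0) + (if card S = 1 then ?F S else 0)
      + (if 2 \<le> card S then b S else 0) * chi \<tau> S W)"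
    unfolding chaos_def
  proof (intro sum.cong refl)
    fix S assume "S \<in> Pow Y"
    then have "finite S" using assms finite_subset by blast
    then have "card S = 0 \<longleftrightarrow> S = {}" by simp
    moreover consider "card S = 0" | "card S = 1" | "2 \<le> card S" by linarith
    ultimately show "?F S = (if S = {} then ?F S else 0) + (if card S = 1 then ?F S else 0)
      + (if 2 \<le> card S then b S else 0) * chi \<tau> S W" by cases auto
  qed
  also have "\<dots> = ?F {} + (\<Sum>i\<in>Y. ?F {i}) + chaos \<tau> Y (\<lambda>S. if 2 \<le> card S then b S else 0) W"
    unfolding sum.distrib sum_Pow_singletons[OF assms] chaos_def using assms by simp
  finally show ?thesis by (simp add: chi_def)
qed

text \<open>The deviation is split into the linear part outside T and the part of degree at least 2;
  one of them reaches \<theta> / 2. Markov's inequality is applied to the fourth power of the first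
  and to the square of the second.\<close>

lemma chaos_tail:
  fixes b :: "'a set \<Rightarrow> real"
  assumes fin: "finite Y" and t: "0 \<le> \<tau>" "\<tau> \<le> 1" and T: "T \<subseteq> Y" and th: "0 < \<theta>"
    and small: "\<And>i. i \<in> Y - T \<Longrightarrow> \<bar>b {i}\<bar> \<le> \<kappa>"
    and B: "(\<Sum>i\<in>Y. (b {i})\<^sup>2) \<le> 1"
  defines "s \<equiv> \<tau> * (1 - \<tau>)"
  shows "bexp \<tau> Y (\<lambda>W. of_bool (\<theta> \<le> \<bar>chaos \<tau> Y b W - b {} - (\<Sum>i\<in>T. b {i} * (of_bool (i \<in> W) - \<tau>))\<bar>))
     \<le> (2 / \<theta>) ^ 4 * ((3 * s\<^sup>2 + s * \<kappa>\<^sup>2) * (\<Sum>i\<in>Y. (b {i})\<^sup>2))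
       + (2 / \<theta>)\<^sup>2 * (\<Sum>S\<in>Pow Y. if 2 \<le> card S then (b S)\<^sup>2 * s ^ card S else 0)"
proof -
  define c where "c = (\<lambda>i. if i \<in> T then 0 else b {i})"
  define L where "L = (\<lambda>W. \<Sum>i\<in>Y. c i * (of_bool (i \<in> W) - \<tau>))"
  define R where "R = chaos \<tau> Y (\<lambda>S. if 2 \<le> card S then b S else 0)"
  define BB where "BB = (\<Sum>i\<in>Y. (b {i})\<^sup>2)"
  have s0: "0 \<le> s" using t by (simp add: s_def)
  have dec: "chaos \<tau> Y b W - b {} - (\<Sum>i\<in>T. b {i} * (of_bool (i \<in> W) - \<tau>)) = L W + R W" for W
  proof -
    have "(\<Sum>i\<in>Y. b {i} * (of_bool (i \<in> W) - \<tau>)) =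
        (\<Sum>i\<in>T. b {i} * (of_bool (i \<in> W) - \<tau>)) + (\<Sum>i\<in>Y - T. b {i} * (of_bool (i \<in> W) - \<tau>))"
      using sum.subset_diff[OF T fin] by (simp add: add.commute)
    moreover have "L W = (\<Sum>i\<in>Y - T. b {i} * (of_bool (i \<in> W) - \<tau>))"
      unfolding L_def using T fin by (intro sum.mono_neutral_cong_right) (auto simp: c_def)
    ultimately show ?thesis using chaos_split[OF fin, of \<tau> b W] unfolding R_def by linarith
  qed
  have c2: "(\<Sum>i\<in>Y. (c i)\<^sup>2) \<le> BB"
    unfolding BB_def by (intro sum_mono) (auto simp: c_def)
  have c4: "(\<Sum>i\<in>Y. (c i) ^ 4) \<le> \<kappa>\<^sup>2 * BB"
    unfolding BB_def sum_distrib_left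
  proof (intro sum_mono)
    fix i assume i: "i \<in> Y"
    show "(c i) ^ 4 \<le> \<kappa>\<^sup>2 * (b {i})\<^sup>2"
    proof (cases "i \<in> T")
      case False
      then have "\<bar>b {i}\<bar>\<^sup>2 \<le> \<kappa>\<^sup>2" using small i by (intro power_mono) auto
      then have "(b {i})\<^sup>2 * (b {i})\<^sup>2 \<le> \<kappa>\<^sup>2 * (b {i})\<^sup>2" by (intro mult_right_mono) auto
      moreover have "(b {i})\<^sup>2 * (b {i})\<^sup>2 = (b {i}) ^ 4" by algebra
      ultimately show ?thesis using False by (simp add: c_def)
    qed (simp add: c_def)
  qed
  have BB: "0 \<le> BB" "BB \<le> 1" using B by (auto simp: BB_def intro: sum_nonneg)
  have "bexp \<tau> Y (\<lambda>W. (L W) ^ 4) \<le> 3 * s\<^sup>2 * (\<Sum>i\<in>Y. (c i)\<^sup>2)\<^sup>2 + s * (\<Sum>i\<in>Y. (c i) ^ 4)"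
    unfolding L_def s_def by (rule bexp_linear_moments(3)[OF fin t])
  also have "\<dots> \<le> 3 * s\<^sup>2 * BB + s * (\<kappa>\<^sup>2 * BB)"
  proof (intro add_mono mult_left_mono c4 s0)
    have "(\<Sum>i\<in>Y. (c i)\<^sup>2)\<^sup>2 \<le> BB\<^sup>2" by (intro power_mono c2 sum_nonneg) auto
    \<comment> \<open>Since BB is at most 1, its square is weakened to BB. A bound linear in squared
      coefficients can later be summed over an unbounded number of points.\<close>
    also have "\<dots> \<le> BB" using BB by (simp add: power2_eq_square mult_left_le)
    finally show "(\<Sum>i\<in>Y. (c i)\<^sup>2)\<^sup>2 \<le> BB" .
  qed auto
  finally have L4: "bexp \<tau> Y (\<lambda>W. (L W) ^ 4) \<le> (3 * s\<^sup>2 + s * \<kappa>\<^sup>2) * BB" by (simp add: algebra_simps)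
  have R2: "bexp \<tau> Y (\<lambda>W. (R W)\<^sup>2) = (\<Sum>S\<in>Pow Y. if 2 \<le> card S then (b S)\<^sup>2 * s ^ card S else 0)"
    unfolding R_def bexp_chaos_square[OF fin] s_def by (intro sum.cong) auto
  have "bexp \<tau> Y (\<lambda>W. of_bool (\<theta> \<le> \<bar>L W + R W\<bar>)) \<le> bexp \<tau> Y (\<lambda>W. (2 / \<theta>) ^ 4 * (L W) ^ 4 + (2 / \<theta>)\<^sup>2 * (R W)\<^sup>2)"
  proof (rule bexp_mono[OF t])
    fix W
    have p4: "0 \<le> (2 / \<theta>) ^ 4 * (L W) ^ 4" and p2: "0 \<le> (2 / \<theta>)\<^sup>2 * (R W)\<^sup>2"
      by (simp_all add: zero_le_even_power)
    have one: "(of_bool (\<theta> \<le> \<bar>L W + R W\<bar>) :: real) \<le> 1" by simp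
    show "of_bool (\<theta> \<le> \<bar>L W + R W\<bar>) \<le> (2 / \<theta>) ^ 4 * (L W) ^ 4 + (2 / \<theta>)\<^sup>2 * (R W)\<^sup>2"
    proof (cases "\<theta> \<le> \<bar>L W + R W\<bar>")
      case True
      then consider "\<theta> / 2 \<le> \<bar>L W\<bar>" | "\<theta> / 2 \<le> \<bar>R W\<bar>" by linarith
      then show ?thesis
      proof cases
        case 1
        then have "1 \<le> 2 / \<theta> * \<bar>L W\<bar>" using th by (simp add: field_simps)
        then have "1 \<le> (2 / \<theta> * \<bar>L W\<bar>) ^ 4" by (rule one_le_power)
        also have "\<dots> = (2 / \<theta>) ^ 4 * (L W) ^ 4"
            unfolding power_mult_distrib by (simp add: power_even_abs)
        finally show ?thesis using p2 one by linarith
      next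
        case 2
        then have "1 \<le> 2 / \<theta> * \<bar>R W\<bar>" using th by (simp add: field_simps)
        then have "1 \<le> (2 / \<theta> * \<bar>R W\<bar>)\<^sup>2" by (rule one_le_power)
        also have "\<dots> = (2 / \<theta>)\<^sup>2 * (R W)\<^sup>2"
          unfolding power_mult_distrib by simp
        finally show ?thesis using p4 one by linarith
      qed
    qed (use p4 p2 in simp)
  qed
  also have "\<dots> \<le> (2 / \<theta>) ^ 4 * ((3 * s\<^sup>2 + s * \<kappa>\<^sup>2) * BB) +
      (2 / \<theta>)\<^sup>2 * (\<Sum>S\<in>Pow Y. if 2 \<le> card S then (b S)\<^sup>2 * s ^ card S else 0)"
    unfolding bexp_add bexp_cmult R2 by (intro add_right_mono mult_left_mono L4) (simp add: zero_le_even_power)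
  finally show ?thesis unfolding dec BB_def .
qed

lemma expansion:
  fixes f :: "'a set \<Rightarrow> real"
  assumes fin: "finite Y" and r: "0 \<le> r" "r \<le> \<tau> * (1 - \<tau> * r)" "\<tau> * r \<le> 1" "0 \<le> \<tau>"
    and f: "\<And>S. 0 \<le> f S" "\<And>S. f S \<le> 1"
  obtains a where "\<And>W. W \<subseteq> Y \<Longrightarrow> bexp r W f = chaos \<tau> Y a W"
    "(\<Sum>S\<in>Pow Y. (a S)\<^sup>2) \<le> 1"
    "bexp (\<tau> * r) Y f = a {}"
    "\<And>i. i \<in> Y \<Longrightarrow> bexp (\<tau> * r) (Y - {i}) f = a {} - \<tau> * a {i}"
    "\<And>i j. i \<in> Y \<Longrightarrow> j \<in> Y \<Longrightarrow> i \<noteq> j \<Longrightarrow>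
      bexp (\<tau> * r) (Y - {i} - {j}) f = a {} - \<tau> * a {i} - \<tau> * a {j} + \<tau>\<^sup>2 * a {i, j}"
proof -
  obtain a where a: "\<forall>W\<subseteq>Y. bexp r W f = chaos \<tau> Y a W"
    "(\<Sum>S\<in>Pow Y. (a S)\<^sup>2) \<le> bexp (\<tau> * r) Y (\<lambda>S. (f S)\<^sup>2)"
    using bessel_exists[OF fin r] by blast
  have "bexp (\<tau> * r) Y (\<lambda>S. (f S)\<^sup>2) \<le> 1"
    using r f fin by (intro bexp_le_const) (auto simp: power_le_one)
  then have le1: "(\<Sum>S\<in>Pow Y. (a S)\<^sup>2) \<le> 1" using a(2) by linarith
  have m: "bexp (\<tau> * r) Z f = bexp \<tau> Z (chaos \<tau> Y a)" if "Z \<subseteq> Y" for Z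
  proof -
    have "bexp \<tau> Z (chaos \<tau> Y a) = bexp \<tau> Z (\<lambda>W. bexp r W f)"
      using a(1) that by (intro bexp_cong) (auto dest: subset_trans)
    then show ?thesis using bexp_comp[of Z \<tau> r f] finite_subset[OF that fin] by simp
  qed
  show ?thesis
  proof (rule that[of a])
    show "bexp r W f = chaos \<tau> Y a W" if "W \<subseteq> Y" for W using a(1) that by blast
    show "bexp (\<tau> * r) Y f = a {}" using m[of Y] chaos_mean[OF fin] by simp
    show "bexp (\<tau> * r) (Y - {i}) f = a {} - \<tau> * a {i}" if "i \<in> Y" for i
      using m[of "Y - {i}"] bexp_chaos_delete[OF fin that] by (simp add: Diff_subset)
    show "bexp (\<tau> * r) (Y - {i} - {j}) f = a {} - \<tau> * a {i} - \<tau> * a {j} + \<tau>\<^sup>2 * a {i, j}"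
      if "i \<in> Y" "j \<in> Y" "i \<noteq> j" for i j
      using m[of "Y - {i} - {j}"] bexp_chaos_delete2[OF fin that] by auto
  qed (rule le1)
qed

text \<open>By Parseval the variance is carried by the nonempty sets, each weighted by at most
  \<tau> (1 - \<tau>), and the squared coefficients sum to at most 1.\<close>

lemma bexp_variance_le:
  fixes f :: "'a set \<Rightarrow> real"
  assumes fin: "finite Y" and r: "0 \<le> r" "r \<le> \<tau> * (1 - \<tau> * r)" "\<tau> * r \<le> 1" "0 \<le> \<tau>" "\<tau> \<le> 1"
    and f: "\<And>S. 0 \<le> f S" "\<And>S. f S \<le> 1"
  shows "bexp \<tau> Y (\<lambda>W. (bexp r W f)\<^sup>2) \<le> (bexp (\<tau> * r) Y f)\<^sup>2 + (1 - \<tau>)"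
proof -
  obtain a where a: "\<And>W. W \<subseteq> Y \<Longrightarrow> bexp r W f = chaos \<tau> Y a W"
    "(\<Sum>S\<in>Pow Y. (a S)\<^sup>2) \<le> 1" "bexp (\<tau> * r) Y f = a {}"
    by (rule expansion[where f = f, OF fin r(1-4) f]) blast
  define s where "s = \<tau> * (1 - \<tau>)"
  have s: "0 \<le> s" "s \<le> 1 - \<tau>" "s \<le> 1" using r by (auto simp: s_def mult_left_le_one_le mult_le_one)
  have "bexp \<tau> Y (\<lambda>W. (bexp r W f)\<^sup>2) = bexp \<tau> Y (\<lambda>W. (chaos \<tau> Y a W)\<^sup>2)"
    by (intro bexp_cong) (simp add: a(1))
  also have "\<dots> = (\<Sum>S\<in>Pow Y. (a S)\<^sup>2 * s ^ card S)" unfolding s_def by (rule bexp_chaos_square[OF fin])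
  also have "\<dots> = (a {})\<^sup>2 + (\<Sum>S\<in>Pow Y - {{}}. (a S)\<^sup>2 * s ^ card S)"
    using fin by (subst sum.remove[of _ "{}"]) auto
  also have "(\<Sum>S\<in>Pow Y - {{}}. (a S)\<^sup>2 * s ^ card S) \<le> (\<Sum>S\<in>Pow Y - {{}}. (a S)\<^sup>2 * s)"
  proof (intro sum_mono mult_left_mono)
    fix S assume "S \<in> Pow Y - {{}}"
    then have "1 \<le> card S" using fin finite_subset by (metis DiffE Pow_iff Suc_leI card_gt_0_iff insertI1 One_nat_def)
    then show "s ^ card S \<le> s" using power_decreasing[of 1 "card S" s] s by simp
  qed auto
  also have "\<dots> \<le> (\<Sum>S\<in>Pow Y. (a S)\<^sup>2) * s"
    unfolding sum_distrib_right[symmetric] using fin s by (intro mult_right_mono sum_mono2) auto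
  also have "\<dots> \<le> 1 * s" using a(2) s by (intro mult_right_mono) auto
  finally show ?thesis using s a(3) by simp
qed

section \<open>Nearly two-valued averages, pairs of deletions, and the number of pivotal
  points\<close>

text \<open>The polynomial h (lam - h) vanishes where h is 0 or lam, so its mean is controlled by
  the distance of h to lam g. Replacing h by its mean M changes the mean of the polynomial by the
  variance of h, which is at most 1 - \<tau>.\<close>

lemma near_two_valued:
  fixes f g :: "'a set \<Rightarrow> real"
  assumes fin: "finite Y" and r: "0 \<le> r" "r \<le> \<tau> * (1 - \<tau> * r)" "r \<le> 1" "0 \<le> \<tau>" "\<tau> \<le> 1"
    and f: "\<And>S. 0 \<le> f S" "\<And>S. f S \<le> 1" and g: "\<And>S. g S \<in> {0, 1}" and lam: "0 \<le> lam" "lam \<le> 1"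
  defines "M \<equiv> bexp (\<tau> * r) Y f"
  shows "\<bar>M * (lam - M)\<bar> \<le> (1 - \<tau>) + bexp \<tau> Y (\<lambda>W. \<bar>bexp r W f - lam * g W\<bar>)"
proof -
  define h where "h = (\<lambda>W. bexp r W f)"
  have h: "0 \<le> h W" "h W \<le> 1" if "W \<subseteq> Y" for W
    using that r f fin finite_subset unfolding h_def by (auto intro!: bexp_nonneg bexp_le_const)
  have M: "M = bexp \<tau> Y h" unfolding h_def M_def using bexp_comp[OF fin] by metis
  have "\<bar>h W * (lam - h W)\<bar> \<le> \<bar>h W - lam * g W\<bar>" if "W \<subseteq> Y" for W
  proof (cases "g W = 0")
    case True
    have "\<bar>lam - h W\<bar> \<le> 1" using h[OF that] lam by auto
    then have "\<bar>h W\<bar> * \<bar>lam - h W\<bar> \<le> \<bar>h W\<bar> * 1" by (intro mult_left_mono) auto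
    then show ?thesis using True by (simp add: abs_mult)
  next
    case False
    then have "g W = 1" using g[of W] by auto
    moreover have "\<bar>h W\<bar> * \<bar>lam - h W\<bar> \<le> 1 * \<bar>lam - h W\<bar>" using h[OF that] by (intro mult_right_mono) auto
    ultimately show ?thesis by (simp add: abs_mult abs_minus_commute)
  qed
  then have "bexp \<tau> Y (\<lambda>W. \<bar>h W * (lam - h W)\<bar>) \<le> bexp \<tau> Y (\<lambda>W. \<bar>h W - lam * g W\<bar>)"
    using r by (intro bexp_mono) auto
  then have 1: "\<bar>bexp \<tau> Y (\<lambda>W. h W * (lam - h W))\<bar> \<le> bexp \<tau> Y (\<lambda>W. \<bar>h W - lam * g W\<bar>)"
    using bexp_abs_le[of \<tau> Y "\<lambda>W. h W * (lam - h W)"] r by linarith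
  have "bexp \<tau> Y (\<lambda>W. h W * (lam - h W)) = bexp \<tau> Y (\<lambda>W. lam * h W - (h W)\<^sup>2)"
    by (intro bexp_cong) (simp add: power2_eq_square algebra_simps)
  then have 2: "bexp \<tau> Y (\<lambda>W. h W * (lam - h W)) = lam * M - bexp \<tau> Y (\<lambda>W. (h W)\<^sup>2)"
    by (simp add: bexp_diff bexp_cmult M)
  have 3: "M\<^sup>2 \<le> bexp \<tau> Y (\<lambda>W. (h W)\<^sup>2)" unfolding M using fin r by (intro bexp_square_le) auto
  have 4: "bexp \<tau> Y (\<lambda>W. (h W)\<^sup>2) \<le> M\<^sup>2 + (1 - \<tau>)"
    unfolding h_def M_def using r f fin by (intro bexp_variance_le) (auto simp: mult_le_one)
  have 5: "M * (lam - M) = lam * M - M\<^sup>2" by (simp add: power2_eq_square algebra_simps)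
  have "\<bar>x\<bar> \<le> t + e" if "x = u - q" "\<bar>u - v\<bar> \<le> e" "q \<le> v" "v \<le> q + t" for x u v q e t :: real
    using that by linarith
  from this[OF 5 1[unfolded 2] 3 4] show ?thesis unfolding h_def .
qed

text \<open>Inclusion-exclusion over i and j isolates the contribution of the sets containing both,
  which is nonnegative. With r < 1/2 the factor 2 (1 - r) exceeds 1, so Y, Y - {i} and Y - {j}
  cannot all have average about lam while Y - {i} - {j} has average about 0.\<close>

lemma pair_inequality:
  fixes f :: "'a set \<Rightarrow> real"
  assumes fin: "finite Y" and ij: "i \<in> Y" "j \<in> Y" "i \<noteq> j" and r: "0 \<le> r" "r \<le> 1" and f: "\<And>S. 0 \<le> f S"
  shows "(1 - r) * (bexp r (Y - {i}) f + bexp r (Y - {j}) f) \<le> bexp r Y f + (1 - r)\<^sup>2 * bexp r (Y - {i} - {j}) f"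
proof -
  define Z where "Z = Y - {i} - {j}"
  have Z: "finite Z" "i \<notin> Z" "j \<notin> Z" using fin by (simp_all add: Z_def)
  have Z4: "insert i (insert j Z) = Y" and Z5: "insert j Z = Y - {i}" and Z6: "insert i Z = Y - {j}"
    unfolding Z_def using ij by auto
  have Y: "bexp r Y f = r * bexp r (insert j Z) (\<lambda>S. f (insert i S)) + (1 - r) * bexp r (insert j Z) f"
    unfolding Z4[symmetric] using Z ij by (intro bexp_insert) auto
  have J: "bexp r (insert j Z) F = r * bexp r Z (\<lambda>S. F (insert j S)) + (1 - r) * bexp r Z F" for F
    using Z(1,3) by (rule bexp_insert)
  have I: "bexp r (insert i Z) f = r * bexp r Z (\<lambda>S. f (insert i S)) + (1 - r) * bexp r Z f"
    using Z(1,2) by (rule bexp_insert)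
  have "0 \<le> r * (r * bexp r Z (\<lambda>S. f (insert i (insert j S))))"
    using r f by (intro mult_nonneg_nonneg bexp_nonneg) auto
  also have "\<dots> = bexp r Y f + (1 - r)\<^sup>2 * bexp r Z f
      - (1 - r) * (bexp r (insert j Z) f + bexp r (insert i Z) f)"
    unfolding Y J I by algebra
  finally have "(1 - r) * (bexp r (insert j Z) f + bexp r (insert i Z) f) \<le> bexp r Y f + (1 - r)\<^sup>2 * bexp r Z f"
    by linarith
  then show ?thesis unfolding Z5 Z6 unfolding Z_def .
qed

text \<open>At \<tau> = 1 the contraction condition reads r \<le> 1 - r, and the linear coefficients
  are exactly the drops caused by deleting one point. Each pivotal point contributes a drop of at
  least lam / 4 to a sum of squares at most 1.\<close>

lemma card_pivotal_le:
  fixes f :: "'a set \<Rightarrow> real"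
  assumes fin: "finite W" and r: "0 \<le> r" "r \<le> 1 / 2" and f: "\<And>S. 0 \<le> f S" "\<And>S. f S \<le> 1"
    and lam: "0 < lam" and M: "lam / 2 \<le> bexp r W f"
  shows "real (card {i\<in>W. bexp r (W - {i}) f < lam / 4}) \<le> 16 / lam\<^sup>2"
proof -
  have rr: "r \<le> 1 * (1 - 1 * r)" "1 * r \<le> 1" using r by auto
  obtain a where a': "(\<Sum>S\<in>Pow W. (a S)\<^sup>2) \<le> 1" "bexp (1 * r) W f = a {}"
    "\<And>i. i \<in> W \<Longrightarrow> bexp (1 * r) (W - {i}) f = a {} - 1 * a {i}"
    by (rule expansion[where f = f, OF fin r(1) rr zero_le_one f]) blast
  note a = a'[unfolded mult_1]
  define T where "T = {i\<in>W. bexp r (W - {i}) f < lam / 4}"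
  have "real (card T) * (lam / 4)\<^sup>2 = (\<Sum>i\<in>T. (lam / 4)\<^sup>2)" by simp
  also have "\<dots> \<le> (\<Sum>i\<in>T. (a {i})\<^sup>2)"
  proof (intro sum_mono power_mono)
    fix i assume "i \<in> T"
    then show "lam / 4 \<le> a {i}" using a(2) a(3)[of i] M by (auto simp: T_def)
  qed (use lam in auto)
  also have "\<dots> = (\<Sum>S\<in>(\<lambda>i. {i}) ` T. (a S)\<^sup>2)" by (subst sum.reindex) auto
  also have "\<dots> \<le> (\<Sum>S\<in>Pow W. (a S)\<^sup>2)" using fin by (intro sum_mono2) (auto simp: T_def)
  also have "\<dots> \<le> 1" by (rule a(1))
  finally show ?thesis using lam unfolding T_def[symmetric] by (simp add: field_simps power2_eq_square)
qed

text \<open>Double counting of the pairs of a set and one of its elements. It bounds the sum over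
  all candidates in \<open>pivotal_not_gained\<close>.\<close>

lemma sum_Pow_delete_insert:
  assumes "finite Y"
  shows "(\<Sum>i\<in>Y. \<Sum>S\<in>Pow (Y - {i}). F (insert i S)) = (\<Sum>U\<in>Pow Y. real (card U) * F U)"
proof -
  have "(\<Sum>S\<in>Pow (Y - {i}). F (insert i S)) = (\<Sum>U\<in>Pow Y. if i \<in> U then F U else 0)" if "i \<in> Y" for i
  proof -
    have inj: "inj_on (insert i) (Pow (Y - {i}))"
      by (intro inj_onI) (metis Diff_iff PowD insertI1 insert_ident subsetD)
    have im: "insert i ` Pow (Y - {i}) = {U \<in> Pow Y. i \<in> U}"
    proof (intro equalityI subsetI)
      fix U assume "U \<in> {U \<in> Pow Y. i \<in> U}"
      then have "U = insert i (U - {i})" "U - {i} \<in> Pow (Y - {i})" by auto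
      then show "U \<in> insert i ` Pow (Y - {i})" by blast
    qed (use that in auto)
    show ?thesis
      using sum.reindex[OF inj, of F] assms unfolding im o_def
      by (simp add: sum.inter_filter[symmetric])
  qed
  then have "(\<Sum>i\<in>Y. \<Sum>S\<in>Pow (Y - {i}). F (insert i S)) = (\<Sum>i\<in>Y. \<Sum>U\<in>Pow Y. if i \<in> U then F U else 0)"
    by simp
  also have "\<dots> = (\<Sum>U\<in>Pow Y. \<Sum>i\<in>Y. if i \<in> U then F U else 0)" by (rule sum.swap)
  also have "\<dots> = (\<Sum>U\<in>Pow Y. real (card U) * F U)"
  proof (intro sum.cong refl)
    fix U assume "U \<in> Pow Y"
    then have "{i \<in> Y. i \<in> U} = U" by auto
    then show "(\<Sum>i\<in>Y. if i \<in> U then F U else 0) = real (card U) * F U"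
      using assms by (simp add: sum.inter_filter[symmetric])
  qed
  finally show ?thesis .
qed

lemma sum_delete_insert_le:
  fixes F :: "'a set \<Rightarrow> real"
  assumes "finite Y" "i \<in> Y" "\<And>U. 0 \<le> F U"
  shows "(\<Sum>S\<in>Pow (Y - {i}). F (insert i S)) \<le> (\<Sum>U\<in>Pow Y. F U)"
proof -
  have inj: "inj_on (insert i) (Pow (Y - {i}))"
    by (intro inj_onI) (metis Diff_iff PowD insertI1 insert_ident subsetD)
  have "(\<Sum>S\<in>Pow (Y - {i}). F (insert i S)) = (\<Sum>U\<in>insert i ` Pow (Y - {i}). F U)"
    by (simp add: sum.reindex[OF inj])
  also have "\<dots> \<le> (\<Sum>U\<in>Pow Y. F U)" using assms by (intro sum_mono2) auto
  finally show ?thesis .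
qed

text \<open>The gap between \<rho> and 1/2 pays for t being below 1. The slack 2 \<sigma> covers
  both t = \<tau> and t = \<tau>^2.\<close>

lemma bernoulli_contraction:
  fixes \<zeta> \<sigma> \<rho> t :: real
  assumes "0 \<le> \<rho>" "\<rho> \<le> 1 / 2 - \<zeta>" "1 - 2 * \<sigma> \<le> t" "t \<le> 1" "\<sigma> \<le> \<zeta>" "0 \<le> t"
  shows "\<rho> \<le> t * (1 - t * \<rho>)"
proof -
  have "t * \<rho> \<le> 1 * \<rho>" using assms by (intro mult_right_mono) auto
  then have 1: "t * (1 - \<rho>) \<le> t * (1 - t * \<rho>)" using assms by (intro mult_left_mono) auto
  have "(1 - t) * (1 - \<rho>) \<le> (2 * \<zeta>) * 1" using assms by (intro mult_mono) auto
  then have "1 - \<rho> - 2 * \<zeta> \<le> t * (1 - \<rho>)" by (simp add: algebra_simps)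
  then show ?thesis using 1 assms(2) by (smt (verit) field_sum_of_halves)
qed

subsection \<open>Two-valued averages and their pivotal points\<close>

text \<open>The bound \<zeta>^3 / 2000 makes the total linear effect of at most 16 / \<zeta>^2
  surviving pivotal points smaller than \<zeta> / 100, and it makes \<open>c0\<close> small compared
  with \<zeta>^2, which is the gain available from the inequality of pairs.\<close>

locale approx_pair =
  fixes \<zeta> \<sigma> \<rho> lam :: real and f g :: "'a set \<Rightarrow> real"
  assumes zeta: "0 < \<zeta>" "\<zeta> \<le> 1 / 4"
    and sigma: "0 < \<sigma>" "\<sigma> \<le> \<zeta> ^ 3 / 2000"
    and rho: "\<zeta> \<le> \<rho>" "\<rho> \<le> 1 / 2 - \<zeta>"
    and lam: "\<zeta> \<le> lam" "lam \<le> 1"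
    and f: "\<And>S. 0 \<le> f S" "\<And>S. f S \<le> 1"
    and g: "\<And>S. g S \<in> {0, 1}"
begin

text \<open>Random deletions take \<open>Y\<close> to \<open>W\<close> to \<open>X\<close>, keeping each point with probability \<open>\<tau>\<close>; \<open>M2\<close>, \<open>M1\<close> and
  \<open>\<lambda>X. bexp \<rho> X f\<close> are the averages of \<open>f\<close> seen from the three levels, and \<open>T2\<close>, \<open>T1\<close> the pivotal points.\<close>
definition \<tau> :: real where "\<tau> = 1 - \<sigma>"
definition k :: "'a set \<Rightarrow> real" where "k X = \<bar>bexp \<rho> X f - lam * g X\<bar>"
definition M1 :: "'a set \<Rightarrow> real" where "M1 W = bexp (\<tau> * \<rho>) W f"
definition M2 :: "'a set \<Rightarrow> real" where "M2 Y = bexp (\<tau> * (\<tau> * \<rho>)) Y f"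
definition c0 :: real where "c0 = 6 * \<sigma> / \<zeta>"
definition T1 :: "'a set \<Rightarrow> 'a set" where "T1 W = {i\<in>W. M1 (W - {i}) < lam / 4}"
definition T2 :: "'a set \<Rightarrow> 'a set" where "T2 Y = {i\<in>Y. M2 (Y - {i}) < lam / 4}"
text \<open>Here 16 / \<zeta> is 2 / \<theta> for the threshold \<theta> = \<zeta> / 8, and 120 /
  \<zeta> is 20 \<open>c0\<close> / \<sigma>. The factor 4 in the last term is fitted to
  \<open>pivotal_not_gained\<close>, whose two contributions then add up to 2 \<open>D0\<close>
  \<sigma>^2.\<close>

definition D0 :: real where
  "D0 = (16 / \<zeta>) ^ 4 * (3 + (120 / \<zeta>)\<^sup>2) + 4 * (16 / \<zeta>)\<^sup>2"

lemma sigma_small: "\<sigma> \<le> \<zeta>\<^sup>2 / 8000" "\<sigma> \<le> \<zeta> / 32000" "\<sigma> \<le> 1 / 128000"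
proof -
  have "\<zeta> ^ 3 = \<zeta> * \<zeta>\<^sup>2" by (simp add: power2_eq_square power3_eq_cube)
  also have "\<dots> \<le> 1 / 4 * \<zeta>\<^sup>2" using zeta by (intro mult_right_mono) auto
  finally show 1: "\<sigma> \<le> \<zeta>\<^sup>2 / 8000" using sigma by linarith
  have "\<zeta>\<^sup>2 \<le> 1 / 4 * \<zeta>" unfolding power2_eq_square using zeta by (intro mult_right_mono) auto
  then show 2: "\<sigma> \<le> \<zeta> / 32000" using 1 by linarith
  then show "\<sigma> \<le> 1 / 128000" using zeta by linarith
qed

lemma c0_bounds: "0 < c0" "c0 \<le> \<zeta>\<^sup>2 / 300" "c0 \<le> \<zeta> / 1200"
proof -
  show "0 < c0" using zeta sigma by (simp add: c0_def)
  have "c0 \<le> 6 * (\<zeta> ^ 3 / 2000) / \<zeta>" unfolding c0_def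
    using zeta sigma by (intro divide_right_mono mult_left_mono) auto
  also have "\<dots> = 6 / 2000 * \<zeta>\<^sup>2" using zeta by (simp add: power2_eq_square power3_eq_cube)
  also have "\<dots> \<le> \<zeta>\<^sup>2 / 300" using zero_le_power2[of \<zeta>] by linarith
  finally show 1: "c0 \<le> \<zeta>\<^sup>2 / 300" .
  have "\<zeta>\<^sup>2 \<le> 1 / 4 * \<zeta>" unfolding power2_eq_square using zeta by (intro mult_right_mono) auto
  then show "c0 \<le> \<zeta> / 1200" using 1 by linarith
qed

lemma tau: "1 / 2 \<le> \<tau>" "\<tau> < 1" "0 < \<tau>" "\<tau> \<le> 1" "1 - 2 * \<sigma> \<le> \<tau> * \<tau>" "\<tau> * \<tau> \<le> 1" "1 / 2 \<le> \<tau> * \<tau>"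
proof -
  show t: "1 / 2 \<le> \<tau>" "\<tau> < 1" "0 < \<tau>" "\<tau> \<le> 1" using sigma_small sigma by (auto simp: \<tau>_def)
  have "\<tau> * \<tau> = 1 - 2 * \<sigma> + \<sigma>\<^sup>2" by (simp add: \<tau>_def power2_eq_square algebra_simps)
  then show 1: "1 - 2 * \<sigma> \<le> \<tau> * \<tau>" by simp
  then show "1 / 2 \<le> \<tau> * \<tau>" using sigma_small by linarith
  show "\<tau> * \<tau> \<le> 1" using t by (simp add: mult_le_one)
qed

lemma rates: "0 < \<rho>" "\<rho> < 1 / 2" "0 < \<tau> * \<rho>" "\<tau> * \<rho> \<le> 1 / 2 - \<zeta>" "0 < \<tau> * (\<tau> * \<rho>)" "\<tau> * (\<tau> * \<rho>) \<le> 1 / 2 - \<zeta>"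
proof -
  show r: "0 < \<rho>" "\<rho> < 1 / 2" using rho zeta by auto
  have "0 < \<tau> * x \<and> \<tau> * x \<le> 1 / 2 - \<zeta>" if "x \<le> 1 / 2 - \<zeta>" "0 < x" for x
  proof
    show "0 < \<tau> * x" using tau that by simp
    have "\<tau> * x \<le> x" using tau that by (intro mult_left_le_one_le) auto
    then show "\<tau> * x \<le> 1 / 2 - \<zeta>" using that by linarith
  qed
  then show "0 < \<tau> * \<rho>" "\<tau> * \<rho> \<le> 1 / 2 - \<zeta>" "0 < \<tau> * (\<tau> * \<rho>)" "\<tau> * (\<tau> * \<rho>) \<le> 1 / 2 - \<zeta>"
    using r rho by blast+
qed

lemma rates_le: "\<tau> * \<rho> \<le> 1" "\<tau> * (\<tau> * \<rho>) \<le> 1" "\<rho> \<le> 1"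
  using rates(2,4,6) zeta(1) by linarith+

lemma contractions: "\<tau> * \<rho> \<le> \<tau> * (1 - \<tau> * (\<tau> * \<rho>))" "\<rho> \<le> \<tau> * (1 - \<tau> * \<rho>)"
    "\<rho> \<le> \<tau> * \<tau> * (1 - \<tau> * \<tau> * \<rho>)" "\<tau> * (\<tau> * \<rho>) \<le> 1"
  using bernoulli_contraction[of "\<tau> * \<rho>" \<zeta> \<sigma> \<tau>] bernoulli_contraction[of \<rho> \<zeta> \<sigma> \<tau>]
    bernoulli_contraction[of \<rho> \<zeta> \<sigma> "\<tau> * \<tau>"] rates tau sigma_small sigma rho zeta
  by (auto simp: \<tau>_def)

lemma k_nonneg: "0 \<le> k X" by (simp add: k_def)

lemma M1_range: "finite W \<Longrightarrow> 0 \<le> M1 W \<and> M1 W \<le> 1"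
  unfolding M1_def using rates rates_le f by (intro conjI bexp_nonneg bexp_le_const) auto

lemma M2_range: "finite W \<Longrightarrow> 0 \<le> M2 W \<and> M2 W \<le> 1"
  unfolding M2_def using rates rates_le f by (intro conjI bexp_nonneg bexp_le_const) auto

lemma M2_delete_le: "finite Y \<Longrightarrow> i \<in> Y \<Longrightarrow> M2 (Y - {i}) \<le> 2 * M2 Y"
proof -
  assume Y: "finite Y" "i \<in> Y"
  have "(1 - \<tau> * (\<tau> * \<rho>)) * M2 (Y - {i}) \<le> M2 Y"
    unfolding M2_def using rates rates_le Y f by (intro bexp_delete_le) auto
  moreover have "1 / 2 * M2 (Y - {i}) \<le> (1 - \<tau> * (\<tau> * \<rho>)) * M2 (Y - {i})"
    using rates M2_range[of "Y - {i}"] Y by (intro mult_right_mono) (use zeta(1) in auto)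
  ultimately show ?thesis by linarith
qed

lemma M1_near: "finite W \<Longrightarrow> \<bar>M1 W * (lam - M1 W)\<bar> \<le> \<sigma> + bexp \<tau> W k"
  using near_two_valued[of W \<rho> \<tau> f g lam] rates contractions tau f g lam zeta
  unfolding M1_def k_def[abs_def] by (simp add: \<tau>_def)

lemma M2_near: "finite Y \<Longrightarrow> \<bar>M2 Y * (lam - M2 Y)\<bar> \<le> 2 * \<sigma> + bexp (\<tau> * \<tau>) Y k"
  using near_two_valued[of Y \<rho> "\<tau> * \<tau>" f g lam] rates contractions tau f g lam zeta
  unfolding M2_def k_def[abs_def] by (simp add: mult.assoc)

text \<open>One of M and lam - M has size at least lam / 2 \<ge> \<zeta> / 2, so the other has size
  at most 6 \<sigma> / \<zeta>, which is \<open>c0\<close>. The 3 \<sigma> allows for the 2 \<sigma>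
  of \<open>M2_near\<close> and another \<sigma> for the mean of \<open>k\<close>.\<close>

lemma dichotomy:
  assumes "0 \<le> M" "\<bar>M * (lam - M)\<bar> \<le> 3 * \<sigma>"
  shows "M \<le> c0 \<or> \<bar>M - lam\<bar> \<le> c0"
proof (cases "M \<le> lam / 2")
  case True
  then have "M * (lam / 2) \<le> M * (lam - M)" using assms by (intro mult_left_mono) auto
  then have "M * lam \<le> 6 * \<sigma>" using assms by linarith
  moreover have "M * \<zeta> \<le> M * lam" using assms lam by (intro mult_left_mono) auto
  ultimately have "M * \<zeta> \<le> 6 * \<sigma>" by linarith
  then show ?thesis using zeta by (auto simp: c0_def field_simps)
next
  case False
  then have "\<zeta> / 2 * \<bar>M - lam\<bar> \<le> M * \<bar>M - lam\<bar>" using lam by (intro mult_right_mono) auto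
  also have "\<dots> = \<bar>M * (lam - M)\<bar>" using assms(1) by (simp add: abs_mult abs_minus_commute)
  finally have "\<zeta> * \<bar>M - lam\<bar> \<le> 6 * \<sigma>" using assms(2) by linarith
  then show ?thesis using zeta by (auto simp: c0_def field_simps)
qed

text \<open>The threshold is \<sigma>^3 because up to two points get deleted, and each deletion can
  multiply the mean of \<open>k\<close> by 1 / (1 - \<tau>^2) \<le> 1 / \<sigma>; what remains is at
  most \<sigma>.\<close>

definition typical :: "'a set \<Rightarrow> bool" where
  "typical Y \<longleftrightarrow> finite Y \<and> bexp (\<tau> * \<tau>) Y k \<le> \<sigma> ^ 3"

lemma sigma_le_rate: "\<sigma> \<le> 1 - \<tau> * \<tau>"
proof -
  have "\<tau> * \<tau> \<le> \<tau> * 1" using tau by (intro mult_left_mono) auto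
  then show ?thesis by (simp add: \<tau>_def)
qed

lemma local_expansion:
  assumes fin: "finite Y"
  obtains a where "\<And>W. W \<subseteq> Y \<Longrightarrow> M1 W = chaos \<tau> Y a W"
    "(\<Sum>S\<in>Pow Y. (a S)\<^sup>2) \<le> 1" "M2 Y = a {}"
    "\<And>i. i \<in> Y \<Longrightarrow> M2 (Y - {i}) = a {} - \<tau> * a {i}"
    "\<And>i j. i \<in> Y \<Longrightarrow> j \<in> Y \<Longrightarrow> i \<noteq> j \<Longrightarrow>
      M2 (Y - {i} - {j}) = a {} - \<tau> * a {i} - \<tau> * a {j} + \<tau>\<^sup>2 * a {i, j}"
  unfolding M1_def M2_def
  by (rule expansion[where f = f, OF fin less_imp_le[OF rates(3)] contractions(1,4) less_imp_le[OF tau(3)] f])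
    (rule that[unfolded M1_def M2_def])

lemma typical_dichotomy:
  assumes Y: "typical Y"
  shows "M2 Y \<le> c0 \<or> \<bar>M2 Y - lam\<bar> \<le> c0"
    and "i \<in> Y \<Longrightarrow> M2 (Y - {i}) \<le> c0 \<or> \<bar>M2 (Y - {i}) - lam\<bar> \<le> c0"
    and "i \<in> Y \<Longrightarrow> j \<in> Y \<Longrightarrow> i \<noteq> j \<Longrightarrow> M2 (Y - {i} - {j}) \<le> c0 \<or> \<bar>M2 (Y - {i} - {j}) - lam\<bar> \<le> c0"
proof -
  have fin: "finite Y" and b: "bexp (\<tau> * \<tau>) Y k \<le> \<sigma> ^ 3" using Y by (auto simp: typical_def)
  have s3: "\<sigma> ^ 3 \<le> \<sigma>" using sigma sigma_small power_decreasing[of 1 3 \<sigma>] by simp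
  have s2: "\<sigma> ^ 3 \<le> \<sigma> * \<sigma>" using sigma sigma_small power_decreasing[of 2 3 \<sigma>] by (simp add: power2_eq_square)
  have *: "M2 Z \<le> c0 \<or> \<bar>M2 Z - lam\<bar> \<le> c0" if "finite Z" "bexp (\<tau> * \<tau>) Z k \<le> \<sigma>" for Z
    using dichotomy[of "M2 Z"] M2_near[OF that(1)] that(2) M2_range[OF that(1)] by linarith
  show "M2 Y \<le> c0 \<or> \<bar>M2 Y - lam\<bar> \<le> c0" using * fin b s3 by auto
  have t2: "0 \<le> \<tau> * \<tau>" "\<tau> * \<tau> \<le> 1" using tau by auto
  show "M2 (Y - {i}) \<le> c0 \<or> \<bar>M2 (Y - {i}) - lam\<bar> \<le> c0" if i: "i \<in> Y"
  proof (rule *)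
    have "(1 - \<tau> * \<tau>) * bexp (\<tau> * \<tau>) (Y - {i}) k \<le> bexp (\<tau> * \<tau>) Y k"
      using fin i t2 k_nonneg by (intro bexp_delete_le) auto
    moreover have "\<sigma> * bexp (\<tau> * \<tau>) (Y - {i}) k \<le> (1 - \<tau> * \<tau>) * bexp (\<tau> * \<tau>) (Y - {i}) k"
      using sigma_le_rate t2 k_nonneg by (intro mult_right_mono bexp_nonneg) auto
    ultimately have "\<sigma> * bexp (\<tau> * \<tau>) (Y - {i}) k \<le> \<sigma> * \<sigma>" using b s2 by linarith
    then show "bexp (\<tau> * \<tau>) (Y - {i}) k \<le> \<sigma>" using sigma by simp
  qed (use fin in simp)
  show "M2 (Y - {i} - {j}) \<le> c0 \<or> \<bar>M2 (Y - {i} - {j}) - lam\<bar> \<le> c0" if ij: "i \<in> Y" "j \<in> Y" "i \<noteq> j"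
  proof (rule *)
    have "(1 - \<tau> * \<tau>)\<^sup>2 * bexp (\<tau> * \<tau>) (Y - {i} - {j}) k \<le> bexp (\<tau> * \<tau>) Y k"
      using fin ij t2 k_nonneg by (intro bexp_delete_delete_le) auto
    moreover have "\<sigma>\<^sup>2 * bexp (\<tau> * \<tau>) (Y - {i} - {j}) k \<le> (1 - \<tau> * \<tau>)\<^sup>2 * bexp (\<tau> * \<tau>) (Y - {i} - {j}) k"
      using sigma_le_rate sigma t2 k_nonneg by (intro mult_right_mono bexp_nonneg power_mono) auto
    moreover have "\<sigma> ^ 3 = \<sigma>\<^sup>2 * \<sigma>" by (simp add: power2_eq_square power3_eq_cube)
    ultimately have "\<sigma>\<^sup>2 * bexp (\<tau> * \<tau>) (Y - {i} - {j}) k \<le> \<sigma>\<^sup>2 * \<sigma>" using b by linarith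
    then show "bexp (\<tau> * \<tau>) (Y - {i} - {j}) k \<le> \<sigma>" using sigma by simp
  qed (use fin in simp)
qed

section \<open>Stability of high and low averages and of pivotal sets under deletions\<close>

lemma tail_bound:
  fixes b :: "'a set \<Rightarrow> real"
  assumes fin: "finite Y" and T: "T \<subseteq> Y"
    and small: "\<And>i. i \<in> Y - T \<Longrightarrow> \<bar>b {i}\<bar> \<le> 20 * c0"
    and B: "(\<Sum>i\<in>Y. (b {i})\<^sup>2) \<le> 1"
  shows "bexp \<tau> Y (\<lambda>W. of_bool (\<zeta> / 8 \<le> \<bar>chaos \<tau> Y b W - b {} - (\<Sum>i\<in>T. b {i} * (of_bool (i \<in> W) - \<tau>))\<bar>))
     \<le> (16 / \<zeta>) ^ 4 * (3 + (120 / \<zeta>)\<^sup>2) * \<sigma>\<^sup>2 * (\<Sum>i\<in>Y. (b {i})\<^sup>2)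
       + (16 / \<zeta>)\<^sup>2 * (\<Sum>S\<in>Pow Y. if 2 \<le> card S then (b S)\<^sup>2 * \<sigma> ^ card S else 0)"
proof -
  define s where "s = \<tau> * (1 - \<tau>)"
  have s: "0 \<le> s" "s \<le> \<sigma>" using tau sigma mult_left_le_one_le[of \<sigma> \<tau>] by (auto simp: s_def \<tau>_def)
  define BB where "BB = (\<Sum>i\<in>Y. (b {i})\<^sup>2)"
  have BB: "0 \<le> BB" by (auto simp: BB_def intro: sum_nonneg)
  have t: "0 \<le> \<tau>" "\<tau> \<le> 1" using tau by auto
  have z8: "2 / (\<zeta> / 8) = 16 / \<zeta>" by simp
  have "bexp \<tau> Y (\<lambda>W. of_bool (\<zeta> / 8 \<le> \<bar>chaos \<tau> Y b W - b {} - (\<Sum>i\<in>T. b {i} * (of_bool (i \<in> W) - \<tau>))\<bar>))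
     \<le> (16 / \<zeta>) ^ 4 * ((3 * s\<^sup>2 + s * (20 * c0)\<^sup>2) * BB)
       + (16 / \<zeta>)\<^sup>2 * (\<Sum>S\<in>Pow Y. if 2 \<le> card S then (b S)\<^sup>2 * s ^ card S else 0)"
    using chaos_tail[OF fin t T _ small B, of "\<zeta> / 8"] zeta unfolding z8 s_def BB_def by simp
  also have "\<dots> \<le> (16 / \<zeta>) ^ 4 * ((3 * \<sigma>\<^sup>2 + (120 / \<zeta>)\<^sup>2 * \<sigma>\<^sup>2) * BB)
       + (16 / \<zeta>)\<^sup>2 * (\<Sum>S\<in>Pow Y. if 2 \<le> card S then (b S)\<^sup>2 * \<sigma> ^ card S else 0)"
  proof (intro add_mono mult_left_mono mult_right_mono sum_mono)
    show "s\<^sup>2 \<le> \<sigma>\<^sup>2" using s by (intro power_mono) auto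
    have "s * (20 * c0)\<^sup>2 \<le> 1 * (20 * c0)\<^sup>2" using s sigma_small by (intro mult_right_mono) auto
    also have "\<dots> = (120 / \<zeta>)\<^sup>2 * \<sigma>\<^sup>2" by (simp add: c0_def power2_eq_square field_simps)
    finally show "s * (20 * c0)\<^sup>2 \<le> (120 / \<zeta>)\<^sup>2 * \<sigma>\<^sup>2" .
    fix S :: "'a set"
    show "(if 2 \<le> card S then (b S)\<^sup>2 * s ^ card S else 0) \<le> (if 2 \<le> card S then (b S)\<^sup>2 * \<sigma> ^ card S else 0)"
      using s by (auto intro!: mult_left_mono power_mono)
  qed (use BB zeta in \<open>auto simp: zero_le_even_power\<close>)
  also have "\<dots> = (16 / \<zeta>) ^ 4 * (3 + (120 / \<zeta>)\<^sup>2) * \<sigma>\<^sup>2 * BB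
      + (16 / \<zeta>)\<^sup>2 * (\<Sum>S\<in>Pow Y. if 2 \<le> card S then (b S)\<^sup>2 * \<sigma> ^ card S else 0)" by algebra
  finally show ?thesis unfolding BB_def .
qed

lemma scalar_tail:
  fixes a :: "'a set \<Rightarrow> real"
  assumes fin: "finite Y" and T: "T \<subseteq> Y"
    and small: "\<And>i. i \<in> Y - T \<Longrightarrow> \<bar>a {i}\<bar> \<le> 20 * c0"
    and a: "(\<Sum>S\<in>Pow Y. (a S)\<^sup>2) \<le> 1"
  shows "bexp \<tau> Y (\<lambda>W. of_bool (\<zeta> / 8 \<le> \<bar>chaos \<tau> Y a W - a {} - (\<Sum>i\<in>T. a {i} * (of_bool (i \<in> W) - \<tau>))\<bar>))
     \<le> D0 * \<sigma>\<^sup>2"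
proof -
  have "(\<Sum>i\<in>Y. (a {i})\<^sup>2) = (\<Sum>S\<in>(\<lambda>i. {i}) ` Y. (a S)\<^sup>2)" by (subst sum.reindex) auto
  also have "\<dots> \<le> (\<Sum>S\<in>Pow Y. (a S)\<^sup>2)" using fin by (intro sum_mono2) auto
  finally have B: "(\<Sum>i\<in>Y. (a {i})\<^sup>2) \<le> 1" using a by linarith
  have "(\<Sum>S\<in>Pow Y. if 2 \<le> card S then (a S)\<^sup>2 * \<sigma> ^ card S else 0) \<le> (\<Sum>S\<in>Pow Y. (a S)\<^sup>2 * \<sigma>\<^sup>2)"
  proof (intro sum_mono)
    fix S :: "'a set"
    have "\<sigma> ^ card S \<le> \<sigma>\<^sup>2" if "2 \<le> card S" using that sigma sigma_small by (intro power_decreasing) auto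
    then show "(if 2 \<le> card S then (a S)\<^sup>2 * \<sigma> ^ card S else 0) \<le> (a S)\<^sup>2 * \<sigma>\<^sup>2"
      by (auto intro!: mult_left_mono)
  qed
  also have "\<dots> \<le> 1 * \<sigma>\<^sup>2" unfolding sum_distrib_right[symmetric] using a by (intro mult_right_mono) auto
  finally have R: "(\<Sum>S\<in>Pow Y. if 2 \<le> card S then (a S)\<^sup>2 * \<sigma> ^ card S else 0) \<le> \<sigma>\<^sup>2" by simp
  have "(16 / \<zeta>) ^ 4 * (3 + (120 / \<zeta>)\<^sup>2) * \<sigma>\<^sup>2 * (\<Sum>i\<in>Y. (a {i})\<^sup>2)
       + (16 / \<zeta>)\<^sup>2 * (\<Sum>S\<in>Pow Y. if 2 \<le> card S then (a S)\<^sup>2 * \<sigma> ^ card S else 0)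
      \<le> (16 / \<zeta>) ^ 4 * (3 + (120 / \<zeta>)\<^sup>2) * \<sigma>\<^sup>2 * 1 + (16 / \<zeta>)\<^sup>2 * \<sigma>\<^sup>2"
    using B R zeta by (intro add_mono mult_left_mono mult_nonneg_nonneg) auto
  also have "\<dots> \<le> D0 * \<sigma>\<^sup>2"
  proof -
    have "0 \<le> 3 * ((16 / \<zeta>)\<^sup>2 * \<sigma>\<^sup>2)" by simp
    moreover have "D0 * \<sigma>\<^sup>2 = (16 / \<zeta>) ^ 4 * (3 + (120 / \<zeta>)\<^sup>2) * \<sigma>\<^sup>2 * 1 + (16 / \<zeta>)\<^sup>2 * \<sigma>\<^sup>2 + 3 * ((16 / \<zeta>)\<^sup>2 * \<sigma>\<^sup>2)"
      unfolding D0_def by algebra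
    ultimately show ?thesis by linarith
  qed
  finally show ?thesis using tail_bound[OF fin T small B] by linarith
qed

text \<open>Deleting a point at most doubles \<open>M2\<close>, so every linear coefficient is of
  order \<open>c0\<close> and the tail bound applies. This form also covers Y - {i} for pivotal i,
  as used in \<open>pivotal_not_lost\<close>.\<close>

lemma low_stays_low:
  assumes fin: "finite Y" and m: "M2 Y \<le> c0"
  shows "bexp \<tau> Y (\<lambda>W. of_bool (lam / 4 \<le> M1 W)) \<le> D0 * \<sigma>\<^sup>2"
proof -
  obtain a where a: "\<And>W. W \<subseteq> Y \<Longrightarrow> M1 W = chaos \<tau> Y a W"
    "(\<Sum>S\<in>Pow Y. (a S)\<^sup>2) \<le> 1" "M2 Y = a {}"
    "\<And>i. i \<in> Y \<Longrightarrow> M2 (Y - {i}) = a {} - \<tau> * a {i}"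
    by (rule local_expansion[OF fin]) blast
  have small: "\<bar>a {i}\<bar> \<le> 20 * c0" if i: "i \<in> Y - {}" for i
  proof -
    have "\<tau> * \<bar>a {i}\<bar> = \<bar>M2 Y - M2 (Y - {i})\<bar>"
      using a(3) a(4)[of i] i tau by (simp add: abs_mult)
    also have "\<dots> \<le> 2 * c0" using M2_delete_le[of Y i] M2_range[of Y] M2_range[of "Y - {i}"] i fin m by auto
    finally have "\<tau> * \<bar>a {i}\<bar> \<le> 2 * c0" .
    moreover have "1 / 2 * \<bar>a {i}\<bar> \<le> \<tau> * \<bar>a {i}\<bar>" using tau by (intro mult_right_mono) auto
    ultimately show ?thesis using c0_bounds by linarith
  qed
  have "bexp \<tau> Y (\<lambda>W. of_bool (lam / 4 \<le> M1 W)) \<le>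
    bexp \<tau> Y (\<lambda>W. of_bool (\<zeta> / 8 \<le> \<bar>chaos \<tau> Y a W - a {} - (\<Sum>i\<in>{}. a {i} * (of_bool (i \<in> W) - \<tau>))\<bar>))"
  proof (rule bexp_mono)
    fix W assume W: "W \<subseteq> Y"
    have "\<zeta> / 8 \<le> \<bar>chaos \<tau> Y a W - a {}\<bar>" if "lam / 4 \<le> M1 W"
      using that a(1)[OF W] a(3) m c0_bounds lam zeta by linarith
    then show "(of_bool (lam / 4 \<le> M1 W) :: real) \<le>
       of_bool (\<zeta> / 8 \<le> \<bar>chaos \<tau> Y a W - a {} - (\<Sum>i\<in>{}. a {i} * (of_bool (i \<in> W) - \<tau>))\<bar>)" by simp
  qed (use tau in auto)
  also have "\<dots> \<le> D0 * \<sigma>\<^sup>2" by (rule scalar_tail[OF fin _ small a(2)]) auto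
  finally show ?thesis .
qed


lemma high_values:
  assumes Y: "typical Y" and high: "lam / 2 \<le> M2 Y"
  shows "\<bar>M2 Y - lam\<bar> \<le> c0"
    and "i \<in> Y - T2 Y \<Longrightarrow> \<bar>M2 (Y - {i}) - lam\<bar> \<le> c0"
    and "i \<in> T2 Y \<Longrightarrow> M2 (Y - {i}) \<le> c0"
proof -
  show "\<bar>M2 Y - lam\<bar> \<le> c0"
    using typical_dichotomy(1)[OF Y] high c0_bounds(3) lam(1) zeta(1) by linarith
  show "\<bar>M2 (Y - {i}) - lam\<bar> \<le> c0" if "i \<in> Y - T2 Y"
    using typical_dichotomy(2)[OF Y, of i] that c0_bounds(3) lam(1) zeta(1) unfolding T2_def by auto
  show "M2 (Y - {i}) \<le> c0" if "i \<in> T2 Y"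
    using typical_dichotomy(2)[OF Y, of i] that c0_bounds(3) lam(1) zeta(1) unfolding T2_def by auto
qed

text \<open>If \<open>j\<close> is not pivotal either, the pair inequality prevents \<open>M2 (Y - {i} - {j})\<close> from being low.\<close>
lemma high_pair_values:
  assumes Y: "typical Y" and high: "lam / 2 \<le> M2 Y" and i: "i \<in> Y - T2 Y" and j: "j \<in> Y" "i \<noteq> j"
  shows "\<bar>M2 (Y - {i} - {j}) - M2 (Y - {i}) - M2 (Y - {j}) + M2 Y\<bar> \<le> 5 * c0"
proof -
  have fin: "finite Y" using Y by (simp add: typical_def)
  note hv = high_values[OF Y high]
  show ?thesis
  proof (cases "j \<in> T2 Y")
    case True
    \<comment> \<open>With j deleted the average is at most \<open>c0\<close>, and at most 2
      \<open>c0\<close> after the second deletion; the two high averages differ by at most 2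
      \<open>c0\<close>. This gives the 5.\<close>
    have "Y - {i} - {j} = Y - {j} - {i}" by auto
    then have "M2 (Y - {i} - {j}) \<le> 2 * M2 (Y - {j})"
      using M2_delete_le[of "Y - {j}" i] fin i j by simp
    moreover have "0 \<le> M2 (Y - {i} - {j})" "0 \<le> M2 (Y - {j})" using M2_range fin by auto
    ultimately show ?thesis using hv(1) hv(2)[OF i] hv(3)[OF True] by linarith
  next
    case False
    define r where "r = \<tau> * (\<tau> * \<rho>)"
    have r: "0 < r" "r \<le> 1 / 2 - \<zeta>" using rates by (auto simp: r_def)
    have mi: "\<bar>M2 (Y - {i}) - lam\<bar> \<le> c0" and mj: "\<bar>M2 (Y - {j}) - lam\<bar> \<le> c0"
      using hv(2) i j False by auto
    have pos: "0 \<le> M2 (Y - {i} - {j})" using M2_range fin by auto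
    have "(1 - r) * (M2 (Y - {i}) + M2 (Y - {j})) \<le> M2 Y + (1 - r)\<^sup>2 * M2 (Y - {i} - {j})"
      unfolding M2_def r_def[symmetric] using r zeta(1) i j fin f by (intro pair_inequality) auto
    also have "(1 - r)\<^sup>2 * M2 (Y - {i} - {j}) \<le> 1 * M2 (Y - {i} - {j})"
      using r zeta(1) pos by (intro mult_right_mono) (auto simp: power_le_one)
    finally have 1: "(1 - r) * (M2 (Y - {i}) + M2 (Y - {j})) \<le> M2 Y + M2 (Y - {i} - {j})" by simp
    \<comment> \<open>The factor 1 - r \<ge> 1/2 + \<zeta> yields a gain 2 \<zeta> lam \<ge> 2
      \<zeta>^2 over lam, against an error of 3 \<open>c0\<close> in total.\<close>
    have "(1 / 2 + \<zeta>) * (2 * (lam - c0)) \<le> (1 - r) * (M2 (Y - {i}) + M2 (Y - {j}))"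
      using r mi mj zeta(1) lam(1) c0_bounds by (intro mult_mono) auto
    moreover have "(1 / 2 + \<zeta>) * (2 * (lam - c0)) = lam - c0 + 2 * (\<zeta> * lam) - 2 * \<zeta> * c0"
      by algebra
    moreover have "\<zeta>\<^sup>2 \<le> \<zeta> * lam" unfolding power2_eq_square using lam(1) zeta(1) by (intro mult_left_mono) auto
    moreover have "2 * \<zeta> * c0 \<le> 1 * c0" using zeta c0_bounds(1) by (intro mult_right_mono) auto
    ultimately have "2 * \<zeta>\<^sup>2 - 3 * c0 \<le> M2 (Y - {i} - {j})" using 1 hv(1) by linarith
    then have "c0 < M2 (Y - {i} - {j})" using c0_bounds(1,2) by linarith
    then have "\<bar>M2 (Y - {i} - {j}) - lam\<bar> \<le> c0" using typical_dichotomy(3)[OF Y, of i j] i j by auto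
    then show ?thesis using hv(1) mi mj c0_bounds(1) by linarith
  qed
qed

text \<open>The coefficient a {i, j} is a second difference of \<open>M2\<close> divided by \<tau>^2
  \<ge> 1/2. Here j ranges over the pivotal points too, because the derivative in i has linear
  coefficients for every other j.\<close>

lemma high_coefficients:
  assumes Y: "typical Y" and high: "lam / 2 \<le> M2 Y"
    and a: "M2 Y = a {}" "\<And>i. i \<in> Y \<Longrightarrow> M2 (Y - {i}) = a {} - \<tau> * a {i}"
    "\<And>i j. i \<in> Y \<Longrightarrow> j \<in> Y \<Longrightarrow> i \<noteq> j \<Longrightarrow>
      M2 (Y - {i} - {j}) = a {} - \<tau> * a {i} - \<tau> * a {j} + \<tau>\<^sup>2 * a {i, j}"
  shows "i \<in> Y - T2 Y \<Longrightarrow> \<bar>a {i}\<bar> \<le> 20 * c0"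
    and "i \<in> Y - T2 Y \<Longrightarrow> j \<in> Y \<Longrightarrow> i \<noteq> j \<Longrightarrow> \<bar>a {i, j}\<bar> \<le> 20 * c0"
proof -
  show "\<bar>a {i}\<bar> \<le> 20 * c0" if i: "i \<in> Y - T2 Y"
  proof -
    have "\<tau> * \<bar>a {i}\<bar> = \<bar>M2 Y - M2 (Y - {i})\<bar>" using a(1) a(2)[of i] i tau by (simp add: abs_mult)
    also have "\<dots> \<le> 2 * c0" using high_values(1)[OF Y high] high_values(2)[OF Y high i] by linarith
    finally have "\<tau> * \<bar>a {i}\<bar> \<le> 2 * c0" .
    moreover have "1 / 2 * \<bar>a {i}\<bar> \<le> \<tau> * \<bar>a {i}\<bar>" using tau by (intro mult_right_mono) auto
    ultimately show ?thesis using c0_bounds by linarith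
  qed
  show "\<bar>a {i, j}\<bar> \<le> 20 * c0" if i: "i \<in> Y - T2 Y" and j: "j \<in> Y" "i \<noteq> j"
  proof -
    have "\<tau>\<^sup>2 * a {i, j} = M2 (Y - {i} - {j}) - M2 (Y - {i}) - M2 (Y - {j}) + M2 Y"
      using a(1) a(2)[of i] a(2)[of j] a(3)[of i j] i j by simp
    then have "\<tau>\<^sup>2 * \<bar>a {i, j}\<bar> \<le> 5 * c0"
      using high_pair_values[OF Y high i j] by (metis abs_mult abs_power2)
    moreover have "1 / 2 * \<bar>a {i, j}\<bar> \<le> \<tau>\<^sup>2 * \<bar>a {i, j}\<bar>"
      using tau by (intro mult_right_mono) (auto simp: power2_eq_square)
    ultimately show ?thesis using c0_bounds by linarith
  qed
qed

lemma card_T2_le: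
  assumes "finite Y" "lam / 2 \<le> M2 Y"
  shows "real (card (T2 Y)) \<le> 16 / \<zeta>\<^sup>2"
proof -
  have "real (card (T2 Y)) \<le> 16 / lam\<^sup>2"
    unfolding T2_def M2_def
    by (rule card_pivotal_le) (use assms rates zeta lam f in \<open>auto simp: M2_def\<close>)
  also have "\<dots> \<le> 16 / \<zeta>\<^sup>2" using lam zeta by (intro divide_left_mono power_mono mult_pos_pos) auto
  finally show ?thesis .
qed

lemma card_T1_le:
  assumes "finite W" "lam / 2 \<le> M1 W"
  shows "real (card (T1 W)) \<le> 16 / \<zeta>\<^sup>2"
proof -
  have "real (card (T1 W)) \<le> 16 / lam\<^sup>2"
    unfolding T1_def M1_def
    by (rule card_pivotal_le) (use assms rates zeta lam f in \<open>auto simp: M1_def\<close>)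
  also have "\<dots> \<le> 16 / \<zeta>\<^sup>2" using lam zeta by (intro divide_left_mono power_mono mult_pos_pos) auto
  finally show ?thesis .
qed

text \<open>The coefficients of pivotal points need not be small, but a pivotal point that survives
  has centred indicator \<sigma>. The pivotal points together thus move the average by at most
  \<zeta> / 100, and the rest is covered by the tail bound.\<close>

lemma high_stays_high:
  assumes Y: "typical Y" and high: "lam / 2 \<le> M2 Y"
  shows "bexp \<tau> Y (\<lambda>W. of_bool (T2 Y \<subseteq> W \<and> M1 W < lam / 2)) \<le> D0 * \<sigma>\<^sup>2"
proof -
  have fin: "finite Y" using Y by (simp add: typical_def)
  obtain a where a: "\<And>W. W \<subseteq> Y \<Longrightarrow> M1 W = chaos \<tau> Y a W"
    "(\<Sum>S\<in>Pow Y. (a S)\<^sup>2) \<le> 1" "M2 Y = a {}"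
    "\<And>i. i \<in> Y \<Longrightarrow> M2 (Y - {i}) = a {} - \<tau> * a {i}"
    "\<And>i j. i \<in> Y \<Longrightarrow> j \<in> Y \<Longrightarrow> i \<noteq> j \<Longrightarrow>
      M2 (Y - {i} - {j}) = a {} - \<tau> * a {i} - \<tau> * a {j} + \<tau>\<^sup>2 * a {i, j}"
    by (rule local_expansion[OF fin]) blast
  have T: "T2 Y \<subseteq> Y" by (auto simp: T2_def)
  have lin: "\<bar>\<Sum>i\<in>T2 Y. a {i} * (of_bool (i \<in> W) - \<tau>)\<bar> \<le> \<zeta> / 100" if "T2 Y \<subseteq> W" for W
  proof -
    have "\<bar>\<Sum>i\<in>T2 Y. a {i} * (of_bool (i \<in> W) - \<tau>)\<bar> \<le> (\<Sum>i\<in>T2 Y. \<bar>a {i} * (of_bool (i \<in> W) - \<tau>)\<bar>)"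
      by (rule sum_abs)
    also have "\<dots> \<le> (\<Sum>i\<in>T2 Y. 1 * \<sigma>)"
    proof (intro sum_mono)
      fix i assume i: "i \<in> T2 Y"
      have "(a {i})\<^sup>2 \<le> (\<Sum>S\<in>Pow Y. (a S)\<^sup>2)" using fin i T by (intro member_le_sum) auto
      then have "(a {i})\<^sup>2 \<le> 1\<^sup>2" using a(2) by simp
      then have "\<bar>a {i}\<bar> \<le> 1" by (metis abs_le_square_iff abs_one)
      then have "\<bar>a {i}\<bar> * \<sigma> \<le> 1 * \<sigma>" using sigma by (intro mult_right_mono) auto
      moreover have "i \<in> W" using i that by auto
      ultimately show "\<bar>a {i} * (of_bool (i \<in> W) - \<tau>)\<bar> \<le> 1 * \<sigma>"
        using sigma by (simp add: abs_mult \<tau>_def)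
    qed
    also have "\<dots> = real (card (T2 Y)) * \<sigma>" by simp
    also have "\<dots> \<le> 16 / \<zeta>\<^sup>2 * (\<zeta> ^ 3 / 2000)"
      using card_T2_le[OF fin high] sigma by (intro mult_mono) auto
    also have "\<dots> = 16 / 2000 * \<zeta>" using zeta by (simp add: power2_eq_square power3_eq_cube)
    also have "\<dots> \<le> \<zeta> / 100" using zeta by simp
    finally show ?thesis .
  qed
  have "bexp \<tau> Y (\<lambda>W. of_bool (T2 Y \<subseteq> W \<and> M1 W < lam / 2)) \<le>
    bexp \<tau> Y (\<lambda>W. of_bool (\<zeta> / 8 \<le> \<bar>chaos \<tau> Y a W - a {} - (\<Sum>i\<in>T2 Y. a {i} * (of_bool (i \<in> W) - \<tau>))\<bar>))"
  proof (rule bexp_mono)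
    fix W assume W: "W \<subseteq> Y"
    have "\<zeta> / 8 \<le> \<bar>chaos \<tau> Y a W - a {} - (\<Sum>i\<in>T2 Y. a {i} * (of_bool (i \<in> W) - \<tau>))\<bar>"
      if w: "T2 Y \<subseteq> W \<and> M1 W < lam / 2"
      using w lin[of W] a(1)[OF W] a(3) high_values(1)[OF Y high] c0_bounds(3) lam(1) zeta(1) by linarith
    then show "(of_bool (T2 Y \<subseteq> W \<and> M1 W < lam / 2) :: real) \<le>
       of_bool (\<zeta> / 8 \<le> \<bar>chaos \<tau> Y a W - a {} - (\<Sum>i\<in>T2 Y. a {i} * (of_bool (i \<in> W) - \<tau>))\<bar>)" by simp
  qed (use tau in auto)
  also have "\<dots> \<le> D0 * \<sigma>\<^sup>2"
    by (rule scalar_tail[OF fin T _ a(2)]) (rule high_coefficients(1)[where a = a, OF Y high a(3-5)])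
  finally show ?thesis .
qed

text \<open>For pivotal i the set Y - {i} is low and W - {i} is a random subset of it, so
  \<open>low_stays_low\<close> applies; there are at most 16 / \<zeta>^2 such i. If i itself was
  deleted, W - {i} = W is high, which falls under the same event.\<close>

lemma pivotal_not_lost:
  assumes Y: "typical Y" and high: "lam / 2 \<le> M2 Y"
  shows "bexp \<tau> Y (\<lambda>W. of_bool (lam / 2 \<le> M1 W \<and> \<not> T2 Y \<subseteq> T1 W)) \<le> 16 / \<zeta>\<^sup>2 * (D0 * \<sigma>\<^sup>2)"
proof -
  have fin: "finite Y" using Y by (simp add: typical_def)
  have T: "T2 Y \<subseteq> Y" by (auto simp: T2_def)
  then have finT: "finite (T2 Y)" using fin finite_subset by blast
  have D0: "0 \<le> D0 * \<sigma>\<^sup>2" using zeta by (auto simp: D0_def intro!: mult_nonneg_nonneg add_nonneg_nonneg)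
  have "bexp \<tau> Y (\<lambda>W. of_bool (lam / 2 \<le> M1 W \<and> \<not> T2 Y \<subseteq> T1 W)) \<le>
      bexp \<tau> Y (\<lambda>W. \<Sum>i\<in>T2 Y. of_bool (lam / 4 \<le> M1 (W - {i})))"
  proof (rule bexp_mono)
    fix W assume W: "W \<subseteq> Y"
    have nn: "0 \<le> (\<Sum>i\<in>T2 Y. (of_bool (lam / 4 \<le> M1 (W - {i})) :: real))" by (intro sum_nonneg) auto
    show "of_bool (lam / 2 \<le> M1 W \<and> \<not> T2 Y \<subseteq> T1 W) \<le> (\<Sum>i\<in>T2 Y. (of_bool (lam / 4 \<le> M1 (W - {i})) :: real))"
    proof (cases "lam / 2 \<le> M1 W \<and> \<not> T2 Y \<subseteq> T1 W")
      case True
      then obtain i where i: "i \<in> T2 Y" "i \<notin> T1 W" by auto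
      have "lam / 4 \<le> M1 (W - {i})"
      proof (cases "i \<in> W")
        case False
        then have "W - {i} = W" by auto
        then show ?thesis using True lam zeta by simp
      qed (use i in \<open>auto simp: T1_def\<close>)
      then have "1 \<le> (\<Sum>i\<in>T2 Y. (of_bool (lam / 4 \<le> M1 (W - {i})) :: real))"
        using member_le_sum[of i "T2 Y" "\<lambda>i. of_bool (lam / 4 \<le> M1 (W - {i})) :: real"] i finT by simp
      then show ?thesis using True by simp
    qed (use nn in auto)
  qed (use tau in auto)
  also have "\<dots> = (\<Sum>i\<in>T2 Y. bexp \<tau> (Y - {i}) (\<lambda>W. of_bool (lam / 4 \<le> M1 W)))"
    unfolding bexp_sum
  proof (intro sum.cong refl)
    fix i assume "i \<in> T2 Y"
    then have "i \<in> Y" using T by auto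
    then show "bexp \<tau> Y (\<lambda>W. of_bool (lam / 4 \<le> M1 (W - {i}))) = bexp \<tau> (Y - {i}) (\<lambda>W. of_bool (lam / 4 \<le> M1 W))"
      using bexp_not_depends[OF fin, of i \<tau> "\<lambda>W. of_bool (lam / 4 \<le> M1 W)"] by simp
  qed
  also have "\<dots> \<le> (\<Sum>i\<in>T2 Y. D0 * \<sigma>\<^sup>2)"
    using fin high_values(3)[OF Y high] by (intro sum_mono low_stays_low) auto
  also have "\<dots> = real (card (T2 Y)) * (D0 * \<sigma>\<^sup>2)" by simp
  also have "\<dots> \<le> 16 / \<zeta>\<^sup>2 * (D0 * \<sigma>\<^sup>2)" using card_T2_le[OF fin high] D0 by (intro mult_right_mono) auto
  finally show ?thesis .
qed

text \<open>A union bound over all points of Y - T2 Y must not lose their number. The event for i is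
  bounded by squared coefficients of the sets containing i, so after double counting each set U
  carries an extra factor card U, which powers of \<sigma> absorb from degree 3 on and which is 2 on
  pairs.\<close>

lemma pivotal_not_gained:
  assumes Y: "typical Y" and high: "lam / 2 \<le> M2 Y"
  shows "bexp \<tau> Y (\<lambda>W. of_bool (lam / 2 \<le> M1 W \<and> \<not> T1 W \<subseteq> T2 Y)) \<le> 2 * (D0 * \<sigma>\<^sup>2)"
proof -
  have fin: "finite Y" using Y by (simp add: typical_def)
  obtain a where a: "\<And>W. W \<subseteq> Y \<Longrightarrow> M1 W = chaos \<tau> Y a W"
    "(\<Sum>S\<in>Pow Y. (a S)\<^sup>2) \<le> 1" "M2 Y = a {}"
    "\<And>i. i \<in> Y \<Longrightarrow> M2 (Y - {i}) = a {} - \<tau> * a {i}"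
    "\<And>i j. i \<in> Y \<Longrightarrow> j \<in> Y \<Longrightarrow> i \<noteq> j \<Longrightarrow>
      M2 (Y - {i} - {j}) = a {} - \<tau> * a {i} - \<tau> * a {j} + \<tau>\<^sup>2 * a {i, j}"
    by (rule local_expansion[OF fin]) blast
  have co: "\<bar>a {i}\<bar> \<le> 20 * c0" "\<And>j. j \<in> Y \<Longrightarrow> i \<noteq> j \<Longrightarrow> \<bar>a {i, j}\<bar> \<le> 20 * c0" if "i \<in> Y - T2 Y" for i
    using high_coefficients[where a = a and i = i, OF Y high a(3)] a(4,5) that by blast+
  define b where "b = (\<lambda>i S. a (insert i S))"
  define P where "P = (\<lambda>i W. of_bool (\<zeta> / 8 \<le> \<bar>chaos \<tau> (Y - {i}) (b i) W - b i {} - (\<Sum>j\<in>{}. b i {j} * (of_bool (j \<in> W) - \<tau>))\<bar>) :: real)"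
  \<comment> \<open>\<open>FB\<close> holds the pairs, which give the linear part of the
    derivatives, and \<open>FR\<close> the larger sets. The exponent drops by one because the
    derivative removes i from U.\<close>
  define FB where "FB = (\<lambda>U :: 'a set. if card U = 2 then (a U)\<^sup>2 else 0)"
  define FR where "FR = (\<lambda>U :: 'a set. if 3 \<le> card U then (a U)\<^sup>2 * \<sigma> ^ (card U - 1) else 0)"
  have card_ins: "card (insert i S) = Suc (card S)" if "S \<subseteq> Y - {i}" for i S
    using that fin finite_subset[of S "Y - {i}"] by (subst card_insert_disjoint) auto
  have B: "(\<Sum>j\<in>Y - {i}. (b i {j})\<^sup>2) = (\<Sum>S\<in>Pow (Y - {i}). FB (insert i S))" if "i \<in> Y" for i
  proof -
    have "(\<Sum>j\<in>Y - {i}. (b i {j})\<^sup>2) = (\<Sum>S\<in>Pow (Y - {i}). if card S = 1 then (b i S)\<^sup>2 else 0)"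
      by (rule sum_Pow_singletons[symmetric]) (use fin in simp)
    also have "\<dots> = (\<Sum>S\<in>Pow (Y - {i}). FB (insert i S))"
      by (intro sum.cong refl) (auto simp: FB_def b_def card_ins)
    finally show ?thesis .
  qed
  have R: "(\<Sum>S\<in>Pow (Y - {i}). if 2 \<le> card S then (b i S)\<^sup>2 * \<sigma> ^ card S else 0)
      = (\<Sum>S\<in>Pow (Y - {i}). FR (insert i S))" for i
    by (intro sum.cong refl) (auto simp: FR_def b_def card_ins)
  have FB0: "0 \<le> FB U" and FBa: "FB U \<le> (a U)\<^sup>2" for U by (auto simp: FB_def)
  have B1: "(\<Sum>j\<in>Y - {i}. (b i {j})\<^sup>2) \<le> 1" if "i \<in> Y" for i
  proof -
    have "(\<Sum>S\<in>Pow (Y - {i}). FB (insert i S)) \<le> (\<Sum>U\<in>Pow Y. FB U)"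
      by (rule sum_delete_insert_le[OF fin that FB0])
    also have "\<dots> \<le> (\<Sum>U\<in>Pow Y. (a U)\<^sup>2)" by (intro sum_mono FBa)
    finally show ?thesis using a(2) B[OF that] by linarith
  qed
  let ?DD = "(16 / \<zeta>) ^ 4 * (3 + (120 / \<zeta>)\<^sup>2) * \<sigma>\<^sup>2"
  have one: "bexp \<tau> (Y - {i}) (P i) \<le> ?DD * (\<Sum>S\<in>Pow (Y - {i}). FB (insert i S))
      + (16 / \<zeta>)\<^sup>2 * (\<Sum>S\<in>Pow (Y - {i}). FR (insert i S))" if i: "i \<in> Y - T2 Y" for i
    unfolding P_def B[symmetric, OF DiffD1[OF i]] R[symmetric]
  proof (rule tail_bound)
    show "\<bar>b i {j}\<bar> \<le> 20 * c0" if "j \<in> Y - {i} - {}" for j using co(2)[OF i, of j] that by (auto simp: b_def)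
  qed (use fin B1[of i] i in auto)
  have "bexp \<tau> Y (\<lambda>W. of_bool (lam / 2 \<le> M1 W \<and> \<not> T1 W \<subseteq> T2 Y)) \<le>
      bexp \<tau> Y (\<lambda>W. \<Sum>i\<in>Y - T2 Y. P i (W - {i}))"
  proof (rule bexp_mono)
    fix W assume W: "W \<subseteq> Y"
    have nn: "0 \<le> (\<Sum>i\<in>Y - T2 Y. P i (W - {i}))" by (intro sum_nonneg) (auto simp: P_def)
    show "of_bool (lam / 2 \<le> M1 W \<and> \<not> T1 W \<subseteq> T2 Y) \<le> (\<Sum>i\<in>Y - T2 Y. P i (W - {i}))"
    proof (cases "lam / 2 \<le> M1 W \<and> \<not> T1 W \<subseteq> T2 Y")
      case True
      then obtain i where i: "i \<in> T1 W" "i \<notin> T2 Y" by auto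
      then have iW: "i \<in> W" "M1 (W - {i}) < lam / 4" by (auto simp: T1_def)
      have iY: "i \<in> Y - T2 Y" using i iW W by auto
      have "chaos \<tau> (Y - {i}) (b i) (W - {i}) = chaos \<tau> Y a (insert i W) - chaos \<tau> Y a (W - {i})"
        unfolding b_def using chaos_difference[OF fin DiffD1[OF iY]] by simp
      also have "\<dots> = M1 W - M1 (W - {i})" using a(1)[OF W] a(1)[OF subset_trans[OF Diff_subset W]] iW(1)
        by (simp add: insert_absorb)
      finally have ch: "chaos \<tau> (Y - {i}) (b i) (W - {i}) = M1 W - M1 (W - {i})" .
      \<comment> \<open>The derivative in i has mean a {i}, of size at most 20 \<open>c0\<close>
        \<le> \<zeta> / 60, whereas a newly pivotal i makes its value exceed lam / 4.\<close>
      have "\<bar>b i {}\<bar> \<le> 20 * c0" using co(1)[OF iY] by (simp add: b_def)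
      then have "\<zeta> / 8 \<le> \<bar>chaos \<tau> (Y - {i}) (b i) (W - {i}) - b i {}\<bar>"
        unfolding ch using True iW(2) c0_bounds(3) lam(1) zeta(1) by linarith
      then have "P i (W - {i}) = 1" by (simp add: P_def)
      then have "1 \<le> (\<Sum>i\<in>Y - T2 Y. P i (W - {i}))"
        using member_le_sum[of i "Y - T2 Y" "\<lambda>i. P i (W - {i})"] iY fin by (simp add: P_def)
      then show ?thesis using True by simp
    qed (use nn in auto)
  qed (use tau in auto)
  also have "\<dots> = (\<Sum>i\<in>Y - T2 Y. bexp \<tau> (Y - {i}) (P i))"
    unfolding bexp_sum by (intro sum.cong refl bexp_not_depends fin) auto
  also have "\<dots> \<le> (\<Sum>i\<in>Y - T2 Y. ?DD * (\<Sum>S\<in>Pow (Y - {i}). FB (insert i S))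
      + (16 / \<zeta>)\<^sup>2 * (\<Sum>S\<in>Pow (Y - {i}). FR (insert i S)))"
    by (intro sum_mono one)
  also have "\<dots> \<le> (\<Sum>i\<in>Y. ?DD * (\<Sum>S\<in>Pow (Y - {i}). FB (insert i S))
      + (16 / \<zeta>)\<^sup>2 * (\<Sum>S\<in>Pow (Y - {i}). FR (insert i S)))"
    using fin zeta sigma by (intro sum_mono2)
      (auto simp: FB_def FR_def intro!: sum_nonneg mult_nonneg_nonneg add_nonneg_nonneg)
  also have "\<dots> = ?DD * (\<Sum>U\<in>Pow Y. real (card U) * FB U) + (16 / \<zeta>)\<^sup>2 * (\<Sum>U\<in>Pow Y. real (card U) * FR U)"
    unfolding sum.distrib sum_distrib_left[symmetric] sum_Pow_delete_insert[OF fin] ..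
  also have "\<dots> \<le> ?DD * 2 + (16 / \<zeta>)\<^sup>2 * (8 * \<sigma>\<^sup>2)"
  proof (intro add_mono mult_left_mono)
    have "(\<Sum>U\<in>Pow Y. real (card U) * FB U) \<le> (\<Sum>U\<in>Pow Y. 2 * (a U)\<^sup>2)"
      by (intro sum_mono) (auto simp: FB_def)
    then show "(\<Sum>U\<in>Pow Y. real (card U) * FB U) \<le> 2"
      using a(2) unfolding sum_distrib_left[symmetric] by linarith
    have "(\<Sum>U\<in>Pow Y. real (card U) * FR U) \<le> (\<Sum>U\<in>Pow Y. (8 * \<sigma>\<^sup>2) * (a U)\<^sup>2)"
    proof (intro sum_mono)
      fix U :: "'a set"
      show "real (card U) * FR U \<le> (8 * \<sigma>\<^sup>2) * (a U)\<^sup>2"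
      proof (cases "3 \<le> card U")
        case True
        then obtain n where n: "card U = Suc n" "2 \<le> n" by (cases "card U") auto
        \<comment> \<open>Bounding card U by 2^(card U) turns the product into 2 (2 \<sigma>)^n with
          n \<ge> 2.\<close>
        have "real (card U) * \<sigma> ^ n \<le> 2 ^ card U * \<sigma> ^ n"
          using sigma of_nat_less_two_power[of "card U", where ?'a = real] by (intro mult_right_mono) auto
        also have "\<dots> = 2 * (2 * \<sigma>) ^ n" using n by (simp add: power_mult_distrib)
        also have "\<dots> \<le> 2 * (2 * \<sigma>)\<^sup>2"
          using n sigma sigma_small by (intro mult_left_mono power_decreasing) auto
        also have "\<dots> = 8 * \<sigma>\<^sup>2" by (simp add: power2_eq_square)
        finally have "real (card U) * \<sigma> ^ n * (a U)\<^sup>2 \<le> 8 * \<sigma>\<^sup>2 * (a U)\<^sup>2" by (intro mult_right_mono) auto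
        then show ?thesis using True n by (simp add: FR_def mult_ac)
      qed (auto simp: FR_def)
    qed
    also have "\<dots> \<le> 8 * \<sigma>\<^sup>2 * 1" unfolding sum_distrib_left[symmetric] using a(2) by (intro mult_left_mono) auto
    finally show "(\<Sum>U\<in>Pow Y. real (card U) * FR U) \<le> 8 * \<sigma>\<^sup>2" by simp
  qed (use zeta in auto)
  also have "\<dots> = 2 * (D0 * \<sigma>\<^sup>2)" unfolding D0_def by algebra
  finally show ?thesis .
qed

text \<open>The label of a point is its set of pivotal points if its average is high. Deleting points turns
  \<open>Y\<close> into \<open>W\<close> badly if the labels do not match and this is not explained by the deletion of a
  pivotal point.\<close>
definition bad :: "'a set \<Rightarrow> 'a set \<Rightarrow> bool" where
  "bad Y W \<longleftrightarrow> (M2 Y < lam / 2 \<and> lam / 2 \<le> M1 W) \<or>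
     (lam / 2 \<le> M2 Y \<and> lam / 2 \<le> M1 W \<and> T1 W \<noteq> T2 Y) \<or>
     (lam / 2 \<le> M2 Y \<and> T2 Y \<subseteq> W \<and> M1 W < lam / 2)"

lemma bad_le:
  assumes Y: "typical Y"
  shows "bexp \<tau> Y (\<lambda>W. of_bool (bad Y W)) \<le> (3 + 16 / \<zeta>\<^sup>2) * (D0 * \<sigma>\<^sup>2)"
proof -
  have fin: "finite Y" using Y by (simp add: typical_def)
  have D0: "0 \<le> D0 * \<sigma>\<^sup>2" using zeta by (auto simp: D0_def intro!: mult_nonneg_nonneg add_nonneg_nonneg)
  have t: "0 \<le> \<tau>" "\<tau> \<le> 1" using tau by auto
  show ?thesis
  proof (cases "lam / 2 \<le> M2 Y")
    case False
    then have m: "M2 Y \<le> c0" using typical_dichotomy(1)[OF Y] c0_bounds(3) lam(1) zeta(1) by linarith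
    have "bexp \<tau> Y (\<lambda>W. of_bool (bad Y W)) \<le> bexp \<tau> Y (\<lambda>W. of_bool (lam / 4 \<le> M1 W))"
      using False lam(1) zeta(1) by (intro bexp_mono[OF t]) (auto simp: bad_def)
    also have "\<dots> \<le> 1 * (D0 * \<sigma>\<^sup>2)" using low_stays_low[OF fin m] by simp
    also have "\<dots> \<le> (3 + 16 / \<zeta>\<^sup>2) * (D0 * \<sigma>\<^sup>2)" using D0 by (intro mult_right_mono) auto
    finally show ?thesis .
  next
    case True
    have "bexp \<tau> Y (\<lambda>W. of_bool (bad Y W)) \<le> bexp \<tau> Y (\<lambda>W.
       of_bool (T2 Y \<subseteq> W \<and> M1 W < lam / 2) + of_bool (lam / 2 \<le> M1 W \<and> \<not> T2 Y \<subseteq> T1 W)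
       + of_bool (lam / 2 \<le> M1 W \<and> \<not> T1 W \<subseteq> T2 Y))"
      using True by (intro bexp_mono[OF t]) (auto simp: bad_def)
    also have "\<dots> \<le> D0 * \<sigma>\<^sup>2 + 16 / \<zeta>\<^sup>2 * (D0 * \<sigma>\<^sup>2) + 2 * (D0 * \<sigma>\<^sup>2)"
      unfolding bexp_add by (intro add_mono high_stays_high pivotal_not_lost pivotal_not_gained Y True)
    finally show ?thesis by (simp add: algebra_simps)
  qed
qed

end

subsection \<open>Certificates from the spectral gap\<close>

lemma bexp_one: "finite A \<Longrightarrow> bexp 1 A \<phi> = \<phi> A"
  by (induction A arbitrary: \<phi> rule: finite_induct) (simp_all add: bexp_insert)

text \<open>The factor \<open>t\<close> bounds the squared maximal correlation \<open>t * (1 - q) / (1 - q * t)\<close> of a \<open>q\<close>-biased bit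
  and its noisy copy.\<close>
lemma bexp_noise_contraction:
  assumes "finite A" "0 \<le> q" "q \<le> 1" "0 \<le> t" "t \<le> 1"
  shows "bexp q A (\<lambda>Y. (bexp t Y \<phi>)\<^sup>2) \<le> t * bexp (q * t) A (\<lambda>W. (\<phi> W)\<^sup>2) + (1 - t) * (bexp (q * t) A \<phi>)\<^sup>2"
  using assms(1)
proof (induction A arbitrary: \<phi> rule: finite_induct)
  case empty
  then show ?case by (simp add: algebra_simps)
next
  case (insert i A)
  define f1 where "f1 = (\<lambda>W. \<phi> (insert i W))"
  \<comment> \<open>\<open>G\<close> is the mean over a bit of bias q t and \<open>D\<close> the
    discrete derivative; the two cases i in Y and i not in Y shift \<open>G\<close> by multiples of
    \<open>D\<close> whose mean is 0.\<close>
  define G where "G = (\<lambda>W. (1 - q * t) * \<phi> W + q * t * f1 W)"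
  define D where "D = (\<lambda>W. f1 W - \<phi> W)"
  have fin: "finite Y" "i \<notin> Y" if "Y \<subseteq> A" for Y using that insert.hyps finite_subset by auto
  have "bexp q A (\<lambda>Y. (bexp t (insert i Y) \<phi>)\<^sup>2) = bexp q A (\<lambda>Y. (bexp t Y G + (1 - q) * t * bexp t Y D)\<^sup>2)"
    by (intro bexp_cong arg_cong[where f = power2])
      (simp add: bexp_insert fin G_def D_def f1_def bexp_add bexp_diff bexp_cmult algebra_simps)
  moreover have "bexp q A (\<lambda>Y. (bexp t Y \<phi>)\<^sup>2) = bexp q A (\<lambda>Y. (bexp t Y G - q * t * bexp t Y D)\<^sup>2)"
    by (intro bexp_cong arg_cong[where f = power2])
      (simp add: G_def D_def bexp_add bexp_diff bexp_cmult algebra_simps)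
  ultimately have "bexp q (insert i A) (\<lambda>Y. (bexp t Y \<phi>)\<^sup>2) =
     bexp q A (\<lambda>Y. q * (bexp t Y G + (1 - q) * t * bexp t Y D)\<^sup>2 + (1 - q) * (bexp t Y G - q * t * bexp t Y D)\<^sup>2)"
    using insert.hyps by (simp add: bexp_insert bexp_add bexp_cmult)
  also have "\<dots> = bexp q A (\<lambda>Y. (bexp t Y G)\<^sup>2 + q * (1 - q) * t\<^sup>2 * (bexp t Y D)\<^sup>2)"
    by (intro bexp_cong) algebra
  also have "\<dots> = bexp q A (\<lambda>Y. (bexp t Y G)\<^sup>2) + q * (1 - q) * t\<^sup>2 * bexp q A (\<lambda>Y. (bexp t Y D)\<^sup>2)"
    by (simp add: bexp_add bexp_cmult)
  also have "\<dots> \<le> (t * bexp (q * t) A (\<lambda>W. (G W)\<^sup>2) + (1 - t) * (bexp (q * t) A G)\<^sup>2)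
      + t * (q * t * (1 - q * t)) * bexp (q * t) A (\<lambda>W. (D W)\<^sup>2)"
  proof (rule add_mono[OF insert.IH mult_mono])
    \<comment> \<open>The derivative part has weight q (1 - q) t^2, and extracting one factor t
      leaves at most the variance of a bit of bias q t. This is the gain that yields the
      gap.\<close>
    have "q * (1 - q) * t\<^sup>2 = (q * t * t) * (1 - q)" by algebra
    also have "\<dots> \<le> (q * t * t) * (1 - q * t)"
      using assms mult_left_le[of t q] by (intro mult_left_mono) auto
    finally show "q * (1 - q) * t\<^sup>2 \<le> t * (q * t * (1 - q * t))" by (simp add: mult_ac)
    have "bexp q A (\<lambda>Y. (bexp t Y D)\<^sup>2) \<le> bexp q A (\<lambda>Y. bexp t Y (\<lambda>W. (D W)\<^sup>2))"
      using assms fin by (intro bexp_mono bexp_square_le) auto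
    then show "bexp q A (\<lambda>Y. (bexp t Y D)\<^sup>2) \<le> bexp (q * t) A (\<lambda>W. (D W)\<^sup>2)"
      using bexp_comp[OF insert.hyps(1)] by metis
  qed (use assms in \<open>auto intro!: mult_nonneg_nonneg bexp_nonneg simp: mult_le_one\<close>)
  also have "\<dots> = t * bexp (q * t) A (\<lambda>W. (G W)\<^sup>2 + q * t * (1 - q * t) * (D W)\<^sup>2) + (1 - t) * (bexp (q * t) A G)\<^sup>2"
    unfolding bexp_add bexp_cmult by algebra
  also have "bexp (q * t) A (\<lambda>W. (G W)\<^sup>2 + q * t * (1 - q * t) * (D W)\<^sup>2) =
      bexp (q * t) A (\<lambda>W. q * t * (f1 W)\<^sup>2 + (1 - q * t) * (\<phi> W)\<^sup>2)"
    unfolding G_def D_def by (intro bexp_cong) algebra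
  also have "\<dots> = bexp (q * t) (insert i A) (\<lambda>W. (\<phi> W)\<^sup>2)"
    using insert.hyps by (simp add: bexp_insert bexp_add bexp_cmult f1_def)
  also have "bexp (q * t) A G = bexp (q * t) (insert i A) \<phi>"
    using insert.hyps by (simp add: bexp_insert bexp_add bexp_cmult f1_def G_def)
  finally show ?case .
qed

text \<open>For fixed Y the best constant approximation of \<psi> below Y is its conditional mean,
  so the right side is at least the mean conditional variance, to which the contraction applies. The
  function \<phi> may differ from \<psi>, so labels of two different levels can be compared.\<close>

lemma noise_gap:
  assumes "finite A" "0 \<le> q" "q \<le> 1" "0 \<le> t" "t \<le> 1"
  shows "(1 - t) * (bexp (q * t) A (\<lambda>W. (\<psi> W)\<^sup>2) - (bexp (q * t) A \<psi>)\<^sup>2)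
    \<le> bexp q A (\<lambda>Y. bexp t Y (\<lambda>W. (\<phi> Y - \<psi> W)\<^sup>2))"
proof -
  have "bexp q A (\<lambda>Y. bexp t Y (\<lambda>W. (\<psi> W)\<^sup>2) - (bexp t Y \<psi>)\<^sup>2) \<le> bexp q A (\<lambda>Y. bexp t Y (\<lambda>W. (\<phi> Y - \<psi> W)\<^sup>2))"
  proof (rule bexp_mono)
    fix Y assume "Y \<subseteq> A"
    then have "finite Y" using assms finite_subset by auto
    have "bexp t Y (\<lambda>W. (\<phi> Y - \<psi> W)\<^sup>2) = bexp t Y (\<lambda>W. (\<phi> Y)\<^sup>2 - 2 * \<phi> Y * \<psi> W + (\<psi> W)\<^sup>2)"
      by (intro bexp_cong) (simp add: power2_eq_square algebra_simps)
    also have "\<dots> = (\<phi> Y)\<^sup>2 - 2 * \<phi> Y * bexp t Y \<psi> + bexp t Y (\<lambda>W. (\<psi> W)\<^sup>2)"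
      using \<open>finite Y\<close> by (simp add: bexp_add bexp_diff bexp_cmult)
    finally have "bexp t Y (\<lambda>W. (\<phi> Y - \<psi> W)\<^sup>2) - (bexp t Y (\<lambda>W. (\<psi> W)\<^sup>2) - (bexp t Y \<psi>)\<^sup>2)
        = (\<phi> Y - bexp t Y \<psi>)\<^sup>2" by (simp add: power2_eq_square algebra_simps)
    then show "bexp t Y (\<lambda>W. (\<psi> W)\<^sup>2) - (bexp t Y \<psi>)\<^sup>2 \<le> bexp t Y (\<lambda>W. (\<phi> Y - \<psi> W)\<^sup>2)"
      using zero_le_power2[of "\<phi> Y - bexp t Y \<psi>"] by linarith
  qed (use assms in auto)
  then have "bexp (q * t) A (\<lambda>W. (\<psi> W)\<^sup>2) - bexp q A (\<lambda>Y. (bexp t Y \<psi>)\<^sup>2) \<le> bexp q A (\<lambda>Y. bexp t Y (\<lambda>W. (\<phi> Y - \<psi> W)\<^sup>2))"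
    unfolding bexp_diff bexp_comp[OF assms(1)] .
  then show ?thesis using bexp_noise_contraction[OF assms, of \<psi>] by (simp add: algebra_simps)
qed

text \<open>As W is contained in Y, the event T \<subseteq> W forces T into both sets and is
  independent of the other coordinates. It transfers the gap to the cube above T.\<close>

lemma bexp_restrict_pair:
  assumes "finite A" "T \<subseteq> A"
  shows "bexp q A (\<lambda>Y. bexp t Y (\<lambda>W. of_bool (T \<subseteq> W) * \<omega> Y W)) =
    (q * t) ^ card T * bexp q (A - T) (\<lambda>Y. bexp t Y (\<lambda>W. \<omega> (T \<union> Y) (T \<union> W)))"
proof -
  have "finite T" using assms finite_subset by blast
  then show ?thesis using assms
  proof (induction T arbitrary: A \<omega> rule: finite_induct)
    case (insert i T)
    define B where "B = A - {i}"
    have B: "finite B" "T \<subseteq> B" "i \<in> A" "B - T = A - insert i T" using insert.prems insert.hyps by (auto simp: B_def)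
    have fin: "finite Y" "i \<notin> Y" if "Y \<subseteq> B" for Y
      using finite_subset[OF that B(1)] that by (auto simp: B_def)
    have 1: "bexp t Y (\<lambda>W. of_bool (insert i T \<subseteq> W) * \<omega> Y W) = 0" if "Y \<subseteq> B" for Y
    proof -
      have "bexp t Y (\<lambda>W. of_bool (insert i T \<subseteq> W) * \<omega> Y W) = bexp t Y (\<lambda>W. 0)"
        using fin[OF that] by (intro bexp_cong) auto
      then show ?thesis using fin[OF that] by simp
    qed
    have 2: "bexp t (insert i Y) (\<lambda>W. of_bool (insert i T \<subseteq> W) * \<omega> (insert i Y) W) =
        t * bexp t Y (\<lambda>W. of_bool (T \<subseteq> W) * \<omega> (insert i Y) (insert i W))" if Y: "Y \<subseteq> B" for Y
    proof -
      have "bexp t Y (\<lambda>W. of_bool (insert i T \<subseteq> W) * \<omega> (insert i Y) W) = bexp t Y (\<lambda>W. 0)"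
        using fin[OF Y] by (intro bexp_cong) auto
      moreover have "bexp t Y (\<lambda>W. of_bool (insert i T \<subseteq> insert i W) * \<omega> (insert i Y) (insert i W)) =
          bexp t Y (\<lambda>W. of_bool (T \<subseteq> W) * \<omega> (insert i Y) (insert i W))"
        using insert.hyps by (intro bexp_cong) auto
      ultimately show ?thesis using fin[OF Y] by (simp add: bexp_insert)
    qed
    have "bexp q A (\<lambda>Y. bexp t Y (\<lambda>W. of_bool (insert i T \<subseteq> W) * \<omega> Y W)) =
      q * bexp q B (\<lambda>Y. bexp t (insert i Y) (\<lambda>W. of_bool (insert i T \<subseteq> W) * \<omega> (insert i Y) W))
      + (1 - q) * bexp q B (\<lambda>Y. bexp t Y (\<lambda>W. of_bool (insert i T \<subseteq> W) * \<omega> Y W))"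
      unfolding B_def using insert.prems by (intro bexp_remove) auto
    also have "bexp q B (\<lambda>Y. bexp t Y (\<lambda>W. of_bool (insert i T \<subseteq> W) * \<omega> Y W)) = bexp q B (\<lambda>_. 0)"
      by (intro bexp_cong 1)
    also have "bexp q B (\<lambda>Y. bexp t (insert i Y) (\<lambda>W. of_bool (insert i T \<subseteq> W) * \<omega> (insert i Y) W))
       = bexp q B (\<lambda>Y. t * bexp t Y (\<lambda>W. of_bool (T \<subseteq> W) * \<omega> (insert i Y) (insert i W)))"
      by (intro bexp_cong 2)
    also have "\<dots> = t * ((q * t) ^ card T * bexp q (B - T) (\<lambda>Y. bexp t Y (\<lambda>W. \<omega> (insert i (T \<union> Y)) (insert i (T \<union> W)))))"
      unfolding bexp_cmult insert.IH[OF B(1,2), of "\<lambda>Y W. \<omega> (insert i Y) (insert i W)"] ..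
    finally show ?case using B insert.hyps by simp
  qed simp
qed

lemma bexp_restrict:
  assumes "finite A" "T \<subseteq> A"
  shows "bexp p A (\<lambda>X. of_bool (T \<subseteq> X) * \<phi> X) = p ^ card T * bexp p (A - T) (\<lambda>X. \<phi> (T \<union> X))"
proof -
  have "bexp p A (\<lambda>Y. bexp 1 Y (\<lambda>W. of_bool (T \<subseteq> W) * \<phi> W)) = bexp p A (\<lambda>X. of_bool (T \<subseteq> X) * \<phi> X)"
    using assms finite_subset by (intro bexp_cong bexp_one) auto
  moreover have "bexp p (A - T) (\<lambda>Y. bexp 1 Y (\<lambda>W. \<phi> (T \<union> W))) = bexp p (A - T) (\<lambda>X. \<phi> (T \<union> X))"
    by (intro bexp_cong bexp_one) (meson assms(1) finite_Diff finite_subset)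
  ultimately show ?thesis using bexp_restrict_pair[OF assms, of p 1 "\<lambda>_. \<phi>"] by simp
qed

lemma bexp_restrict_le:
  assumes "finite A" "T \<subseteq> A" "0 \<le> p" "p \<le> 1" "\<And>X. X \<subseteq> A \<Longrightarrow> 0 \<le> \<phi> X"
  shows "p ^ card T * bexp p (A - T) (\<lambda>X. \<phi> (T \<union> X)) \<le> bexp p A \<phi>"
  unfolding bexp_restrict[OF assms(1,2), symmetric]
  using assms by (intro bexp_mono) auto

lemma ex_le_weighted_average:
  fixes w v :: "'b \<Rightarrow> real"
  assumes "finite I" "\<And>i. i \<in> I \<Longrightarrow> 0 \<le> w i" "0 < sum w I" "(\<Sum>i\<in>I. w i * v i) \<le> c * sum w I"
  shows "\<exists>i\<in>I. 0 < w i \<and> v i \<le> c"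
proof (rule ccontr)
  assume neg: "\<not> ?thesis"
  obtain j where j: "j \<in> I" "w j \<noteq> 0" using assms(3) by (metis less_irrefl sum.neutral)
  have "(\<Sum>i\<in>I. w i * c) < (\<Sum>i\<in>I. w i * v i)"
  proof (rule sum_strict_mono_ex1[OF assms(1)])
    show "\<forall>i\<in>I. w i * c \<le> w i * v i"
    proof
      fix i assume i: "i \<in> I"
      show "w i * c \<le> w i * v i"
        using neg i assms(2)[OF i] by (cases "w i = 0") (auto intro!: mult_left_mono)
    qed
    show "\<exists>i\<in>I. w i * c < w i * v i"
      using neg j assms(2)[OF j(1)] by (intro bexI[of _ j]) (auto intro!: mult_strict_left_mono)
  qed
  moreover have "(\<Sum>i\<in>I. w i * c) = c * sum w I" by (simp add: sum_distrib_left mult.commute)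
  ultimately show False using assms(4) by linarith
qed

section \<open>Concentration of one label above its pivotal set\<close>

context approx_pair
begin

definition D1 :: real where "D1 = (3 + 16 / \<zeta>\<^sup>2) * D0"

lemma D1_nonneg: "0 \<le> D1"
  using zeta by (auto simp: D0_def D1_def intro!: mult_nonneg_nonneg add_nonneg_nonneg)

text \<open>Sets that are not typical are discarded by Markov's inequality at level
  \<sigma>^3.\<close>

lemma expected_bad_le:
  assumes A: "finite A" and q: "0 \<le> q" "q \<le> 1"
  shows "bexp q A (\<lambda>Y. bexp \<tau> Y (\<lambda>W. of_bool (bad Y W))) \<le> D1 * \<sigma>\<^sup>2 + bexp (q * (\<tau> * \<tau>)) A k / \<sigma> ^ 3"
proof -
  have s3: "0 < \<sigma> ^ 3" using sigma by simp
  have "bexp q A (\<lambda>Y. bexp \<tau> Y (\<lambda>W. of_bool (bad Y W))) \<le> bexp q A (\<lambda>Y. D1 * \<sigma>\<^sup>2 + 1 / \<sigma> ^ 3 * bexp (\<tau> * \<tau>) Y k)"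
  proof (rule bexp_mono[OF q])
    fix Y assume "Y \<subseteq> A"
    then have Y: "finite Y" using A finite_subset by blast
    have k0: "0 \<le> bexp (\<tau> * \<tau>) Y k" using tau k_nonneg by (intro bexp_nonneg) auto
    show "bexp \<tau> Y (\<lambda>W. of_bool (bad Y W)) \<le> D1 * \<sigma>\<^sup>2 + 1 / \<sigma> ^ 3 * bexp (\<tau> * \<tau>) Y k"
    proof (cases "typical Y")
      case True
      then show ?thesis using bad_le[OF True] k0 s3 by (simp add: D1_def mult.assoc add_increasing2)
    next
      case False
      then have "\<sigma> ^ 3 < bexp (\<tau> * \<tau>) Y k" using Y by (simp add: typical_def)
      then have "1 \<le> 1 / \<sigma> ^ 3 * bexp (\<tau> * \<tau>) Y k" using s3 by (simp add: field_simps)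
      moreover have "bexp \<tau> Y (\<lambda>W. of_bool (bad Y W)) \<le> 1" using Y tau by (intro bexp_le_const) auto
      moreover have "0 \<le> D1 * \<sigma>\<^sup>2" using D1_nonneg by simp
      ultimately show ?thesis by linarith
    qed
  qed
  also have "\<dots> = D1 * \<sigma>\<^sup>2 + bexp (q * (\<tau> * \<tau>)) A k / \<sigma> ^ 3"
    using A by (simp only: bexp_add bexp_cmult bexp_comp bexp_const) simp
  finally show ?thesis .
qed

definition label1 :: "'a set \<Rightarrow> 'a set \<Rightarrow> real" where
  "label1 T W = of_bool (lam / 2 \<le> M1 W \<and> T1 W = T)"
definition label2 :: "'a set \<Rightarrow> 'a set \<Rightarrow> real" where
  "label2 T Y = of_bool (lam / 2 \<le> M2 Y \<and> T2 Y = T)"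

lemma label1_simps: "0 \<le> label1 T W" "label1 T W \<le> 1" "(label1 T W)\<^sup>2 = label1 T W"
  by (auto simp: label1_def)

lemma sum_label_le:
  assumes "finite A"
  shows "(\<Sum>T\<in>Pow A. label1 T W) \<le> 1" "(\<Sum>T\<in>Pow A. label2 T Y) \<le> 1"
proof -
  have *: "(\<Sum>T\<in>Pow A. of_bool (P \<and> L = T)) \<le> (1 :: real)" for P :: bool and L :: "'a set"
  proof -
    have "(\<Sum>T\<in>Pow A. of_bool (P \<and> L = T)) \<le> (\<Sum>T\<in>Pow A. if T = L then 1 else (0 :: real))"
      by (intro sum_mono) auto
    also have "\<dots> \<le> 1" using assms by simp
    finally show ?thesis .
  qed
  show "(\<Sum>T\<in>Pow A. label1 T W) \<le> 1" "(\<Sum>T\<in>Pow A. label2 T Y) \<le> 1"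
    unfolding label1_def label2_def by (rule *)+
qed

text \<open>Deleting a pivotal point has probability of order \<sigma> and cannot count as an error,
  so labels are compared only where T \<subseteq> W. There a mismatch makes the pair bad. Each of Y
  and W carries at most one label, hence the factor 2.\<close>

lemma label_mismatch_le:
  assumes A: "finite A" and W: "W \<subseteq> Y"
  shows "(\<Sum>T\<in>Pow A. of_bool (T \<subseteq> W) * (label2 T Y - label1 T W)\<^sup>2) \<le> 2 * of_bool (bad Y W)"
proof (cases "bad Y W")
  case True
  have "(\<Sum>T\<in>Pow A. of_bool (T \<subseteq> W) * (label2 T Y - label1 T W)\<^sup>2) \<le> (\<Sum>T\<in>Pow A. label2 T Y + label1 T W)"
    by (intro sum_mono) (auto simp: label1_def label2_def)
  also have "\<dots> \<le> 2" unfolding sum.distrib using sum_label_le(1)[OF A, of W] sum_label_le(2)[OF A, of Y] by simp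
  finally show ?thesis using True by simp
next
  case False
  then have "of_bool (T \<subseteq> W) * (label2 T Y - label1 T W)\<^sup>2 = 0" for T
    by (auto simp: bad_def label1_def label2_def not_le)
  then show ?thesis by (simp only: sum.neutral_const) simp
qed

text \<open>On the cube above T the label is a 0-1 function of variance \<alpha> (1 - \<alpha>). The
  gap \<sigma> is applied for each T separately, and the mismatches are then summed inside the
  expectation.\<close>

lemma sum_variance_le:
  assumes A: "finite A" and q: "0 \<le> q" "q \<le> 1"
  defines "\<alpha> \<equiv> \<lambda>T. bexp (q * \<tau>) (A - T) (\<lambda>W. label1 T (T \<union> W))"
  shows "\<sigma> * (\<Sum>T\<in>Pow A. (q * \<tau>) ^ card T * \<alpha> T * (1 - \<alpha> T))
     \<le> 2 * bexp q A (\<lambda>Y. bexp \<tau> Y (\<lambda>W. of_bool (bad Y W)))"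
proof -
  have t: "0 \<le> \<tau>" "\<tau> \<le> 1" using tau by auto
  have qt: "0 \<le> q * \<tau>" using q t by simp
  have "\<sigma> * (\<Sum>T\<in>Pow A. (q * \<tau>) ^ card T * \<alpha> T * (1 - \<alpha> T))
      = (\<Sum>T\<in>Pow A. (q * \<tau>) ^ card T * (\<sigma> * (\<alpha> T - (\<alpha> T)\<^sup>2)))"
    unfolding sum_distrib_left by (intro sum.cong refl) (simp add: power2_eq_square algebra_simps)
  also have "\<dots> \<le> (\<Sum>T\<in>Pow A. bexp q A (\<lambda>Y. bexp \<tau> Y (\<lambda>W. of_bool (T \<subseteq> W) * (label2 T Y - label1 T W)\<^sup>2)))"
  proof (intro sum_mono)
    fix T assume T: "T \<in> Pow A"
    have "\<sigma> * (\<alpha> T - (\<alpha> T)\<^sup>2) = (1 - \<tau>) * (bexp (q * \<tau>) (A - T) (\<lambda>W. (label1 T (T \<union> W))\<^sup>2)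
        - (bexp (q * \<tau>) (A - T) (\<lambda>W. label1 T (T \<union> W)))\<^sup>2)"
      unfolding \<alpha>_def label1_simps by (simp add: \<tau>_def)
    also have "\<dots> \<le> bexp q (A - T) (\<lambda>Y. bexp \<tau> Y (\<lambda>W. (label2 T (T \<union> Y) - label1 T (T \<union> W))\<^sup>2))"
      using A by (intro noise_gap q t) auto
    finally have "(q * \<tau>) ^ card T * (\<sigma> * (\<alpha> T - (\<alpha> T)\<^sup>2)) \<le> (q * \<tau>) ^ card T *
       bexp q (A - T) (\<lambda>Y. bexp \<tau> Y (\<lambda>W. (label2 T (T \<union> Y) - label1 T (T \<union> W))\<^sup>2))"
      using qt by (intro mult_left_mono) auto
    also have "\<dots> = bexp q A (\<lambda>Y. bexp \<tau> Y (\<lambda>W. of_bool (T \<subseteq> W) * (label2 T Y - label1 T W)\<^sup>2))"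
      using bexp_restrict_pair[OF A, of T q \<tau> "\<lambda>Y W. (label2 T Y - label1 T W)\<^sup>2"] T by simp
    finally show "(q * \<tau>) ^ card T * (\<sigma> * (\<alpha> T - (\<alpha> T)\<^sup>2))
      \<le> bexp q A (\<lambda>Y. bexp \<tau> Y (\<lambda>W. of_bool (T \<subseteq> W) * (label2 T Y - label1 T W)\<^sup>2))" .
  qed
  also have "\<dots> = bexp q A (\<lambda>Y. bexp \<tau> Y (\<lambda>W. \<Sum>T\<in>Pow A. of_bool (T \<subseteq> W) * (label2 T Y - label1 T W)\<^sup>2))"
    unfolding bexp_sum ..
  also have "\<dots> \<le> bexp q A (\<lambda>Y. bexp \<tau> Y (\<lambda>W. 2 * of_bool (bad Y W)))"
    by (intro bexp_mono q t label_mismatch_le A)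
  finally show ?thesis unfolding bexp_cmult .
qed

lemma M1_low: "finite W \<Longrightarrow> M1 W < lam / 2 \<Longrightarrow> M1 W \<le> 2 * (\<sigma> + bexp \<tau> W k) / \<zeta>"
proof -
  assume W: "finite W" "M1 W < lam / 2"
  have "M1 W * (\<zeta> / 2) \<le> M1 W * (lam - M1 W)" using W M1_range[OF W(1)] lam by (intro mult_left_mono) auto
  then have "M1 W * (\<zeta> / 2) \<le> \<sigma> + bexp \<tau> W k" using M1_near[OF W(1)] by linarith
  then show ?thesis using zeta by (simp add: field_simps)
qed

lemma M1_high: "finite W \<Longrightarrow> lam / 2 \<le> M1 W \<Longrightarrow> lam - 2 * (\<sigma> + bexp \<tau> W k) / \<zeta> \<le> M1 W"
proof -
  assume W: "finite W" "lam / 2 \<le> M1 W"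
  have k0: "0 \<le> bexp \<tau> W k" using tau k_nonneg by (intro bexp_nonneg) auto
  show ?thesis
  proof (cases "lam \<le> M1 W")
    case True
    have "0 \<le> 2 * (\<sigma> + bexp \<tau> W k) / \<zeta>" using k0 sigma zeta by simp
    then show ?thesis using True by linarith
  next
    case False
    then have "(\<zeta> / 2) * (lam - M1 W) \<le> M1 W * (lam - M1 W)" using W lam by (intro mult_right_mono) auto
    then have "(\<zeta> / 2) * (lam - M1 W) \<le> \<sigma> + bexp \<tau> W k" using M1_near[OF W(1)] by linarith
    then have "lam - M1 W \<le> 2 * (\<sigma> + bexp \<tau> W k) / \<zeta>" using zeta by (simp add: field_simps)
    then show ?thesis by linarith
  qed
qed

text \<open>The mean of \<open>M1\<close> is that of the noisy f, hence at least \<zeta> times the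
  mean of g up to the mean of \<open>k\<close>. Where \<open>M1\<close> is not high it is nearly 0,
  so this mass must come from high sets.\<close>

lemma prob_high_ge:
  assumes A: "finite A" and p1: "0 \<le> p1" "p1 \<le> 1"
  shows "\<zeta> * bexp (p1 * \<tau>) A g - bexp (p1 * \<tau>) A k - 2 * (\<sigma> + bexp (p1 * \<tau>) A k) / \<zeta>
    \<le> bexp p1 A (\<lambda>W. of_bool (lam / 2 \<le> M1 W))"
proof -
  have pt: "0 \<le> p1 * \<tau>" "p1 * \<tau> \<le> 1" using p1 tau by (auto simp: mult_le_one)
  have "bexp p1 A M1 \<le> bexp p1 A (\<lambda>W. of_bool (lam / 2 \<le> M1 W) + 2 / \<zeta> * (\<sigma> + bexp \<tau> W k))"
  proof (rule bexp_mono[OF p1])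
    fix W assume "W \<subseteq> A"
    then have W: "finite W" using A finite_subset by blast
    have "0 \<le> bexp \<tau> W k" using tau k_nonneg by (intro bexp_nonneg) auto
    then have "0 \<le> 2 / \<zeta> * (\<sigma> + bexp \<tau> W k)" using zeta sigma by simp
    then show "M1 W \<le> of_bool (lam / 2 \<le> M1 W) + 2 / \<zeta> * (\<sigma> + bexp \<tau> W k)"
      using M1_low[OF W] M1_range[OF W] by (cases "lam / 2 \<le> M1 W") auto
  qed
  also have "\<dots> = bexp p1 A (\<lambda>W. of_bool (lam / 2 \<le> M1 W)) + 2 * (\<sigma> + bexp (p1 * \<tau>) A k) / \<zeta>"
    using A by (simp only: bexp_add bexp_cmult bexp_comp bexp_const) simp
  also have "bexp p1 A M1 = bexp (p1 * \<tau>) A (\<lambda>X. bexp \<rho> X f)"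
    unfolding M1_def[abs_def] using A by (simp add: bexp_comp mult.assoc)
  finally have 1: "bexp (p1 * \<tau>) A (\<lambda>X. bexp \<rho> X f) \<le> bexp p1 A (\<lambda>W. of_bool (lam / 2 \<le> M1 W)) + 2 * (\<sigma> + bexp (p1 * \<tau>) A k) / \<zeta>" .
  have "bexp (p1 * \<tau>) A (\<lambda>X. \<zeta> * g X - k X) \<le> bexp (p1 * \<tau>) A (\<lambda>X. bexp \<rho> X f)"
  proof (rule bexp_mono[OF pt])
    fix X
    have "\<zeta> * g X \<le> lam * g X" using lam g[of X] by auto
    then show "\<zeta> * g X - k X \<le> bexp \<rho> X f" unfolding k_def by linarith
  qed
  then show ?thesis using 1 unfolding bexp_diff bexp_cmult by linarith
qed

text \<open>A set labelled T has \<open>M1\<close> near lam. Among its random subsets, those that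
  lose an element of T have probability at most card T * \<sigma> by Bernoulli's inequality; on the
  others, all above T, the noisy f is lam g up to \<open>k\<close>.\<close>

lemma transfer_to_g:
  assumes A: "finite A" "T \<subseteq> A" and p1: "0 \<le> p1" "p1 \<le> 1"
  defines "\<alpha> \<equiv> bexp p1 (A - T) (\<lambda>W. label1 T (T \<union> W))"
  shows "lam * \<alpha> - 2 / \<zeta> * (\<sigma> + bexp p1 (A - T) (\<lambda>W. bexp \<tau> (T \<union> W) k)) - real (card T) * \<sigma>
     - bexp (p1 * \<tau>) (A - T) (\<lambda>X. k (T \<union> X)) \<le> lam * bexp (p1 * \<tau>) (A - T) (\<lambda>X. g (T \<union> X))"
proof -
  have t: "0 \<le> \<tau>" "\<tau> \<le> 1" using tau by auto
  have pt: "0 \<le> p1 * \<tau>" "p1 * \<tau> \<le> 1" using p1 tau by (auto simp: mult_le_one)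
  have finT: "finite T" "finite (A - T)" using A finite_subset by auto
  have finTW: "finite (T \<union> W)" if "W \<subseteq> A - T" for W using that A finite_subset[of "T \<union> W" A] by auto
  define h where "h = (\<lambda>X. bexp \<rho> X f)"
  have h: "h X \<le> 1" "0 \<le> h X" if "finite X" for X
    using that rates f by (auto simp: h_def intro!: bexp_le_const bexp_nonneg)
  have "bexp p1 (A - T) (\<lambda>W. lam * label1 T (T \<union> W) - 2 / \<zeta> * (\<sigma> + bexp \<tau> (T \<union> W) k)) \<le> bexp p1 (A - T) (\<lambda>W. M1 (T \<union> W))"
  proof (rule bexp_mono[OF p1])
    fix W assume W: "W \<subseteq> A - T"
    have "0 \<le> bexp \<tau> (T \<union> W) k" using tau k_nonneg by (intro bexp_nonneg) auto
    then have "0 \<le> 2 / \<zeta> * (\<sigma> + bexp \<tau> (T \<union> W) k)" using zeta sigma by simp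
    then show "lam * label1 T (T \<union> W) - 2 / \<zeta> * (\<sigma> + bexp \<tau> (T \<union> W) k) \<le> M1 (T \<union> W)"
      using M1_high[OF finTW[OF W]] M1_range[OF finTW[OF W]]
      by (cases "lam / 2 \<le> M1 (T \<union> W) \<and> T1 (T \<union> W) = T") (auto simp: label1_def)
  qed
  then have 1: "lam * \<alpha> - 2 / \<zeta> * (\<sigma> + bexp p1 (A - T) (\<lambda>W. bexp \<tau> (T \<union> W) k)) \<le> bexp p1 (A - T) (\<lambda>W. M1 (T \<union> W))"
    using finT unfolding bexp_diff bexp_cmult bexp_add \<alpha>_def by simp
  have bern: "1 - real (card T) * \<sigma> \<le> \<tau> ^ card T"
    using Bernoulli_inequality[of "- \<sigma>" "card T"] sigma_small by (simp add: \<tau>_def)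
  have M1h: "M1 (T \<union> W) \<le> bexp \<tau> W (\<lambda>X. h (T \<union> X)) + real (card T) * \<sigma>" if W: "W \<subseteq> A - T" for W
  proof -
    have finW: "finite W" "T \<inter> W = {}" using W A finite_subset[of W A] by auto
    have "M1 (T \<union> W) = bexp \<tau> (T \<union> W) h"
      unfolding M1_def h_def using bexp_comp[OF finTW[OF W]] by simp
    also have "\<dots> \<le> bexp \<tau> (T \<union> W) (\<lambda>X. of_bool (T \<subseteq> X) * h X + (1 - of_bool (T \<subseteq> X) * 1))"
    proof (rule bexp_mono[OF t])
      fix X assume "X \<subseteq> T \<union> W"
      then have "finite X" using finTW[OF W] finite_subset by blast
      then show "h X \<le> of_bool (T \<subseteq> X) * h X + (1 - of_bool (T \<subseteq> X) * 1)" using h by auto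
    qed
    also have "\<dots> = \<tau> ^ card T * bexp \<tau> W (\<lambda>X. h (T \<union> X)) + (1 - \<tau> ^ card T)"
    proof -
      have TW: "T \<union> W - T = W" using finW by auto
      show ?thesis
        using bexp_restrict[OF finTW[OF W], of T \<tau> h] bexp_restrict[OF finTW[OF W], of T \<tau> "\<lambda>_. 1"] finTW[OF W] finW
        unfolding bexp_add bexp_diff TW by simp
    qed
    also have "\<dots> \<le> 1 * bexp \<tau> W (\<lambda>X. h (T \<union> X)) + real (card T) * \<sigma>"
    proof (intro add_mono mult_right_mono)
      show "0 \<le> bexp \<tau> W (\<lambda>X. h (T \<union> X))"
        using finW finT by (intro bexp_nonneg t h) (auto intro: finite_subset)
    qed (use bern t in \<open>auto simp: power_le_one\<close>)
    finally show ?thesis by simp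
  qed
  have "bexp p1 (A - T) (\<lambda>W. M1 (T \<union> W)) \<le> bexp p1 (A - T) (\<lambda>W. bexp \<tau> W (\<lambda>X. h (T \<union> X)) + real (card T) * \<sigma>)"
    by (intro bexp_mono p1 M1h)
  also have "\<dots> = bexp (p1 * \<tau>) (A - T) (\<lambda>X. h (T \<union> X)) + real (card T) * \<sigma>"
    using finT by (simp add: bexp_add bexp_comp)
  also have "bexp (p1 * \<tau>) (A - T) (\<lambda>X. h (T \<union> X)) \<le> bexp (p1 * \<tau>) (A - T) (\<lambda>X. lam * g (T \<union> X) + k (T \<union> X))"
    by (intro bexp_mono pt) (auto simp: h_def k_def)
  finally show ?thesis using 1 unfolding bexp_add bexp_cmult by linarith
qed

text \<open>The labels have total probability at least of order \<zeta> \<epsilon>, so some T has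
  deficiency of order e / (\<sigma> \<zeta> \<epsilon>), where e is the probability of a bad pair.
  With e of order \<sigma>^2 this is of order \<sigma>.\<close>

lemma certificate_bound:
  assumes A: "finite A" and p: "\<zeta> \<le> p" "p \<le> 1 - \<zeta>" and k: "bexp p A k \<le> \<eta>" and N: "16 / \<zeta>\<^sup>2 \<le> real N"
    and eps: "0 < \<epsilon>" "\<epsilon> \<le> bexp p A g" "2 * (\<sigma> + \<eta>) / \<zeta> + \<eta> + \<zeta> * \<epsilon> / 2 \<le> \<zeta> * \<epsilon>"
  shows "\<exists>T\<subseteq>A. card T \<le> N \<and> 1 - bexp p (A - T) (\<lambda>X. g (T \<union> X)) \<le>
     4 * (D1 * \<sigma>\<^sup>2 + \<eta> / \<sigma> ^ 3) / (\<sigma> * \<zeta> * \<epsilon>) + (2 / \<zeta> * (\<sigma> + \<eta> / \<zeta> ^ N) + real N * \<sigma> + \<eta> / \<zeta> ^ N) / \<zeta>"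
proof -
  \<comment> \<open>The biases of the three levels Y, W, X are q, \<open>p1\<close> and p, chosen so
    that two deletions end at the given p. The bound q \<le> 1 uses p \<le> 1 - \<zeta> and the
    smallness of \<sigma>.\<close>
  define p1 where "p1 = p / \<tau>"
  define q where "q = p1 / \<tau>"
  have p1t: "p1 * \<tau> = p" and qt: "q * \<tau> = p1" using tau by (auto simp: p1_def q_def)
  have qtt: "q * (\<tau> * \<tau>) = p" using p1t qt by (simp add: mult.assoc[symmetric])
  have "p \<le> \<tau> * \<tau>" using p tau sigma_small zeta by linarith
  then have q: "0 \<le> q" "q \<le> 1" using p zeta tau by (auto simp: q_def p1_def field_simps)
  have "p \<le> p1" using p zeta tau by (simp add: p1_def field_simps)
  then have p1: "0 \<le> p1" "p1 \<le> 1" "\<zeta> \<le> p1" using q qt tau p zeta by (auto simp: mult_le_one)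
  have p01: "0 \<le> p" "p \<le> 1" using p zeta by auto
  define e where "e = bexp q A (\<lambda>Y. bexp \<tau> Y (\<lambda>W. of_bool (bad Y W)))"
  define \<alpha> where "\<alpha> = (\<lambda>T. bexp p1 (A - T) (\<lambda>W. label1 T (T \<union> W)))"
  define Pg where "Pg = bexp p1 A (\<lambda>W. of_bool (lam / 2 \<le> M1 W))"
  have k0: "0 \<le> bexp p A k" using p01 k_nonneg by (intro bexp_nonneg) auto
  have e: "e \<le> D1 * \<sigma>\<^sup>2 + \<eta> / \<sigma> ^ 3"
    using expected_bad_le[OF A q] k sigma divide_right_mono[OF k, of "\<sigma> ^ 3"] unfolding qtt e_def by simp
  have Pg: "\<zeta> * \<epsilon> / 2 \<le> Pg"
  proof -
    have "\<zeta> * \<epsilon> \<le> \<zeta> * bexp p A g" using eps zeta by (intro mult_left_mono) auto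
    moreover have "2 * (\<sigma> + bexp p A k) / \<zeta> \<le> 2 * (\<sigma> + \<eta>) / \<zeta>" using k zeta by (intro divide_right_mono) auto
    ultimately show ?thesis using prob_high_ge[OF A p1(1,2)] k eps(3) unfolding p1t Pg_def by linarith
  qed
  then have Pg0: "0 < Pg" using eps zeta by (meson half_gt_zero less_le_trans mult_pos_pos)
  have e0: "0 \<le> e" unfolding e_def using q tau by (intro bexp_nonneg) auto
  have sum: "(\<Sum>T\<in>Pow A. p1 ^ card T * \<alpha> T) = Pg"
  proof -
    have "(\<Sum>T\<in>Pow A. p1 ^ card T * \<alpha> T) = (\<Sum>T\<in>Pow A. bexp p1 A (label1 T))"
    proof (intro sum.cong refl)
      fix T assume T: "T \<in> Pow A"
      have "p1 ^ card T * \<alpha> T = bexp p1 A (\<lambda>W. of_bool (T \<subseteq> W) * label1 T W)"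
        unfolding \<alpha>_def using T bexp_restrict[OF A, of T p1 "label1 T"] by simp
      also have "\<dots> = bexp p1 A (label1 T)"
        by (intro bexp_cong) (auto simp: label1_def T1_def)
      finally show "p1 ^ card T * \<alpha> T = bexp p1 A (label1 T)" .
    qed
    also have "\<dots> = bexp p1 A (\<lambda>W. \<Sum>T\<in>Pow A. label1 T W)" unfolding bexp_sum ..
    also have "\<dots> = Pg" unfolding Pg_def
    proof (rule bexp_cong)
      fix W assume W: "W \<subseteq> A"
      have "(\<Sum>T\<in>Pow A. label1 T W) = (\<Sum>T\<in>Pow A. if T = T1 W then of_bool (lam / 2 \<le> M1 W) else 0)"
        by (intro sum.cong) (auto simp: label1_def)
      also have "\<dots> = of_bool (lam / 2 \<le> M1 W)" using A W by (auto simp: T1_def)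
      finally show "(\<Sum>T\<in>Pow A. label1 T W) = of_bool (lam / 2 \<le> M1 W)" .
    qed
    finally show ?thesis .
  qed
  \<comment> \<open>The weights are the probabilities of the labels and sum to \<open>Pg\<close>;
    the averaged quantity is bounded by \<open>sum_variance_le\<close>.\<close>
  have "\<exists>T\<in>Pow A. 0 < p1 ^ card T * \<alpha> T \<and> 1 - \<alpha> T \<le> 2 * e / (\<sigma> * Pg)"
  proof (rule ex_le_weighted_average)
    show "0 \<le> p1 ^ card T * \<alpha> T" for T
      unfolding \<alpha>_def using p1 label1_simps by (intro mult_nonneg_nonneg bexp_nonneg) auto
    have "\<sigma> * (\<Sum>T\<in>Pow A. p1 ^ card T * \<alpha> T * (1 - \<alpha> T)) \<le> 2 * e"
      using sum_variance_le[OF A q] unfolding e_def \<alpha>_def qt .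
    then have "(\<Sum>T\<in>Pow A. p1 ^ card T * \<alpha> T * (1 - \<alpha> T)) \<le> 2 * e / \<sigma>"
      using sigma by (simp add: field_simps)
    also have "\<dots> = 2 * e / (\<sigma> * Pg) * Pg" using Pg0 by simp
    finally show "(\<Sum>T\<in>Pow A. p1 ^ card T * \<alpha> T * (1 - \<alpha> T)) \<le> 2 * e / (\<sigma> * Pg) * (\<Sum>T\<in>Pow A. p1 ^ card T * \<alpha> T)"
      unfolding sum .
  qed (use A sum Pg0 in auto)
  then obtain T where T: "T \<subseteq> A" "0 < p1 ^ card T * \<alpha> T" "1 - \<alpha> T \<le> 2 * e / (\<sigma> * Pg)" by auto
  have "2 * e / (\<sigma> * Pg) \<le> 2 * (D1 * \<sigma>\<^sup>2 + \<eta> / \<sigma> ^ 3) / (\<sigma> * (\<zeta> * \<epsilon> / 2))"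
    using e e0 Pg Pg0 sigma zeta eps by (intro frac_le mult_left_mono mult_pos_pos) auto
  also have "\<dots> = 4 * (D1 * \<sigma>\<^sup>2 + \<eta> / \<sigma> ^ 3) / (\<sigma> * \<zeta> * \<epsilon>)" by (simp add: mult.assoc)
  finally have a: "1 - \<alpha> T \<le> 4 * (D1 * \<sigma>\<^sup>2 + \<eta> / \<sigma> ^ 3) / (\<sigma> * \<zeta> * \<epsilon>)" using T(3) by linarith
  \<comment> \<open>A label of positive probability is the pivotal set of some actual high set,
    which bounds its size.\<close>
  have "\<exists>W\<subseteq>A - T. label1 T (T \<union> W) \<noteq> 0"
  proof (rule ccontr)
    assume "\<not> ?thesis"
    then have "\<alpha> T = bexp p1 (A - T) (\<lambda>_. 0)" unfolding \<alpha>_def by (intro bexp_cong) auto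
    then show False using T(2) A by simp
  qed
  then obtain W where W: "W \<subseteq> A - T" "lam / 2 \<le> M1 (T \<union> W)" "T1 (T \<union> W) = T" by (auto simp: label1_def)
  have "finite (T \<union> W)" using W T A finite_subset[of "T \<union> W" A] by auto
  from card_T1_le[OF this W(2)] N have card: "card T \<le> N" unfolding W(3) by linarith
  have zN: "\<zeta> ^ N \<le> \<zeta> ^ card T" using card zeta by (intro power_decreasing) auto
  have aux: "x \<le> \<eta> / \<zeta> ^ N" if "r ^ card T * x \<le> \<eta>" "\<zeta> \<le> r" "0 \<le> x" for x r
  proof -
    have "\<zeta> ^ card T \<le> r ^ card T" using that zeta by (intro power_mono) auto
    then have "\<zeta> ^ N * x \<le> r ^ card T * x" using that zN by (intro mult_right_mono) auto
    then show ?thesis using that zeta by (simp add: field_simps)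
  qed
  have k1: "bexp p1 (A - T) (\<lambda>W. bexp \<tau> (T \<union> W) k) \<le> \<eta> / \<zeta> ^ N"
  proof (rule aux)
    have "p1 ^ card T * bexp p1 (A - T) (\<lambda>W. bexp \<tau> (T \<union> W) k) \<le> bexp p1 A (\<lambda>W. bexp \<tau> W k)"
      using A T p1 tau k_nonneg by (intro bexp_restrict_le bexp_nonneg) auto
    then show "p1 ^ card T * bexp p1 (A - T) (\<lambda>W. bexp \<tau> (T \<union> W) k) \<le> \<eta>"
      using k p1t A by (simp add: bexp_comp)
  qed (use p1 tau k_nonneg in \<open>auto intro!: bexp_nonneg\<close>)
  have k2: "bexp p (A - T) (\<lambda>X. k (T \<union> X)) \<le> \<eta> / \<zeta> ^ N"
  proof (rule aux)
    have "p ^ card T * bexp p (A - T) (\<lambda>X. k (T \<union> X)) \<le> bexp p A k"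
      using A T p01 k_nonneg by (intro bexp_restrict_le) auto
    then show "p ^ card T * bexp p (A - T) (\<lambda>X. k (T \<union> X)) \<le> \<eta>" using k by linarith
  qed (use p p01 k_nonneg in \<open>auto intro!: bexp_nonneg\<close>)
  define G where "G = bexp p (A - T) (\<lambda>X. g (T \<union> X))"
  define X where "X = 2 / \<zeta> * (\<sigma> + \<eta> / \<zeta> ^ N) + real N * \<sigma> + \<eta> / \<zeta> ^ N"
  have "lam * \<alpha> T - X \<le> lam * G"
  proof -
    have "2 / \<zeta> * (\<sigma> + bexp p1 (A - T) (\<lambda>W. bexp \<tau> (T \<union> W) k)) \<le> 2 / \<zeta> * (\<sigma> + \<eta> / \<zeta> ^ N)"
      using k1 zeta by (intro mult_left_mono) auto
    moreover have "real (card T) * \<sigma> \<le> real N * \<sigma>" using card sigma by (intro mult_right_mono) auto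
    ultimately show ?thesis
      using transfer_to_g[OF A T(1) p1(1,2)] k2 unfolding p1t X_def G_def \<alpha>_def by linarith
  qed
  moreover have "0 \<le> X"
  proof -
    have "0 \<le> \<eta> / \<zeta> ^ N" using k k0 zeta by simp
    then show ?thesis unfolding X_def using sigma zeta by (intro add_nonneg_nonneg mult_nonneg_nonneg) auto
  qed
  ultimately have "lam * (\<alpha> T - G) \<le> X" "0 \<le> X" by (auto simp: algebra_simps)
  then have "\<alpha> T - G \<le> X / \<zeta>"
  proof (cases "0 \<le> \<alpha> T - G")
    case True
    then have "\<zeta> * (\<alpha> T - G) \<le> lam * (\<alpha> T - G)" using lam by (intro mult_right_mono) auto
    then have "\<zeta> * (\<alpha> T - G) \<le> X" using \<open>lam * (\<alpha> T - G) \<le> X\<close> by linarith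
    then show ?thesis using zeta by (simp add: field_simps)
  next
    case False
    moreover have "0 \<le> X / \<zeta>" using \<open>0 \<le> X\<close> zeta by simp
    ultimately show ?thesis by linarith
  qed
  then have "1 - G \<le> 4 * (D1 * \<sigma>\<^sup>2 + \<eta> / \<sigma> ^ 3) / (\<sigma> * \<zeta> * \<epsilon>) + X / \<zeta>" using a by linarith
  then show ?thesis using T(1) card unfolding G_def X_def by blast
qed

end

lemma ex_small_multiple:
  fixes d :: real
  assumes "0 < d"
  shows "\<exists>y>0. \<forall>x. 0 < x \<longrightarrow> x \<le> y \<longrightarrow> K * x \<le> d"
proof (intro exI[of _ "d / (\<bar>K\<bar> + 1)"] conjI allI impI)
  show "0 < d / (\<bar>K\<bar> + 1)" using assms by simp
  fix x assume x: "0 < x" "x \<le> d / (\<bar>K\<bar> + 1)"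
  have "K * x \<le> (\<bar>K\<bar> + 1) * x" using x by (intro mult_right_mono) auto
  also have "\<dots> \<le> d" using x by (simp add: field_simps)
  finally show "K * x \<le> d" .
qed

lemma ex_small_multiples:
  fixes d1 d2 d3 d4 :: real
  assumes "0 < d1" "0 < d2" "0 < d3" "0 < d4"
  shows "\<exists>x>0. K1 * x \<le> d1 \<and> K2 * x \<le> d2 \<and> K3 * x \<le> d3 \<and> K4 * x \<le> d4"
proof -
  obtain y1 where 1: "0 < y1" "\<forall>x. 0 < x \<longrightarrow> x \<le> y1 \<longrightarrow> K1 * x \<le> d1"
    using ex_small_multiple[OF assms(1)] by blast
  obtain y2 where 2: "0 < y2" "\<forall>x. 0 < x \<longrightarrow> x \<le> y2 \<longrightarrow> K2 * x \<le> d2"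
    using ex_small_multiple[OF assms(2)] by blast
  obtain y3 where 3: "0 < y3" "\<forall>x. 0 < x \<longrightarrow> x \<le> y3 \<longrightarrow> K3 * x \<le> d3"
    using ex_small_multiple[OF assms(3)] by blast
  obtain y4 where 4: "0 < y4" "\<forall>x. 0 < x \<longrightarrow> x \<le> y4 \<longrightarrow> K4 * x \<le> d4"
    using ex_small_multiple[OF assms(4)] by blast
  from 1 2 3 4 show ?thesis by (intro exI[of _ "min (min y1 y2) (min y3 y4)"]) auto
qed

section \<open>Choice of the parameters and intersection of certificates\<close>

text \<open>The ground set is arbitrary because the argument is restarted on A - {i}: restricting to
  x_i = 0 changes A but not f and g.\<close>

definition approx_solution ::
    "real \<Rightarrow> real \<Rightarrow> 'a set \<Rightarrow> real \<Rightarrow> real \<Rightarrow> real \<Rightarrow> ('a set \<Rightarrow> real) \<Rightarrow> ('a set \<Rightarrow> real) \<Rightarrow> bool" where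
  "approx_solution \<zeta> \<eta> A p \<rho> lam f g \<longleftrightarrow>
     finite A \<and> p \<in> {\<zeta>..1 - \<zeta>} \<and> \<rho> \<in> {\<zeta>..1 / 2 - \<zeta>} \<and> lam \<in> {\<zeta>..1} \<and>
     (\<forall>S. 0 \<le> f S \<and> f S \<le> 1) \<and> (\<forall>S. g S \<in> {0, 1}) \<and>
     bexp p A (\<lambda>X. \<bar>bexp \<rho> X f - lam * g X\<bar>) \<le> \<eta>"

lemma certificate_exists:
  assumes zeta: "0 < \<zeta>" "\<zeta> \<le> 1 / 4" and eps: "0 < \<epsilon>" and del: "0 < \<delta>" and N: "16 / \<zeta>\<^sup>2 \<le> real N"
  shows "\<exists>\<eta>>0. \<forall>(A :: 'a set) p \<rho> lam f g.
    approx_solution \<zeta> \<eta> A p \<rho> lam f g \<longrightarrow> \<epsilon> \<le> bexp p A g \<longrightarrow>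
    (\<exists>T\<subseteq>A. card T \<le> N \<and> 1 - \<delta> \<le> bexp p (A - T) (\<lambda>X. g (T \<union> X)))"
proof -
  \<comment> \<open>This constant depends on \<zeta> only, so it is available before f and g are
    given.\<close>
  define D where "D = approx_pair.D1 \<zeta>"
  \<comment> \<open>The deficiency in \<open>certificate_bound\<close> has two terms linear in
    \<sigma> and, with \<sigma> fixed, two linear in \<eta>; each is made at most \<delta> / 4. The
    factor 1 / \<sigma>^4 forces \<eta> to come last.\<close>
  obtain \<sigma> where s: "0 < \<sigma>" "1 * \<sigma> \<le> \<zeta> ^ 3 / 2000" "2 / \<zeta> * \<sigma> \<le> \<zeta> * \<epsilon> / 4"
    "4 * D / (\<zeta> * \<epsilon>) * \<sigma> \<le> \<delta> / 4" "(2 / \<zeta> + real N) / \<zeta> * \<sigma> \<le> \<delta> / 4"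
    using ex_small_multiples[of "\<zeta> ^ 3 / 2000" "\<zeta> * \<epsilon> / 4" "\<delta> / 4" "\<delta> / 4" 1 "2 / \<zeta>" "4 * D / (\<zeta> * \<epsilon>)" "(2 / \<zeta> + real N) / \<zeta>"]
      zeta eps del by auto
  obtain \<eta> where e: "0 < \<eta>" "(2 / \<zeta> + 1) * \<eta> \<le> \<zeta> * \<epsilon> / 4" "4 / (\<sigma> ^ 4 * \<zeta> * \<epsilon>) * \<eta> \<le> \<delta> / 4"
    "(2 / \<zeta> + 1) / \<zeta> ^ N / \<zeta> * \<eta> \<le> \<delta> / 4"
    using ex_small_multiples[of "\<zeta> * \<epsilon> / 4" "\<delta> / 4" "\<delta> / 4" 1 "2 / \<zeta> + 1" "4 / (\<sigma> ^ 4 * \<zeta> * \<epsilon>)" "(2 / \<zeta> + 1) / \<zeta> ^ N / \<zeta>" 0]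
      zeta eps del by auto
  have total: "4 * (D * \<sigma>\<^sup>2 + \<eta> / \<sigma> ^ 3) / (\<sigma> * \<zeta> * \<epsilon>) + (2 / \<zeta> * (\<sigma> + \<eta> / \<zeta> ^ N) + real N * \<sigma> + \<eta> / \<zeta> ^ N) / \<zeta> \<le> \<delta>"
  proof -
    have s4: "\<sigma> ^ 4 = \<sigma> ^ 3 * \<sigma>" by algebra
    have "4 * (D * \<sigma>\<^sup>2 + \<eta> / \<sigma> ^ 3) / (\<sigma> * \<zeta> * \<epsilon>) = 4 * D / (\<zeta> * \<epsilon>) * \<sigma> + 4 / (\<sigma> ^ 4 * \<zeta> * \<epsilon>) * \<eta>"
      unfolding s4 using s(1) zeta eps by (simp add: add_divide_distrib power2_eq_square distrib_left)
    moreover have "(2 / \<zeta> * (\<sigma> + \<eta> / \<zeta> ^ N) + real N * \<sigma> + \<eta> / \<zeta> ^ N) / \<zeta>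
        = (2 / \<zeta> + real N) / \<zeta> * \<sigma> + (2 / \<zeta> + 1) / \<zeta> ^ N / \<zeta> * \<eta>"
      by (simp add: add_divide_distrib algebra_simps)
    ultimately show ?thesis using s e del by linarith
  qed
  have eps': "2 * (\<sigma> + \<eta>) / \<zeta> + \<eta> + \<zeta> * \<epsilon> / 2 \<le> \<zeta> * \<epsilon>"
  proof -
    have "2 * (\<sigma> + \<eta>) / \<zeta> + \<eta> = 2 / \<zeta> * \<sigma> + (2 / \<zeta> + 1) * \<eta>"
      by (simp add: add_divide_distrib algebra_simps)
    then show ?thesis using s(3) e(2) by linarith
  qed
  show ?thesis
  proof (intro exI[of _ \<eta>] conjI allI impI e(1))
    fix A :: "'a set" and p \<rho> lam f g
    assume sol: "approx_solution \<zeta> \<eta> A p \<rho> lam f g" and gA: "\<epsilon> \<le> bexp p A g"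
    then have a: "finite A" "\<zeta> \<le> p" "p \<le> 1 - \<zeta>" by (auto simp: approx_solution_def)
    interpret approx_pair \<zeta> \<sigma> \<rho> lam f g
      using sol zeta s by unfold_locales (auto simp: approx_solution_def)
    have "bexp p A k \<le> \<eta>" using sol unfolding k_def[abs_def] approx_solution_def by blast
    from certificate_bound[OF a this N eps gA eps'] total
    show "\<exists>T\<subseteq>A. card T \<le> N \<and> 1 - \<delta> \<le> bexp p (A - T) (\<lambda>X. g (T \<union> X))"
      unfolding D_def by (smt (verit))
  qed
qed

text \<open>If \<open>g\<close> accepts two incomparable atoms \<open>insert i C\<close> and \<open>insert j C\<close> but rejects \<open>C\<close>, then the
  inequality of pairs forces a negative value of \<open>f\<close>, because \<open>2 * (1 - \<rho>) > 1\<close>.\<close>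
lemma accepted_sets_inter_closed:
  fixes F G :: "'a set \<Rightarrow> real"
  assumes zeta: "0 < \<zeta>" "\<zeta> \<le> 1 / 4" and rho: "0 \<le> \<rho>" "\<rho> \<le> 1 / 2 - \<zeta>" and lam: "\<zeta> \<le> lam"
    and K: "finite K" and F: "\<And>S. 0 \<le> F S"
    and G: "\<And>R. R \<subseteq> K \<Longrightarrow> G R \<in> {0, 1}"
    and near: "\<And>R. R \<subseteq> K \<Longrightarrow> \<bar>bexp \<rho> R F - lam * G R\<bar> < \<zeta>\<^sup>2 / 4"
    and PQ: "P \<subseteq> K" "Q \<subseteq> K" "G P = 1" "G Q = 1" and R: "P \<inter> Q \<subseteq> R" "R \<subseteq> K"
  shows "G R = 1"
proof -
  define \<theta> where "\<theta> = \<zeta>\<^sup>2 / 4"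
  have "\<zeta>\<^sup>2 \<le> \<zeta> * (1 / 4)" unfolding power2_eq_square using zeta by (intro mult_left_mono) auto
  then have th: "\<theta> \<le> \<zeta> / 16" by (simp add: \<theta>_def)
  have finR: "finite S" if "S \<subseteq> K" for S using that K finite_subset by blast
  \<comment> \<open>Adding a point retains at least the fraction 1 - \<rho> \<ge> 1/2 of the
    average, and (lam - \<theta>) / 2 is too large for a rejected set.\<close>
  have up: "G (insert i S) = 1" if "insert i S \<subseteq> K" "G S = 1" for i S
  proof (cases "i \<in> S")
    case False
    have "(1 - \<rho>) * bexp \<rho> (insert i S - {i}) F \<le> bexp \<rho> (insert i S) F"
      using finR[OF that(1)] rho zeta F by (intro bexp_delete_le) auto
    then have 1: "(1 - \<rho>) * bexp \<rho> S F \<le> bexp \<rho> (insert i S) F" using False by simp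
    have S: "S \<subseteq> K" using that by auto
    have "\<bar>bexp \<rho> S F - lam * 1\<bar> < \<theta>" using near[OF S] unfolding that(2) \<theta>_def .
    then have "lam - \<theta> \<le> bexp \<rho> S F" by linarith
    then have "1 / 2 * (lam - \<theta>) \<le> (1 - \<rho>) * bexp \<rho> S F"
      using rho zeta lam th by (intro mult_mono) auto
    then have "1 / 2 * (lam - \<theta>) \<le> bexp \<rho> (insert i S) F" using 1 by (rule order_trans)
    moreover have "2 * \<theta> + \<theta> \<le> lam" using lam zeta(1) th by linarith
    ultimately have "\<theta> \<le> bexp \<rho> (insert i S) F" by (simp add: field_simps)
    then have "G (insert i S) \<noteq> 0" using near[OF that(1)] by (auto simp: \<theta>_def)
    then show ?thesis using G[OF that(1)] by auto
  qed (use that in \<open>simp add: insert_absorb\<close>)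
  have up': "G S = 1" if "U \<subseteq> S" "S \<subseteq> K" "G U = 1" for U S
  proof -
    have "finite (S - U)" using finR[OF that(2)] by simp
    have "G (U \<union> V) = 1" if "V \<subseteq> S - U" for V
      using finite_subset[OF that \<open>finite (S - U)\<close>] that
    proof (induction V rule: finite_induct)
      case (insert x V)
      then show ?case using up[of x "U \<union> V"] \<open>U \<subseteq> S\<close> \<open>S \<subseteq> K\<close> by auto
    qed (use \<open>G U = 1\<close> in simp)
    from this[of "S - U"] show ?thesis using that(1) by (simp add: Un_absorb1)
  qed
  have pair: "G C = 1" if ij: "i \<notin> C" "j \<notin> C" "i \<noteq> j" "insert i C \<subseteq> K" "insert j C \<subseteq> K"
      "G (insert i C) = 1" "G (insert j C) = 1" for i j C
  proof -
    define Y where "Y = insert i (insert j C)"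
    have Y: "Y \<subseteq> K" "finite Y" "Y - {i} = insert j C" "Y - {j} = insert i C" "insert j C - {j} = C"
      using ij finR[of Y] by (auto simp: Y_def)
    have "(1 - \<rho>) * (bexp \<rho> (Y - {i}) F + bexp \<rho> (Y - {j}) F) \<le> bexp \<rho> Y F + (1 - \<rho>)\<^sup>2 * bexp \<rho> (Y - {i} - {j}) F"
      using Y ij rho zeta F by (intro pair_inequality) (auto simp: Y_def)
    then have 1: "(1 - \<rho>) * (bexp \<rho> (insert j C) F + bexp \<rho> (insert i C) F) \<le> bexp \<rho> Y F + (1 - \<rho>)\<^sup>2 * bexp \<rho> C F"
      unfolding Y .
    have C0: "0 \<le> bexp \<rho> C F" using rho zeta F by (intro bexp_nonneg) auto
    have "(1 - \<rho>)\<^sup>2 * bexp \<rho> C F \<le> 1 * bexp \<rho> C F"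
      using C0 rho zeta by (intro mult_right_mono) (auto simp: power_le_one)
    moreover have "(1 / 2 + \<zeta>) * (2 * (lam - \<theta>)) \<le> (1 - \<rho>) * (bexp \<rho> (insert j C) F + bexp \<rho> (insert i C) F)"
    proof (rule mult_mono)
      have "\<bar>bexp \<rho> (insert i C) F - lam * 1\<bar> < \<theta>" "\<bar>bexp \<rho> (insert j C) F - lam * 1\<bar> < \<theta>"
        using near[OF ij(4)] near[OF ij(5)] unfolding ij(6,7) \<theta>_def .
      then have "lam - \<theta> \<le> bexp \<rho> (insert j C) F" "lam - \<theta> \<le> bexp \<rho> (insert i C) F"
        by (simp_all add: abs_less_iff)
      from add_mono[OF this] show "2 * (lam - \<theta>) \<le> bexp \<rho> (insert j C) F + bexp \<rho> (insert i C) F" by simp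
      show "0 \<le> 2 * (lam - \<theta>)" using lam zeta(1) th by simp
    qed (use rho zeta(1) in auto)
    moreover have "bexp \<rho> Y F \<le> lam + \<theta>"
    proof -
      have "bexp \<rho> Y F \<le> \<theta> + lam * G Y" using near[OF Y(1)] unfolding \<theta>_def[symmetric] by (simp add: abs_less_iff)
      moreover have "lam * G Y \<le> lam" using G[OF Y(1)] lam zeta(1) by auto
      ultimately show ?thesis by simp
    qed
    \<comment> \<open>The gain 2 \<zeta> lam is at least 8 \<theta> and the errors cost 3 \<theta>,
      which leaves 5 \<theta>.\<close>
    moreover have "(1 / 2 + \<zeta>) * (2 * (lam - \<theta>)) = lam - \<theta> + 2 * (\<zeta> * lam) - 2 * \<zeta> * \<theta>" by algebra
    moreover have "2 * \<zeta> * \<theta> \<le> 1 * \<theta>" using zeta by (intro mult_right_mono) (auto simp: \<theta>_def)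
    moreover have "\<zeta> * \<zeta> \<le> \<zeta> * lam" using lam zeta by (intro mult_left_mono) auto
    then have "4 * \<theta> \<le> \<zeta> * lam" by (simp add: \<theta>_def power2_eq_square)
    ultimately have "5 * \<theta> \<le> bexp \<rho> C F" using 1 by linarith
    moreover have "0 < \<theta>" using zeta(1) by (simp add: \<theta>_def)
    ultimately have "\<theta> \<le> bexp \<rho> C F" by linarith
    moreover have "C \<subseteq> K" using ij by auto
    ultimately have "G C \<noteq> 0" using near[of C] by (auto simp: \<theta>_def)
    then show ?thesis using G[OF \<open>C \<subseteq> K\<close>] by auto
  qed
  have "G (P \<inter> Q) = 1"
    using PQ
  proof (induction "card (P - Q) + card (Q - P)" arbitrary: P Q rule: less_induct)
    case less
    have fin: "finite (P - Q)" "finite (Q - P)" using finR less.prems by auto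
    \<comment> \<open>Adding x from U - V to V brings V closer to U, so the induction accepts U
      \<inter> insert x V. This set exceeds V only by x, so it is closer to V than U was, and a
      second use of the induction removes x.\<close>
    have step: "G (U \<inter> V) = 1" if UV: "U \<subseteq> K" "V \<subseteq> K" "G U = 1" "G V = 1" "2 \<le> card (U - V)"
        "card (U - V) + card (V - U) = card (P - Q) + card (Q - P)" for U V
    proof -
      have fUV: "finite (U - V)" "finite (V - U)" using finR UV by auto
      obtain x where x: "x \<in> U" "x \<notin> V" using UV(5) by (metis Diff_iff all_not_in_conv card.empty not_numeral_le_zero)
      have "U - insert x V = (U - V) - {x}" "insert x V - U = V - U" using x by auto
      then have "card (U - insert x V) + card (insert x V - U) < card (P - Q) + card (Q - P)"
        using UV(5,6) fUV x by (simp add: card_Diff_singleton)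
      from less.hyps[OF this] have 1: "G (U \<inter> insert x V) = 1"
        using UV x up[of x V] by auto
      have "U \<inter> insert x V - V = {x}" "V - (U \<inter> insert x V) = V - U" using x by auto
      then have "card (U \<inter> insert x V - V) + card (V - (U \<inter> insert x V)) < card (P - Q) + card (Q - P)"
        using UV(5,6) by simp
      from less.hyps[OF this _ UV(2) 1 UV(4)] have "G (U \<inter> insert x V \<inter> V) = 1" using UV(1) by auto
      moreover have "U \<inter> insert x V \<inter> V = U \<inter> V" by auto
      ultimately show ?thesis by simp
    qed
    consider "P - Q = {}" | "Q - P = {}" | "2 \<le> card (P - Q)" | "2 \<le> card (Q - P)"
      | "card (P - Q) = 1" "card (Q - P) = 1"
      using fin by (metis One_nat_def Suc_1 Suc_leI card_0_eq le_neq_implies_less not_less_eq_eq not_less0 linorder_neqE_nat)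
    then show ?case
    proof cases
      case 1
      then have "P \<inter> Q = P" by auto
      then show ?thesis using less.prems by simp
    next
      case 2
      then have "P \<inter> Q = Q" by auto
      then show ?thesis using less.prems by simp
    next
      case 3
      then show ?thesis using step[of P Q] less.prems by simp
    next
      case 4
      then show ?thesis using step[of Q P] less.prems by (simp add: Int_commute)
    next
      case 5
      then obtain i j where ij: "P - Q = {i}" "Q - P = {j}" by (auto simp: card_1_singleton_iff)
      then have "P = insert i (P \<inter> Q)" "Q = insert j (P \<inter> Q)" "i \<notin> P \<inter> Q" "j \<notin> P \<inter> Q" "i \<noteq> j" by auto
      then show ?thesis using pair[of i "P \<inter> Q" j] less.prems by metis
    qed
  qed
  then show ?thesis using up'[OF R] by simp
qed

subsection \<open>Minimal certificates\<close>

lemma bexp_swap: "bexp p A (\<lambda>S. bexp q B (\<lambda>R. \<phi> S R)) = bexp q B (\<lambda>R. bexp p A (\<lambda>S. \<phi> S R))"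
  unfolding bexp_def sum_distrib_left by (subst sum.swap) (simp add: mult_ac)

lemma bexp_atom_le:
  assumes "finite A" "K \<subseteq> A" "R \<subseteq> K" "card K \<le> n" "0 < \<zeta>" "\<zeta> \<le> p" "p \<le> 1 - \<zeta>" "\<And>S. S \<subseteq> A \<Longrightarrow> 0 \<le> \<phi> S"
  shows "bexp p (A - K) (\<lambda>S. \<phi> (R \<union> S)) \<le> bexp p A \<phi> / \<zeta> ^ n"
proof -
  have finK: "finite K" using assms finite_subset by blast
  have nn: "0 \<le> bexp p (A - K) (\<lambda>S. \<phi> (R \<union> S))"
  proof (rule bexp_nonneg)
    fix S assume "S \<subseteq> A - K"
    then have "R \<union> S \<subseteq> A" using assms by auto
    then show "0 \<le> \<phi> (R \<union> S)" using assms by blast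
  qed (use assms in auto)
  have "\<zeta> ^ n \<le> \<zeta> ^ card K" using assms by (intro power_decreasing) auto
  also have "card K = card R + card (K - R)"
    using finK assms(3) by (metis card_Diff_subset card_mono finite_subset le_add_diff_inverse)
  also have "\<zeta> ^ (card R + card (K - R)) \<le> p ^ card R * (1 - p) ^ card (K - R)"
    unfolding power_add using assms by (intro mult_mono power_mono) auto
  finally have "\<zeta> ^ n * bexp p (A - K) (\<lambda>S. \<phi> (R \<union> S)) \<le>
      p ^ card R * (1 - p) ^ card (K - R) * bexp p (A - K) (\<lambda>S. \<phi> (R \<union> S))"
    using nn by (intro mult_right_mono) auto
  also have "\<dots> \<le> bexp p A \<phi>" by (rule bexp_ge_atom) (use assms in auto)
  finally show ?thesis using assms by (simp add: field_simps)
qed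

text \<open>Outside K = T \<union> T' the coordinates S are fixed. For most S both T \<union> S and
  T' \<union> S are accepted and all errors on the cube of K are small, so
  \<open>accepted_sets_inter_closed\<close> accepts every R \<union> S with T \<inter> T'
  \<subseteq> R \<subseteq> K. Exceptional S are paid for by the three error terms.\<close>

lemma certificate_inter:
  fixes f g :: "'a set \<Rightarrow> real"
  assumes zeta: "0 < \<zeta>" "\<zeta> \<le> 1 / 4" and rho: "\<zeta> \<le> \<rho>" "\<rho> \<le> 1 / 2 - \<zeta>" and lam: "\<zeta> \<le> lam"
    and p: "\<zeta> \<le> p" "p \<le> 1 - \<zeta>" and A: "finite A"
    and f: "\<And>S. 0 \<le> f S" and g: "\<And>S. g S \<in> {0, 1}"
    and k: "bexp p A (\<lambda>X. \<bar>bexp \<rho> X f - lam * g X\<bar>) \<le> \<eta>"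
    and T: "T \<subseteq> A" "card T \<le> N" "1 - \<delta> \<le> bexp p (A - T) (\<lambda>X. g (T \<union> X))"
    and T': "i \<in> T" "T' \<subseteq> A - {i}" "card T' \<le> N" "1 - \<delta>' \<le> bexp p (A - {i} - T') (\<lambda>X. g (T' \<union> X))"
  shows "1 - ((\<delta> + \<delta>') / \<zeta> ^ N + 4 / \<zeta>\<^sup>2 * (2 ^ (2 * N) * (\<eta> / \<zeta> ^ (2 * N))))
    \<le> bexp p (A - (T \<inter> T')) (\<lambda>X. g (T \<inter> T' \<union> X))"
proof -
  define K where "K = T \<union> T'"
  define B where "B = A - K"
  define k where "k = (\<lambda>X. \<bar>bexp \<rho> X f - lam * g X\<bar>)"
  have p01: "0 \<le> p" "p \<le> 1" using p zeta by auto
  have K: "K \<subseteq> A" "finite K" "finite B" using A T T' finite_subset[of K A] by (auto simp: K_def B_def)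
  have cK: "card K \<le> 2 * N" using card_Un_le[of T T'] T T' by (simp add: K_def)
  have g01: "0 \<le> g S" "g S \<le> 1" for S using g[of S] by auto
  have u: "bexp p B (\<lambda>S. 1 - g (T \<union> S)) \<le> \<delta> / \<zeta> ^ N"
  proof -
    \<comment> \<open>The additional points of K are fixed as absent, so that T \<union> S is
      evaluated with S outside K; this costs the factor 1 / \<zeta>^N.\<close>
    have "bexp p (A - T - (K - T)) (\<lambda>S. 1 - g (T \<union> ({} \<union> S))) \<le> bexp p (A - T) (\<lambda>S. 1 - g (T \<union> S)) / \<zeta> ^ N"
    proof (rule bexp_atom_le)
      have "K - T \<subseteq> T'" by (auto simp: K_def)
      then have "card (K - T) \<le> card T'" using T' A by (intro card_mono) (auto intro: finite_subset)
      then show "card (K - T) \<le> N" using T' by linarith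
    qed (use A K zeta p g01 in auto)
    also have "\<dots> \<le> \<delta> / \<zeta> ^ N"
      using T(3) A zeta by (intro divide_right_mono) (auto simp: bexp_diff)
    also have "A - T - (K - T) = B" by (auto simp: B_def K_def)
    finally show ?thesis by simp
  qed
  have u': "bexp p B (\<lambda>S. 1 - g (T' \<union> S)) \<le> \<delta>' / \<zeta> ^ N"
  proof -
    have "bexp p (A - {i} - T' - (K - {i} - T')) (\<lambda>S. 1 - g (T' \<union> ({} \<union> S))) \<le> bexp p (A - {i} - T') (\<lambda>S. 1 - g (T' \<union> S)) / \<zeta> ^ N"
    proof (rule bexp_atom_le)
      have "K - {i} - T' \<subseteq> T" by (auto simp: K_def)
      then have "card (K - {i} - T') \<le> card T" using T A by (intro card_mono) (auto intro: finite_subset)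
      then show "card (K - {i} - T') \<le> N" using T by linarith
    qed (use A K zeta p g01 in auto)
    also have "\<dots> \<le> \<delta>' / \<zeta> ^ N"
      using T'(4) A zeta by (intro divide_right_mono) (auto simp: bexp_diff)
    also have "A - {i} - T' - (K - {i} - T') = B" using T'(1) by (auto simp: B_def K_def)
    finally show ?thesis by simp
  qed
  have e0: "0 \<le> \<eta> / \<zeta> ^ (2 * N)"
  proof -
    have "0 \<le> bexp p A k" using p01 by (intro bexp_nonneg) (auto simp: k_def)
    then show ?thesis using k zeta unfolding k_def by simp
  qed
  have kk: "bexp p B (\<lambda>S. \<Sum>R\<in>Pow K. k (R \<union> S)) \<le> 2 ^ (2 * N) * (\<eta> / \<zeta> ^ (2 * N))"
  proof -
    have "bexp p B (\<lambda>S. \<Sum>R\<in>Pow K. k (R \<union> S)) = (\<Sum>R\<in>Pow K. bexp p B (\<lambda>S. k (R \<union> S)))"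
      by (rule bexp_sum)
    also have "\<dots> \<le> (\<Sum>R\<in>Pow K. \<eta> / \<zeta> ^ (2 * N))"
    proof (intro sum_mono)
      fix R assume "R \<in> Pow K"
      then have "bexp p (A - K) (\<lambda>S. k (R \<union> S)) \<le> bexp p A k / \<zeta> ^ (2 * N)"
        using A K cK zeta p by (intro bexp_atom_le) (auto simp: k_def)
      also have "\<dots> \<le> \<eta> / \<zeta> ^ (2 * N)" using k zeta unfolding k_def by (intro divide_right_mono) auto
      finally show "bexp p B (\<lambda>S. k (R \<union> S)) \<le> \<eta> / \<zeta> ^ (2 * N)" unfolding B_def .
    qed
    also have "\<dots> = 2 ^ card K * (\<eta> / \<zeta> ^ (2 * N))" using K by (simp add: card_Pow)
    also have "\<dots> \<le> 2 ^ (2 * N) * (\<eta> / \<zeta> ^ (2 * N))"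
      using cK e0 by (intro mult_right_mono power_increasing) auto
    finally show ?thesis .
  qed
  have point: "1 - g (T \<inter> T' \<union> (R \<union> S)) \<le> (1 - g (T \<union> S)) + (1 - g (T' \<union> S)) + 4 / \<zeta>\<^sup>2 * (\<Sum>R\<in>Pow K. k (R \<union> S))"
    if R: "R \<subseteq> K" and S: "S \<subseteq> B" for R S
  proof (cases "g (T \<union> S) = 1 \<and> g (T' \<union> S) = 1 \<and> (\<Sum>R\<in>Pow K. k (R \<union> S)) < \<zeta>\<^sup>2 / 4")
    case True
    \<comment> \<open>The noise on the coordinates S is absorbed into F, so that the noise of F at U
      is the noise of f at U \<union> S.\<close>
    define F where "F = (\<lambda>R. bexp \<rho> S (\<lambda>X. f (R \<union> X)))"
    have "finite S" using S K finite_subset by blast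
    have "g (T \<inter> T' \<union> R \<union> S) = 1"
    proof (rule accepted_sets_inter_closed[where G = "\<lambda>R. g (R \<union> S)" and F = F and K = K and P = T and Q = T'])
      fix U assume U: "U \<subseteq> K"
      have "U \<inter> S = {}" using U S by (auto simp: B_def)
      then have "bexp \<rho> U F = bexp \<rho> (U \<union> S) f"
        unfolding F_def using U K finite_subset \<open>finite S\<close> by (intro bexp_union[symmetric]) auto
      moreover have "k (U \<union> S) \<le> (\<Sum>R\<in>Pow K. k (R \<union> S))"
        using U K by (intro member_le_sum[of U "Pow K" "\<lambda>R. k (R \<union> S)"]) (auto simp: k_def)
      ultimately show "\<bar>bexp \<rho> U F - lam * g (U \<union> S)\<bar> < \<zeta>\<^sup>2 / 4" using True by (simp add: k_def)
    next
      show "0 \<le> F U" for U unfolding F_def using rho zeta f by (intro bexp_nonneg) auto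
    qed (use zeta rho lam K g True R in \<open>auto simp: K_def\<close>)
    moreover have "0 \<le> (\<Sum>R\<in>Pow K. k (R \<union> S))" by (intro sum_nonneg) (auto simp: k_def)
    ultimately show ?thesis using True zeta by (simp add: Un_assoc)
  next
    case False
    have nn: "0 \<le> 4 / \<zeta>\<^sup>2 * (\<Sum>R\<in>Pow K. k (R \<union> S))"
      using zeta by (intro mult_nonneg_nonneg sum_nonneg) (auto simp: k_def)
    have "1 \<le> 4 / \<zeta>\<^sup>2 * (\<Sum>R\<in>Pow K. k (R \<union> S))" if "\<zeta>\<^sup>2 / 4 \<le> (\<Sum>R\<in>Pow K. k (R \<union> S))"
      using that zeta by (simp add: field_simps)
    then show ?thesis
      using False nn g[of "T \<union> S"] g[of "T' \<union> S"] g01[of "T \<inter> T' \<union> (R \<union> S)"] g01[of "T \<union> S"] g01[of "T' \<union> S"]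
      by (auto simp: not_less)
  qed
  let ?C = "T \<inter> T'"
  have sub: "K - ?C \<subseteq> A - ?C" "A - ?C - (K - ?C) = B" using K by (auto simp: K_def B_def)
  have "bexp p (A - ?C) (\<lambda>X. 1 - g (?C \<union> X)) = bexp p (K - ?C) (\<lambda>R. bexp p B (\<lambda>S. 1 - g (?C \<union> (R \<union> S))))"
    using bexp_split[OF _ sub(1), of p "\<lambda>X. 1 - g (?C \<union> X)"] A unfolding sub(2) by simp
  also have "\<dots> \<le> bexp p (K - ?C) (\<lambda>R. bexp p B (\<lambda>S. (1 - g (T \<union> S)) + (1 - g (T' \<union> S)) + 4 / \<zeta>\<^sup>2 * (\<Sum>R\<in>Pow K. k (R \<union> S))))"
    by (intro bexp_mono p01 point) auto
  also have "\<dots> = bexp p B (\<lambda>S. (1 - g (T \<union> S)) + (1 - g (T' \<union> S)) + 4 / \<zeta>\<^sup>2 * (\<Sum>R\<in>Pow K. k (R \<union> S)))"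
    using K by (intro bexp_const) auto
  also have "\<dots> \<le> \<delta> / \<zeta> ^ N + \<delta>' / \<zeta> ^ N + 4 / \<zeta>\<^sup>2 * (2 ^ (2 * N) * (\<eta> / \<zeta> ^ (2 * N)))"
    unfolding bexp_add bexp_cmult by (intro add_mono u u' mult_left_mono kk) auto
  finally show ?thesis using A by (simp add: bexp_diff add_divide_distrib)
qed

text \<open>If g had much mass off the minimal T, it would have mass on some x_i = 0 with i in T. A
  certificate found there avoids i, and its intersection with T is a strictly smaller
  certificate.\<close>

lemma ex_approx_AND:
  assumes zeta: "0 < \<zeta>" "\<zeta> \<le> 1 / 4" and eps: "0 < \<epsilon>" and N: "16 / \<zeta>\<^sup>2 \<le> real N"
  shows "\<exists>\<eta>>0. \<forall>(A :: 'a set) p \<rho> lam f g.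
    approx_solution \<zeta> \<eta> A p \<rho> lam f g \<longrightarrow> \<epsilon> \<le> bexp p A g \<longrightarrow>
    (\<exists>T\<subseteq>A. card T \<le> N \<and> bexp p A (\<lambda>X. of_bool (\<not> T \<subseteq> X) * g X) \<le> \<epsilon> \<and>
        1 - \<epsilon> \<le> bexp p (A - T) (\<lambda>X. g (T \<union> X)))"
proof -
  define z where "z = \<zeta> ^ N"
  \<comment> \<open>One intersection turns tolerance t into at most 2 t / z + \<delta>, with
    \<delta> \<le> t \<le> t / z; hence the factor 3 / z.\<close>
  define C where "C = 3 / z"
  define \<delta> where "\<delta> = \<epsilon> / C ^ N"
  \<comment> \<open>Mass \<epsilon> off T, split over at most N points of T, leaves mass above
    \<epsilon>' for one of them.\<close>
  define \<epsilon>' where "\<epsilon>' = \<epsilon> / (real N + 1)"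
  have z: "0 < z" "z \<le> 1" using zeta by (auto simp: z_def power_le_one)
  have C: "1 \<le> C" "0 < C" using z by (auto simp: C_def field_simps)
  have del: "0 < \<delta>" using eps C by (simp add: \<delta>_def)
  have eps': "0 < \<epsilon>'" "\<epsilon>' \<le> \<epsilon>" using eps by (auto simp: \<epsilon>'_def field_simps)
  obtain \<eta>1 where e1: "0 < \<eta>1" "\<forall>(A :: 'a set) p \<rho> lam f g.
    approx_solution \<zeta> \<eta>1 A p \<rho> lam f g \<longrightarrow> \<epsilon>' \<le> bexp p A g \<longrightarrow>
    (\<exists>T\<subseteq>A. card T \<le> N \<and> 1 - \<delta> \<le> bexp p (A - T) (\<lambda>X. g (T \<union> X)))"
    using certificate_exists[OF zeta eps'(1) del N] by blast
  obtain \<eta> where e: "0 < \<eta>" "1 / \<zeta> * \<eta> \<le> \<eta>1" "4 / \<zeta>\<^sup>2 * (2 ^ (2 * N) * (1 / \<zeta> ^ (2 * N))) * \<eta> \<le> \<delta>" "1 * \<eta> \<le> \<eta>1"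
    using ex_small_multiples[OF e1(1) del e1(1) e1(1), of "1 / \<zeta>" "4 / \<zeta>\<^sup>2 * (2 ^ (2 * N) * (1 / \<zeta> ^ (2 * N)))" 1] by blast
  show ?thesis
  proof (intro exI[of _ \<eta>] conjI allI impI e(1))
    fix A :: "'a set" and p \<rho> lam f g
    assume sol: "approx_solution \<zeta> \<eta> A p \<rho> lam f g" and gA: "\<epsilon> \<le> bexp p A g"
    from sol have A: "finite A" and p: "\<zeta> \<le> p" "p \<le> 1 - \<zeta>" and rho: "\<zeta> \<le> \<rho>" "\<rho> \<le> 1 / 2 - \<zeta>"
      and lam: "\<zeta> \<le> lam" "lam \<le> 1" and f: "\<forall>S. 0 \<le> f S \<and> f S \<le> 1" and g: "\<forall>S. g S \<in> {0, 1 :: real}"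
      and k: "bexp p A (\<lambda>X. \<bar>bexp \<rho> X f - lam * g X\<bar>) \<le> \<eta>" by (auto simp: approx_solution_def)
    have p01: "0 \<le> p" "p \<le> 1" using p zeta by auto
    have g01: "0 \<le> g S" "g S \<le> 1" for S using g[rule_format, of S] by auto
    \<comment> \<open>The tolerance grows by C for each point removed, to match the loss in an
      intersection. As sizes are at most N, it never exceeds \<delta> C^N = \<epsilon>.\<close>
    define t where "t = (\<lambda>c. \<delta> * C ^ (N - c))"
    define P where "P = (\<lambda>T. T \<subseteq> A \<and> card T \<le> N \<and> 1 - t (card T) \<le> bexp p (A - T) (\<lambda>X. g (T \<union> X)))"
    have t_ge: "\<delta> \<le> t c" for c
      using del C one_le_power[of C "N - c"] by (simp add: t_def)
    have t_le: "t c \<le> \<epsilon>" for c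
    proof -
      have "t c \<le> \<delta> * C ^ N" unfolding t_def using del C by (intro mult_left_mono power_increasing) auto
      then show ?thesis using C by (simp add: \<delta>_def)
    qed
    have "\<exists>T\<subseteq>A. card T \<le> N \<and> 1 - \<delta> \<le> bexp p (A - T) (\<lambda>X. g (T \<union> X))"
      using e1(2)[rule_format, of A p \<rho> lam f g] sol e(4) gA eps' by (auto simp: approx_solution_def)
    then obtain T0 where "P T0" unfolding P_def using t_ge by (meson diff_left_mono order_trans)
    then obtain T where T: "P T" "\<And>T'. P T' \<Longrightarrow> card T \<le> card T'"
      using ex_has_least_nat[of P T0 card] by blast
    have TP: "T \<subseteq> A" "card T \<le> N" "1 - t (card T) \<le> bexp p (A - T) (\<lambda>X. g (T \<union> X))"
      using T(1) by (auto simp: P_def)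
    have finT: "finite T" using TP A finite_subset by blast
    have small: "bexp p A (\<lambda>X. of_bool (\<not> T \<subseteq> X) * g X) \<le> \<epsilon>"
    proof (rule ccontr)
      assume big: "\<not> ?thesis"
      have "bexp p A (\<lambda>X. of_bool (\<not> T \<subseteq> X) * g X) \<le> bexp p A (\<lambda>X. \<Sum>i\<in>T. of_bool (i \<notin> X) * g X)"
      proof (rule bexp_mono[OF p01])
        fix X
        have nn: "0 \<le> (\<Sum>i\<in>T. of_bool (i \<notin> X) * g X)" using g01 by (intro sum_nonneg) auto
        show "of_bool (\<not> T \<subseteq> X) * g X \<le> (\<Sum>i\<in>T. of_bool (i \<notin> X) * g X)"
        proof (cases "T \<subseteq> X")
          case False
          then obtain i where i: "i \<in> T" "i \<notin> X" by auto
          then have "of_bool (i \<notin> X) * g X \<le> (\<Sum>i\<in>T. of_bool (i \<notin> X) * g X)"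
            using finT g01 by (intro member_le_sum) auto
          then show ?thesis using False i by simp
        qed (use nn in simp)
      qed
      also have "\<dots> = (\<Sum>i\<in>T. bexp p A (\<lambda>X. of_bool (i \<notin> X) * g X))" by (rule bexp_sum)
      finally have "\<epsilon> < (\<Sum>i\<in>T. bexp p A (\<lambda>X. of_bool (i \<notin> X) * g X))" using big by linarith
      moreover have "(\<Sum>i\<in>T. \<epsilon>') \<le> \<epsilon>"
      proof -
        have "\<epsilon>' * real (card T) \<le> \<epsilon>' * (real N + 1)" using TP(2) eps' by (intro mult_left_mono) auto
        moreover have "\<epsilon>' * (real N + 1) = \<epsilon>" by (simp add: \<epsilon>'_def)
        ultimately show ?thesis by (simp add: mult.commute)
      qed
      ultimately have "(\<Sum>i\<in>T. \<epsilon>') < (\<Sum>i\<in>T. bexp p A (\<lambda>X. of_bool (i \<notin> X) * g X))" by linarith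
      then have "\<not> (\<forall>i\<in>T. bexp p A (\<lambda>X. of_bool (i \<notin> X) * g X) \<le> \<epsilon>')"
        by (meson not_le sum_mono)
      then obtain i where i: "i \<in> T" "\<epsilon>' < bexp p A (\<lambda>X. of_bool (i \<notin> X) * g X)" by (auto simp: not_le)
      have iA: "i \<in> A" using i TP by auto
      have "bexp p A (\<lambda>X. of_bool (i \<notin> X) * g X) = (1 - p) * bexp p (A - {i}) g"
      proof -
        have "bexp p (A - {i}) (\<lambda>X. of_bool (i \<notin> X) * g X) = bexp p (A - {i}) g" by (intro bexp_cong) auto
        then show ?thesis using bexp_remove[OF A iA, of p "\<lambda>X. of_bool (i \<notin> X) * g X"] A by simp
      qed
      also have "\<dots> \<le> bexp p (A - {i}) g"
        using p01 g01 by (intro mult_left_le_one_le bexp_nonneg) auto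
      finally have gi: "\<epsilon>' \<le> bexp p (A - {i}) g" using i by linarith
      have "(1 - p) * bexp p (A - {i}) (\<lambda>X. \<bar>bexp \<rho> X f - lam * g X\<bar>) \<le> \<eta>"
        using bexp_delete_le[OF A iA p01, of "\<lambda>X. \<bar>bexp \<rho> X f - lam * g X\<bar>"] k by simp
      moreover have "\<zeta> * bexp p (A - {i}) (\<lambda>X. \<bar>bexp \<rho> X f - lam * g X\<bar>) \<le>
          (1 - p) * bexp p (A - {i}) (\<lambda>X. \<bar>bexp \<rho> X f - lam * g X\<bar>)"
        using p p01 by (intro mult_right_mono bexp_nonneg) auto
      ultimately have "bexp p (A - {i}) (\<lambda>X. \<bar>bexp \<rho> X f - lam * g X\<bar>) \<le> 1 / \<zeta> * \<eta>"
        using zeta by (simp add: field_simps)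
      then have "bexp p (A - {i}) (\<lambda>X. \<bar>bexp \<rho> X f - lam * g X\<bar>) \<le> \<eta>1" using e(2) by linarith
      then obtain T' where T': "T' \<subseteq> A - {i}" "card T' \<le> N" "1 - \<delta> \<le> bexp p (A - {i} - T') (\<lambda>X. g (T' \<union> X))"
        using e1(2)[rule_format, of "A - {i}" p \<rho> lam f g] sol gi by (auto simp: approx_solution_def)
      have "1 - ((t (card T) + \<delta>) / \<zeta> ^ N + 4 / \<zeta>\<^sup>2 * (2 ^ (2 * N) * (\<eta> / \<zeta> ^ (2 * N))))
          \<le> bexp p (A - (T \<inter> T')) (\<lambda>X. g (T \<inter> T' \<union> X))"
        by (rule certificate_inter[where f = f and lam = lam and \<rho> = \<rho> and i = i]) (use zeta rho lam p A f g k TP i T' in auto)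
      moreover have "(t (card T) + \<delta>) / \<zeta> ^ N + 4 / \<zeta>\<^sup>2 * (2 ^ (2 * N) * (\<eta> / \<zeta> ^ (2 * N))) \<le> C * t (card T)"
      proof -
        have "(t (card T) + \<delta>) / \<zeta> ^ N \<le> 2 * t (card T) / z"
          using t_ge[of "card T"] z unfolding z_def[symmetric] by (intro divide_right_mono) auto
        moreover have "4 / \<zeta>\<^sup>2 * (2 ^ (2 * N) * (\<eta> / \<zeta> ^ (2 * N))) \<le> \<delta>" using e(3) by simp
        moreover have "t (card T) \<le> t (card T) / z"
          using z t_ge[of "card T"] del by (simp add: field_simps)
        moreover have "C * t (card T) = 2 * t (card T) / z + t (card T) / z" by (simp add: C_def field_simps)
        ultimately show ?thesis using t_ge[of "card T"] by linarith
      qed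
      moreover have less: "card (T \<inter> T') < card T" using i(1) T'(1) finT by (intro psubset_card_mono) auto
      have "C * t (card T) \<le> t (card (T \<inter> T'))"
      proof -
        have "C * C ^ (N - card T) \<le> C ^ (N - card (T \<inter> T'))"
          unfolding power_Suc[symmetric] using less TP(2) C by (intro power_increasing) auto
        then show ?thesis using del mult_left_mono[of "C * C ^ (N - card T)" _ \<delta>] by (simp add: t_def mult_ac)
      qed
      ultimately have "P (T \<inter> T')" unfolding P_def using TP less by auto
      from T(2)[OF this] less show False by simp
    qed
    show "\<exists>T\<subseteq>A. card T \<le> N \<and> bexp p A (\<lambda>X. of_bool (\<not> T \<subseteq> X) * g X) \<le> \<epsilon> \<and>
        1 - \<epsilon> \<le> bexp p (A - T) (\<lambda>X. g (T \<union> X))"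
      using TP small t_le[of "card T"] by (intro exI[of _ T]) auto
  qed
qed

text \<open>Triangularity of the noise operator on the bounded cube of \<open>T\<close> allows one to solve for \<open>F\<close>.\<close>
lemma invert_noise_AND:
  fixes F :: "'a set \<Rightarrow> real"
  assumes T: "finite T" "card T \<le> N" and zeta: "0 < \<zeta>" "\<zeta> \<le> 1" and rho: "\<zeta> \<le> \<rho>" "\<rho> \<le> 1"
    and F: "\<And>S. 0 \<le> F S" and th: "0 \<le> \<theta>"
    and near: "\<And>R. R \<subseteq> T \<Longrightarrow> \<bar>bexp \<rho> R F - lam * of_bool (T \<subseteq> R)\<bar> \<le> \<theta>"
    and R: "R \<subseteq> T"
  shows "\<bar>F R - lam / \<rho> ^ card T * of_bool (T \<subseteq> R)\<bar> \<le> 2 * \<theta> / \<zeta> ^ (2 * N)"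
proof -
  have r0: "0 \<le> \<rho>" "0 < \<rho>" using zeta rho by auto
  have pw: "\<zeta> ^ N \<le> \<rho> ^ card S" if "S \<subseteq> T" for S
  proof -
    have "card S \<le> N" using card_mono[OF T(1) that] T(2) by linarith
    then have "\<zeta> ^ N \<le> \<zeta> ^ card S" using zeta by (intro power_decreasing) auto
    also have "\<dots> \<le> \<rho> ^ card S" using zeta rho by (intro power_mono) auto
    finally show ?thesis .
  qed
  have zN: "0 < \<zeta> ^ N" "\<zeta> ^ N \<le> 1" using zeta by (auto simp: power_le_one)
  have zz: "\<zeta> ^ (2 * N) = \<zeta> ^ N * \<zeta> ^ N" by (simp add: mult_2 power_add)
  \<comment> \<open>For nonnegative F, the term of S itself in the noise at S is bounded by the
    whole average, which is at most \<theta> below the top.\<close>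
  have low: "F S \<le> \<theta> / \<zeta> ^ N" if S: "S \<subseteq> T" "S \<noteq> T" for S
  proof -
    have "\<rho> ^ card S * (1 - \<rho>) ^ card (S - S) * bexp \<rho> (S - S) (\<lambda>X. F (S \<union> X)) \<le> bexp \<rho> S F"
      using T S finite_subset r0 rho F by (intro bexp_ge_atom) auto
    also have "\<dots> \<le> \<theta>" using near[OF S(1)] S by auto
    finally have "\<rho> ^ card S * F S \<le> \<theta>" by simp
    then have "\<zeta> ^ N * F S \<le> \<theta>" using mult_right_mono[OF pw[OF S(1)] F[of S]] by linarith
    then show ?thesis using zN by (simp add: field_simps)
  qed
  show ?thesis
  proof (cases "R = T")
    case False
    then have "\<not> T \<subseteq> R" using R by auto
    have "\<theta> / \<zeta> ^ N \<le> \<theta> / \<zeta> ^ (2 * N)"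
      unfolding zz using th zN by (intro divide_left_mono mult_pos_pos) (auto simp: mult_left_le)
    also have "\<dots> \<le> 2 * \<theta> / \<zeta> ^ (2 * N)" using th zeta by (intro divide_right_mono) auto
    finally show ?thesis using low[OF R False] F[of R] \<open>\<not> T \<subseteq> R\<close> by simp
  next
    case True
    have "bexp \<rho> T F = bexp \<rho> T (\<lambda>X. of_bool (T \<subseteq> X) * F X + of_bool (\<not> T \<subseteq> X) * F X)"
      by (intro bexp_cong) auto
    also have "\<dots> = \<rho> ^ card T * F T + bexp \<rho> T (\<lambda>X. of_bool (\<not> T \<subseteq> X) * F X)"
      unfolding bexp_add bexp_restrict[OF T(1) order_refl] by simp
    finally have split: "bexp \<rho> T F = \<rho> ^ card T * F T + bexp \<rho> T (\<lambda>X. of_bool (\<not> T \<subseteq> X) * F X)" .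
    have rest: "0 \<le> bexp \<rho> T (\<lambda>X. of_bool (\<not> T \<subseteq> X) * F X)"
      "bexp \<rho> T (\<lambda>X. of_bool (\<not> T \<subseteq> X) * F X) \<le> \<theta> / \<zeta> ^ N"
    proof -
      show "0 \<le> bexp \<rho> T (\<lambda>X. of_bool (\<not> T \<subseteq> X) * F X)" using r0 rho F by (intro bexp_nonneg) auto
      show "bexp \<rho> T (\<lambda>X. of_bool (\<not> T \<subseteq> X) * F X) \<le> \<theta> / \<zeta> ^ N"
      proof (rule bexp_le_const)
        fix S assume "S \<subseteq> T"
        then show "of_bool (\<not> T \<subseteq> S) * F S \<le> \<theta> / \<zeta> ^ N"
          using low[of S] th zN by (cases "S = T") auto
      qed (use T r0 rho in auto)
    qed
    have "\<theta> \<le> \<theta> / \<zeta> ^ N" using th zN by (simp add: field_simps mult_left_le)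
    then have "\<bar>\<rho> ^ card T * F T - lam\<bar> \<le> 2 * (\<theta> / \<zeta> ^ N)"
      using near[OF order_refl] split rest by auto
    moreover have "\<rho> ^ card T * \<bar>F T - lam / \<rho> ^ card T\<bar> = \<bar>\<rho> ^ card T * F T - lam\<bar>"
    proof -
      have "\<rho> ^ card T * (F T - lam / \<rho> ^ card T) = \<rho> ^ card T * F T - lam" using r0 by (simp add: field_simps)
      then show ?thesis using r0 by (metis abs_mult abs_of_nonneg zero_le_power)
    qed
    moreover have "\<zeta> ^ N * \<bar>F T - lam / \<rho> ^ card T\<bar> \<le> \<rho> ^ card T * \<bar>F T - lam / \<rho> ^ card T\<bar>"
      using pw[OF order_refl] by (intro mult_right_mono) auto
    ultimately have "\<zeta> ^ N * \<bar>F T - lam / \<rho> ^ card T\<bar> \<le> 2 * (\<theta> / \<zeta> ^ N)" by linarith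
    then have "\<bar>F T - lam / \<rho> ^ card T\<bar> \<le> 2 * \<theta> / \<zeta> ^ (2 * N)"
      unfolding zz using zN by (simp add: field_simps)
    then show ?thesis using True by simp
  qed
qed

section \<open>The structure result in terms of subsets\<close>

lemma approx_solutions_AND:
  assumes zeta: "0 < \<zeta>" "\<zeta> \<le> 1 / 4" and eps: "0 < \<epsilon>" and N: "16 / \<zeta>\<^sup>2 \<le> real N"
  shows "\<exists>\<eta>>0. \<forall>(A :: 'a set) p \<rho> lam f g.
    approx_solution \<zeta> \<eta> A p \<rho> lam f g \<longrightarrow>
    (bexp (\<rho> * p) A f \<le> \<epsilon> \<and> bexp p A g \<le> \<epsilon>) \<or>
    (\<exists>T\<subseteq>A. card T \<le> N \<and> bexp p A (\<lambda>X. \<bar>g X - of_bool (T \<subseteq> X)\<bar>) \<le> \<epsilon> \<and>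
       bexp (\<rho> * p) T (\<lambda>R. \<bar>bexp (\<rho> * p) (A - T) (\<lambda>S. f (R \<union> S)) - lam / \<rho> ^ card T * of_bool (T \<subseteq> R)\<bar>) \<le> \<epsilon>)"
proof -
  define z where "z = \<zeta> ^ N"
  have z: "0 < z" "z \<le> 1" using zeta by (auto simp: z_def power_le_one)
  \<comment> \<open>One factor z is lost when the coordinates in T are fixed and two when the noise
    is inverted; the 4 is the 2 of \<open>invert_noise_AND\<close> times the 2 from \<eta> +
    \<open>\<epsilon>1\<close> \<le> 2 \<open>\<epsilon>1\<close>.\<close>
  define \<epsilon>1 where "\<epsilon>1 = \<epsilon> * z ^ 3 / 4"
  have z3: "z ^ 3 \<le> 1" using z by (simp add: power_le_one)
  have e1: "0 < \<epsilon>1" "\<epsilon>1 \<le> \<epsilon> / 4" using eps z mult_left_le[OF z3, of \<epsilon>] by (auto simp: \<epsilon>1_def)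
  obtain \<eta>1 where h: "0 < \<eta>1" "\<forall>(A :: 'a set) p \<rho> lam f g.
    approx_solution \<zeta> \<eta>1 A p \<rho> lam f g \<longrightarrow> \<epsilon>1 \<le> bexp p A g \<longrightarrow>
    (\<exists>T\<subseteq>A. card T \<le> N \<and> bexp p A (\<lambda>X. of_bool (\<not> T \<subseteq> X) * g X) \<le> \<epsilon>1 \<and>
        1 - \<epsilon>1 \<le> bexp p (A - T) (\<lambda>X. g (T \<union> X)))"
    using ex_approx_AND[OF zeta e1(1) N] by blast
  define \<eta> where "\<eta> = min \<eta>1 \<epsilon>1"
  have eta: "0 < \<eta>" "\<eta> \<le> \<eta>1" "\<eta> \<le> \<epsilon>1" using h(1) e1 by (auto simp: \<eta>_def)
  show ?thesis
  proof (intro exI[of _ \<eta>] conjI allI impI eta(1))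
    fix A :: "'a set" and p \<rho> lam f g
    assume "approx_solution \<zeta> \<eta> A p \<rho> lam f g"
    then have A: "finite A" and p: "\<zeta> \<le> p" "p \<le> 1 - \<zeta>" and rho: "\<zeta> \<le> \<rho>" "\<rho> \<le> 1 / 2 - \<zeta>"
      and lam: "\<zeta> \<le> lam" "lam \<le> 1" and f: "\<forall>S. 0 \<le> f S \<and> f S \<le> 1" and g: "\<forall>S. g S \<in> {0, 1 :: real}"
      and k: "bexp p A (\<lambda>X. \<bar>bexp \<rho> X f - lam * g X\<bar>) \<le> \<eta>" by (auto simp: approx_solution_def)
    have p01: "0 \<le> p" "p \<le> 1" using p zeta by auto
    have r01: "0 \<le> \<rho>" "\<rho> \<le> 1" using rho zeta by auto
    have rp: "0 \<le> \<rho> * p" "\<rho> * p \<le> 1" using p01 r01 by (auto simp: mult_le_one)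
    have g01: "0 \<le> g S" "g S \<le> 1" for S using g[rule_format, of S] by auto
    show "(bexp (\<rho> * p) A f \<le> \<epsilon> \<and> bexp p A g \<le> \<epsilon>) \<or>
    (\<exists>T\<subseteq>A. card T \<le> N \<and> bexp p A (\<lambda>X. \<bar>g X - of_bool (T \<subseteq> X)\<bar>) \<le> \<epsilon> \<and>
       bexp (\<rho> * p) T (\<lambda>R. \<bar>bexp (\<rho> * p) (A - T) (\<lambda>S. f (R \<union> S)) - lam / \<rho> ^ card T * of_bool (T \<subseteq> R)\<bar>) \<le> \<epsilon>)"
    proof (cases "\<epsilon>1 \<le> bexp p A g")
      case False
      have "bexp (\<rho> * p) A f = bexp p A (\<lambda>X. bexp \<rho> X f)" using bexp_comp[OF A] by (metis mult.commute)
      also have "\<dots> \<le> bexp p A (\<lambda>X. g X + \<bar>bexp \<rho> X f - lam * g X\<bar>)"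
      proof (rule bexp_mono[OF p01])
        fix X
        have "lam * g X \<le> g X" using lam zeta g01 by (intro mult_left_le_one_le) auto
        then show "bexp \<rho> X f \<le> g X + \<bar>bexp \<rho> X f - lam * g X\<bar>" by linarith
      qed
      also have "\<dots> \<le> \<epsilon>1 + \<eta>" unfolding bexp_add using False k by linarith
      finally show ?thesis using False e1 eta eps by (intro disjI1) linarith
    next
      case True
      then obtain T where T: "T \<subseteq> A" "card T \<le> N" "bexp p A (\<lambda>X. of_bool (\<not> T \<subseteq> X) * g X) \<le> \<epsilon>1"
        "1 - \<epsilon>1 \<le> bexp p (A - T) (\<lambda>X. g (T \<union> X))"
        using h(2)[rule_format, of A p \<rho> lam f g] True A p rho lam f g k eta by (auto simp: approx_solution_def)
      have finT: "finite T" "finite (A - T)" using T A finite_subset by auto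
      have gAND: "bexp p A (\<lambda>X. \<bar>g X - of_bool (T \<subseteq> X)\<bar>) \<le> \<epsilon>"
      proof -
        have "bexp p A (\<lambda>X. \<bar>g X - of_bool (T \<subseteq> X)\<bar>) =
            bexp p A (\<lambda>X. of_bool (\<not> T \<subseteq> X) * g X + of_bool (T \<subseteq> X) * (1 - g X))"
          using g01 by (intro bexp_cong) auto
        also have "\<dots> = bexp p A (\<lambda>X. of_bool (\<not> T \<subseteq> X) * g X) + p ^ card T * bexp p (A - T) (\<lambda>X. 1 - g (T \<union> X))"
          unfolding bexp_add bexp_restrict[OF A T(1)] ..
        also have "p ^ card T * bexp p (A - T) (\<lambda>X. 1 - g (T \<union> X)) \<le> 1 * \<epsilon>1"
          using T(4) finT p01 g01 e1 by (intro mult_mono bexp_nonneg) (auto simp: power_le_one bexp_diff)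
        finally show ?thesis using T(3) e1 eps by linarith
      qed
      define F where "F = (\<lambda>R. bexp (\<rho> * p) (A - T) (\<lambda>S. f (R \<union> S)))"
      define \<theta> where "\<theta> = (\<eta> + \<epsilon>1) / z"
      have near: "\<bar>bexp \<rho> R F - lam * of_bool (T \<subseteq> R)\<bar> \<le> \<theta>" if R: "R \<subseteq> T" for R
      proof -
        have atom: "bexp p (A - T) (\<lambda>S. \<phi> (R \<union> S)) \<le> bexp p A \<phi> / z" if "\<And>S. 0 \<le> \<phi> S" for \<phi>
          unfolding z_def using A T R zeta p that by (intro bexp_atom_le) auto
        \<comment> \<open>Averaging outside T commutes with the noise inside T, so F satisfies on
          the cube of T the same kind of approximate equation, with g averaged as well.\<close>
        have "bexp \<rho> R F = bexp p (A - T) (\<lambda>S. bexp \<rho> (R \<union> S) f)"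
        proof -
          have "bexp p (A - T) (\<lambda>S. bexp \<rho> (R \<union> S) f) = bexp p (A - T) (\<lambda>S. bexp \<rho> R (\<lambda>R'. bexp \<rho> S (\<lambda>S'. f (R' \<union> S'))))"
            using R finT by (intro bexp_cong bexp_union) (auto intro: finite_subset)
          also have "\<dots> = bexp \<rho> R (\<lambda>R'. bexp p (A - T) (\<lambda>S. bexp \<rho> S (\<lambda>S'. f (R' \<union> S'))))"
            by (rule bexp_swap)
          also have "\<dots> = bexp \<rho> R F"
            unfolding F_def using bexp_comp[OF finT(2), of p \<rho>] by (simp add: mult.commute)
          finally show ?thesis by simp
        qed
        then have "bexp \<rho> R F - lam * bexp p (A - T) (\<lambda>S. g (R \<union> S)) = bexp p (A - T) (\<lambda>S. bexp \<rho> (R \<union> S) f - lam * g (R \<union> S))"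
          by (simp add: bexp_diff bexp_cmult)
        also have "\<bar>\<dots>\<bar> \<le> bexp p (A - T) (\<lambda>S. \<bar>bexp \<rho> (R \<union> S) f - lam * g (R \<union> S)\<bar>)"
          by (rule bexp_abs_le[OF p01])
        also have "\<dots> \<le> bexp p A (\<lambda>X. \<bar>bexp \<rho> X f - lam * g X\<bar>) / z"
          by (rule atom) simp
        also have "\<dots> \<le> \<eta> / z" using k z by (intro divide_right_mono) auto
        finally have 1: "\<bar>bexp \<rho> R F - lam * bexp p (A - T) (\<lambda>S. g (R \<union> S))\<bar> \<le> \<eta> / z" .
        have e1z: "\<epsilon>1 \<le> \<epsilon>1 / z" using e1 z by (simp add: field_simps mult_left_le)
        have 2: "\<bar>bexp p (A - T) (\<lambda>S. g (R \<union> S)) - of_bool (T \<subseteq> R)\<bar> \<le> \<epsilon>1 / z"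
        proof (cases "R = T")
          case True
          have "bexp p (A - T) (\<lambda>S. g (T \<union> S)) \<le> 1" using finT p01 g01 by (intro bexp_le_const) auto
          then show ?thesis using True T(4) e1z by simp
        next
          case False
          then have nT: "\<not> T \<subseteq> R" using R by auto
          have "bexp p (A - T) (\<lambda>S. g (R \<union> S)) = bexp p (A - T) (\<lambda>S. of_bool (\<not> T \<subseteq> R \<union> S) * g (R \<union> S))"
          proof (rule bexp_cong)
            fix S assume "S \<subseteq> A - T"
            then have "\<not> T \<subseteq> R \<union> S" using nT by auto
            then show "g (R \<union> S) = of_bool (\<not> T \<subseteq> R \<union> S) * g (R \<union> S)" by simp
          qed
          also have "\<dots> \<le> bexp p A (\<lambda>X. of_bool (\<not> T \<subseteq> X) * g X) / z"
            by (rule atom) (use g01 in auto)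
          also have "\<dots> \<le> \<epsilon>1 / z" using T(3) z by (intro divide_right_mono) auto
          finally show ?thesis using nT p01 g01 by (simp add: bexp_nonneg)
        qed
        have "\<bar>lam * bexp p (A - T) (\<lambda>S. g (R \<union> S)) - lam * of_bool (T \<subseteq> R)\<bar> = lam * \<bar>bexp p (A - T) (\<lambda>S. g (R \<union> S)) - of_bool (T \<subseteq> R)\<bar>"
          using lam zeta by (simp only: right_diff_distrib[symmetric] abs_mult abs_of_nonneg)
        also have "\<dots> \<le> 1 * (\<epsilon>1 / z)" using 2 lam zeta by (intro mult_mono) auto
        finally show ?thesis using 1 unfolding \<theta>_def add_divide_distrib by linarith
      qed
      have th0: "0 \<le> \<theta>" using eta e1 z by (simp add: \<theta>_def)
      have "2 * \<theta> / \<zeta> ^ (2 * N) \<le> \<epsilon>"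
      proof -
        have z2: "\<zeta> ^ (2 * N) = z * z" by (simp add: z_def mult_2 power_add)
        have "\<theta> \<le> 2 * \<epsilon>1 / z" unfolding \<theta>_def using eta z by (intro divide_right_mono) auto
        then have "2 * \<theta> / \<zeta> ^ (2 * N) \<le> 2 * (2 * \<epsilon>1 / z) / (z * z)"
          unfolding z2 using z by (intro divide_right_mono mult_left_mono) auto
        also have "\<dots> = \<epsilon>" unfolding \<epsilon>1_def using z by (simp add: power3_eq_cube)
        finally show ?thesis .
      qed
      then have FR: "\<bar>F R - lam / \<rho> ^ card T * of_bool (T \<subseteq> R)\<bar> \<le> \<epsilon>" if R: "R \<subseteq> T" for R
      proof (rule order_trans[rotated])
        have F0: "0 \<le> F S" for S unfolding F_def using f rp by (intro bexp_nonneg) auto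
        have "\<zeta> \<le> 1" using zeta by simp
        from invert_noise_AND[OF finT(1) T(2) zeta(1) this rho(1) r01(2) F0 th0 near R]
        show "\<bar>F R - lam / \<rho> ^ card T * of_bool (T \<subseteq> R)\<bar> \<le> 2 * \<theta> / \<zeta> ^ (2 * N)" .
      qed
      have "bexp (\<rho> * p) T (\<lambda>R. \<bar>F R - lam / \<rho> ^ card T * of_bool (T \<subseteq> R)\<bar>) \<le> \<epsilon>"
        using FR finT rp by (intro bexp_le_const) auto
      then show ?thesis using T gAND unfolding F_def by blast
    qed
  qed
qed

section \<open>Translation between probability mass functions and averages over subsets\<close>

lemma expectation_mu:
  assumes "finite A" "0 \<le> p" "p \<le> 1"
  shows "measure_pmf.expectation (mu A p) \<phi> = bexp p A (\<lambda>S. \<phi> (\<lambda>i. i \<in> S))"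
proof -
  have inj: "inj_on (\<lambda>S i. i \<in> S) (Pow A)" by (intro inj_onI) (auto simp: fun_eq_iff)
  have im: "cube A = (\<lambda>S i. i \<in> S) ` Pow A"
  proof (intro equalityI subsetI)
    fix x assume "x \<in> cube A"
    then have "x = (\<lambda>i. i \<in> {i\<in>A. x i})" by (auto simp: cube_def PiE_dflt_def fun_eq_iff)
    then show "x \<in> (\<lambda>S i. i \<in> S) ` Pow A" by blast
  qed (auto simp: cube_def PiE_dflt_def)
  have fin: "finite (cube A)" unfolding im using assms by simp
  have "measure_pmf.expectation (mu A p) \<phi> = (\<Sum>x\<in>cube A. pmf (mu A p) x *\<^sub>R \<phi> x)"
    using fin by (rule integral_measure_pmf)
      (use set_Pi_pmf_subset[OF assms(1), of False "\<lambda>_. bernoulli_pmf p"] in \<open>auto simp: mu_def cube_def PiE_dflt_def\<close>)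
  also have "\<dots> = (\<Sum>S\<in>Pow A. pmf (mu A p) (\<lambda>i. i \<in> S) * \<phi> (\<lambda>i. i \<in> S))"
    unfolding im by (subst sum.reindex[OF inj]) simp
  also have "\<dots> = bexp p A (\<lambda>S. \<phi> (\<lambda>i. i \<in> S))"
    unfolding bexp_def
  proof (intro sum.cong refl)
    fix S assume "S \<in> Pow A"
    then have S: "S \<subseteq> A" "finite S" using assms finite_subset by auto
    have "pmf (mu A p) (\<lambda>i. i \<in> S) = (\<Prod>i\<in>A. pmf (bernoulli_pmf p) (i \<in> S))"
      unfolding mu_def using S by (subst pmf_Pi'[OF assms(1)]) auto
    also have "\<dots> = (\<Prod>i\<in>S. pmf (bernoulli_pmf p) (i \<in> S)) * (\<Prod>i\<in>A - S. pmf (bernoulli_pmf p) (i \<in> S))"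
      unfolding prod.subset_diff[OF S(1) assms(1)] by (rule mult.commute)
    also have "(\<Prod>i\<in>S. pmf (bernoulli_pmf p) (i \<in> S)) = p ^ card S" using assms by simp
    also have "(\<Prod>i\<in>A - S. pmf (bernoulli_pmf p) (i \<in> S)) = (1 - p) ^ card (A - S)" using assms by simp
    finally show "pmf (mu A p) (\<lambda>i. i \<in> S) * \<phi> (\<lambda>i. i \<in> S) = p ^ card S * (1 - p) ^ card (A - S) * \<phi> (\<lambda>i. i \<in> S)" by simp
  qed
  finally show ?thesis .
qed

text \<open>The noise bits outside X are masked by the zeros of the point and average out.\<close>

lemma noise_down_eq:
  assumes "finite A" "0 \<le> \<rho>" "\<rho> \<le> 1" "X \<subseteq> A"
  shows "noise_down A \<rho> f (\<lambda>i. i \<in> X) = bexp \<rho> X (\<lambda>S. f (\<lambda>i. i \<in> S))"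
proof -
  have X: "finite X" "X \<inter> (A - X) = {}" "X \<union> (A - X) = A" "finite (A - X)" using assms finite_subset by auto
  have "noise_down A \<rho> f (\<lambda>i. i \<in> X) = bexp \<rho> A (\<lambda>Z. f (\<lambda>i. i \<in> X \<and> i \<in> Z))"
    unfolding noise_down_def by (rule expectation_mu[OF assms(1-3)])
  also have "\<dots> = bexp \<rho> X (\<lambda>S. bexp \<rho> (A - X) (\<lambda>R. f (\<lambda>i. i \<in> X \<and> i \<in> S \<union> R)))"
    using bexp_union[OF X(1,4,2), of \<rho> "\<lambda>Z. f (\<lambda>i. i \<in> X \<and> i \<in> Z)"] unfolding X(3) .
  also have "\<dots> = bexp \<rho> X (\<lambda>S. bexp \<rho> (A - X) (\<lambda>R. f (\<lambda>i. i \<in> S)))"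
    by (intro bexp_cong arg_cong[where f = f]) (auto simp: fun_eq_iff)
  finally show ?thesis using X by simp
qed

lemma avg_outside_eq:
  assumes "finite A" "0 \<le> q" "q \<le> 1" "R \<subseteq> T"
  shows "avg_outside A T q f (\<lambda>i. i \<in> R) = bexp q (A - T) (\<lambda>S. f (\<lambda>i. i \<in> R \<union> S))"
  unfolding avg_outside_def using assms
  by (subst expectation_mu) (auto simp: combine_def intro!: bexp_cong arg_cong[where f = f])

lemma eps_close_eq:
  assumes "finite A" "0 \<le> p" "p \<le> 1"
  shows "eps_close A p \<epsilon> h k \<longleftrightarrow> bexp p A (\<lambda>S. \<bar>h (\<lambda>i. i \<in> S) - k (\<lambda>i. i \<in> S)\<bar>) \<le> \<epsilon>"
  unfolding eps_close_def L1_norm_def using expectation_mu[OF assms] by simp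

theorem theorem2p5:
  fixes \<zeta> :: real
  assumes "\<zeta> > 0"
  shows "\<exists>J::nat. \<forall>\<epsilon>::real. \<epsilon> > 0 \<longrightarrow> (\<exists>\<eta>::real. \<eta> > 0 \<and>
    (\<forall>(n::nat) (p::real) (\<rho>::real) (lam::real)
      (f :: (nat \<Rightarrow> bool) \<Rightarrow> real) (g :: (nat \<Rightarrow> bool) \<Rightarrow> real).
      p \<in> {\<zeta>..1 - \<zeta>} \<longrightarrow> \<rho> \<in> {\<zeta>..1/2 - \<zeta>} \<longrightarrow> lam \<in> {\<zeta>..1} \<longrightarrow>
      f \<in> cube {1..n} \<rightarrow> {0..1} \<longrightarrow> g \<in> cube {1..n} \<rightarrow> {0, 1} \<longrightarrow>
      L1_norm {1..n} p (\<lambda>x. noise_down {1..n} \<rho> f x - lam * g x) \<le> \<eta> \<longrightarrow>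
      (eps_close {1..n} (\<rho> * p) \<epsilon> f (\<lambda>_. 0) \<and> eps_close {1..n} p \<epsilon> g (\<lambda>_. 0)) \<or>
      (\<exists>T \<subseteq> {1..n}. card T \<le> J \<and>
        eps_close {1..n} p \<epsilon> g (AND_fun T) \<and>
        eps_close T (\<rho> * p) \<epsilon> (avg_outside {1..n} T (\<rho> * p) f)
          (\<lambda>x. \<rho> powi (- int (card T)) * lam * AND_fun T x))))"
proof (cases "\<zeta> \<le> 1 / 4")
  case False
  \<comment> \<open>For \<zeta> above 1/4 no \<rho> is admissible, so any J and \<eta> will
    do.\<close>
  then have "{\<zeta>..1 / 2 - \<zeta>} = {}" by auto
  then show ?thesis by (auto intro!: exI[of _ "1 :: real"])
next
  case True
  define N where "N = nat \<lceil>16 / \<zeta>\<^sup>2\<rceil>"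
  have N: "16 / \<zeta>\<^sup>2 \<le> real N" unfolding N_def by linarith
  show ?thesis
  proof (intro exI[of _ N] allI impI)
    fix \<epsilon> :: real assume "\<epsilon> > 0"
    from approx_solutions_AND[OF assms True this N, where ?'a = nat] obtain \<eta> where \<eta>: "\<eta> > 0"
      "\<forall>(A :: nat set) p \<rho> lam f g.
    approx_solution \<zeta> \<eta> A p \<rho> lam f g \<longrightarrow>
        (bexp (\<rho> * p) A f \<le> \<epsilon> \<and> bexp p A g \<le> \<epsilon>) \<or>
        (\<exists>T\<subseteq>A. card T \<le> N \<and> bexp p A (\<lambda>X. \<bar>g X - of_bool (T \<subseteq> X)\<bar>) \<le> \<epsilon> \<and>
          bexp (\<rho> * p) T (\<lambda>R. \<bar>bexp (\<rho> * p) (A - T) (\<lambda>S. f (R \<union> S)) - lam / \<rho> ^ card T * of_bool (T \<subseteq> R)\<bar>) \<le> \<epsilon>)"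
      by blast
    show "\<exists>\<eta>::real. \<eta> > 0 \<and>
    (\<forall>(n::nat) (p::real) (\<rho>::real) (lam::real)
      (f :: (nat \<Rightarrow> bool) \<Rightarrow> real) (g :: (nat \<Rightarrow> bool) \<Rightarrow> real).
      p \<in> {\<zeta>..1 - \<zeta>} \<longrightarrow> \<rho> \<in> {\<zeta>..1/2 - \<zeta>} \<longrightarrow> lam \<in> {\<zeta>..1} \<longrightarrow>
      f \<in> cube {1..n} \<rightarrow> {0..1} \<longrightarrow> g \<in> cube {1..n} \<rightarrow> {0, 1} \<longrightarrow>
      L1_norm {1..n} p (\<lambda>x. noise_down {1..n} \<rho> f x - lam * g x) \<le> \<eta> \<longrightarrow>
      (eps_close {1..n} (\<rho> * p) \<epsilon> f (\<lambda>_. 0) \<and> eps_close {1..n} p \<epsilon> g (\<lambda>_. 0)) \<or>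
      (\<exists>T \<subseteq> {1..n}. card T \<le> N \<and>
        eps_close {1..n} p \<epsilon> g (AND_fun T) \<and>
        eps_close T (\<rho> * p) \<epsilon> (avg_outside {1..n} T (\<rho> * p) f)
          (\<lambda>x. \<rho> powi (- int (card T)) * lam * AND_fun T x)))"
    proof (intro exI[of _ \<eta>] conjI allI impI \<eta>(1))
      fix n :: nat and p \<rho> lam :: real and f g :: "(nat \<Rightarrow> bool) \<Rightarrow> real"
      define A where "A = {1..n}"
      assume p: "p \<in> {\<zeta>..1 - \<zeta>}" and rho: "\<rho> \<in> {\<zeta>..1/2 - \<zeta>}" and lam: "lam \<in> {\<zeta>..1}"
        and "f \<in> cube {1..n} \<rightarrow> {0..1}" and "g \<in> cube {1..n} \<rightarrow> {0, 1}"
        and "L1_norm {1..n} p (\<lambda>x. noise_down {1..n} \<rho> f x - lam * g x) \<le> \<eta>"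
      then have f: "f \<in> cube A \<rightarrow> {0..1}" and g: "g \<in> cube A \<rightarrow> {0, 1}"
        and close: "L1_norm A p (\<lambda>x. noise_down A \<rho> f x - lam * g x) \<le> \<eta>" by (auto simp: A_def)
      have A: "finite A" by (simp add: A_def)
      have p01: "0 \<le> p" "p \<le> 1" and r01: "0 \<le> \<rho>" "\<rho> \<le> 1" using p rho assms by auto
      have rp: "0 \<le> \<rho> * p" "\<rho> * p \<le> 1" using p01 r01 by (auto simp: mult_le_one)
      have mem: "(\<lambda>i. i \<in> S) \<in> cube A" if "S \<subseteq> A" for S
        using that by (auto simp: cube_def PiE_dflt_def)
      \<comment> \<open>The hypotheses constrain f and g only on the cube, whereas
        \<open>approx_solution\<close> asks for bounds at every set; outside the subsets of A the
        value 0 is harmless, as no average over subsets of A sees it.\<close>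
      define F where "F = (\<lambda>S. if S \<subseteq> A then f (\<lambda>i. i \<in> S) else 0)"
      define G where "G = (\<lambda>S. if S \<subseteq> A then g (\<lambda>i. i \<in> S) else 0)"
      have F01: "\<forall>S. 0 \<le> F S \<and> F S \<le> 1" using f mem by (auto simp: F_def Pi_iff)
      have G01: "\<forall>S. G S \<in> {0, 1}" using g mem by (auto simp: G_def Pi_iff)
      have "L1_norm A p (\<lambda>x. noise_down A \<rho> f x - lam * g x) = bexp p A (\<lambda>X. \<bar>bexp \<rho> X F - lam * G X\<bar>)"
        unfolding L1_norm_def expectation_mu[OF A p01]
      proof (rule bexp_cong)
        fix X assume X: "X \<subseteq> A"
        have "bexp \<rho> X F = bexp \<rho> X (\<lambda>S. f (\<lambda>i. i \<in> S))"
          using X by (intro bexp_cong) (auto simp: F_def)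
        then show "\<bar>noise_down A \<rho> f (\<lambda>i. i \<in> X) - lam * g (\<lambda>i. i \<in> X)\<bar> = \<bar>bexp \<rho> X F - lam * G X\<bar>"
          using noise_down_eq[OF A r01 X, of f] X by (simp add: G_def)
      qed
      then have "bexp p A (\<lambda>X. \<bar>bexp \<rho> X F - lam * G X\<bar>) \<le> \<eta>" using close by simp
      then consider (zero) "bexp (\<rho> * p) A F \<le> \<epsilon>" "bexp p A G \<le> \<epsilon>"
        | (AND) T where "T \<subseteq> A" "card T \<le> N" "bexp p A (\<lambda>X. \<bar>G X - of_bool (T \<subseteq> X)\<bar>) \<le> \<epsilon>"
          "bexp (\<rho> * p) T (\<lambda>R. \<bar>bexp (\<rho> * p) (A - T) (\<lambda>S. F (R \<union> S)) - lam / \<rho> ^ card T * of_bool (T \<subseteq> R)\<bar>) \<le> \<epsilon>"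
        using \<eta>(2)[THEN spec[of _ A], THEN spec[of _ p], THEN spec[of _ \<rho>], THEN spec[of _ lam],
          THEN spec[of _ F], THEN spec[of _ G]] A p rho lam F01 G01 unfolding approx_solution_def by blast
      then have "(eps_close A (\<rho> * p) \<epsilon> f (\<lambda>_. 0) \<and> eps_close A p \<epsilon> g (\<lambda>_. 0)) \<or>
        (\<exists>T \<subseteq> A. card T \<le> N \<and> eps_close A p \<epsilon> g (AND_fun T) \<and>
          eps_close T (\<rho> * p) \<epsilon> (avg_outside A T (\<rho> * p) f)
            (\<lambda>x. \<rho> powi (- int (card T)) * lam * AND_fun T x))"
      proof cases
        case zero
        have "bexp (\<rho> * p) A (\<lambda>S. \<bar>f (\<lambda>i. i \<in> S) - 0\<bar>) = bexp (\<rho> * p) A F"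
          using F01 by (intro bexp_cong) (auto simp: F_def split: if_splits)
        moreover have "bexp p A (\<lambda>S. \<bar>g (\<lambda>i. i \<in> S) - 0\<bar>) = bexp p A G"
        proof (rule bexp_cong)
          fix S assume "S \<subseteq> A"
          then show "\<bar>g (\<lambda>i. i \<in> S) - 0\<bar> = G S" using G01[rule_format, of S] by (auto simp: G_def)
        qed
        ultimately show ?thesis using zero by (simp add: eps_close_eq[OF A] rp p01)
      next
        case (AND T)
        have T: "finite T" using AND A finite_subset by blast
        have "bexp p A (\<lambda>S. \<bar>g (\<lambda>i. i \<in> S) - AND_fun T (\<lambda>i. i \<in> S)\<bar>) = bexp p A (\<lambda>X. \<bar>G X - of_bool (T \<subseteq> X)\<bar>)"
          by (intro bexp_cong) (auto simp: G_def AND_fun_def subset_iff)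
        moreover have "bexp (\<rho> * p) T (\<lambda>R. \<bar>avg_outside A T (\<rho> * p) f (\<lambda>i. i \<in> R) -
            \<rho> powi (- int (card T)) * lam * AND_fun T (\<lambda>i. i \<in> R)\<bar>) =
          bexp (\<rho> * p) T (\<lambda>R. \<bar>bexp (\<rho> * p) (A - T) (\<lambda>S. F (R \<union> S)) - lam / \<rho> ^ card T * of_bool (T \<subseteq> R)\<bar>)"
        proof (rule bexp_cong)
          fix R assume R: "R \<subseteq> T"
          have "avg_outside A T (\<rho> * p) f (\<lambda>i. i \<in> R) = bexp (\<rho> * p) (A - T) (\<lambda>S. F (R \<union> S))"
            unfolding avg_outside_eq[OF A rp R] using R AND(1) by (intro bexp_cong) (auto simp: F_def)
          moreover have "\<rho> powi (- int (card T)) * lam = lam / \<rho> ^ card T"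
            by (simp add: power_int_minus divide_inverse mult.commute)
          moreover have "AND_fun T (\<lambda>i. i \<in> R) = of_bool (T \<subseteq> R)" by (auto simp: AND_fun_def subset_iff)
          ultimately show "\<bar>avg_outside A T (\<rho> * p) f (\<lambda>i. i \<in> R) -
              \<rho> powi (- int (card T)) * lam * AND_fun T (\<lambda>i. i \<in> R)\<bar> =
            \<bar>bexp (\<rho> * p) (A - T) (\<lambda>S. F (R \<union> S)) - lam / \<rho> ^ card T * of_bool (T \<subseteq> R)\<bar>" by simp
        qed
        ultimately have "eps_close A p \<epsilon> g (AND_fun T)"
          "eps_close T (\<rho> * p) \<epsilon> (avg_outside A T (\<rho> * p) f) (\<lambda>x. \<rho> powi (- int (card T)) * lam * AND_fun T x)"
          using AND(3,4) unfolding eps_close_eq[OF A p01] eps_close_eq[OF T rp] by simp_all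
        then show ?thesis using AND(1,2) by blast
      qed
      then show "(eps_close {1..n} (\<rho> * p) \<epsilon> f (\<lambda>_. 0) \<and> eps_close {1..n} p \<epsilon> g (\<lambda>_. 0)) \<or>
      (\<exists>T \<subseteq> {1..n}. card T \<le> N \<and>
        eps_close {1..n} p \<epsilon> g (AND_fun T) \<and>
        eps_close T (\<rho> * p) \<epsilon> (avg_outside {1..n} T (\<rho> * p) f)
          (\<lambda>x. \<rho> powi (- int (card T)) * lam * AND_fun T x))"
        unfolding A_def .
    qed
  qed
qed

end
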